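(* Let $\Omega$, $\partial\Omega=\partial\Omega_D\cup\partial\Omega_N$ and the constants $\lambda,\delta,\mu_n>0$ be fixed as in the context, and let $U\in H^{3/2}(\partial\Omega_D)$. Then there exists a constant $C_D>0$, depending (for the fixed geometry) only on the Dirichlet boundary datum $U$, such that the following two statements hold. (1) For every bounded weak solution $V_e\in H^1(\Omega)\cap L^\infty(\Omega)$ of the equilibrium Poisson problem $$\lambda^2\Delta V_e=\delta^2 e^{V_e}-C(x)\ \text{ in }\Omega,\qquad V_e=V_{\rm bi}\ \text{ on }\partial\Omega_D,\qquad \nabla V_e\cdot\nu=0\ \text{ on }\partial\Omega_N,$$ (for a doping profile $C$ and built-in potential $V_{\rm bi}$), the corresponding weak solution $\widehat u\in H^1(\Omega)$ of $$\operatorname{div}\big(\mu_n\delta^2 e^{V_e}\nabla\widehat u\big)=0\ \text{ in }\Omega,\qquad \widehat u=U\ \text{ on }\partial\Omega_D,\qquad \nabla\widehat u\cdot\nu=0\ \text{ on }\partial\Omega_N$$ satisfies $$\|\widehat u\|_{H^1(\Omega)}\le C_D\exp\big(2\|V_e\|_{L^\infty(\Omega)}\big).$$ (2) If $V_e^1,V_e^2$ are two bounded weak solutions of the equilibrium Poisson problem (for doping profiles $C_1,C_2$ with corresponding built-in potentials) and $\widehat u_1,\widehat u_2$ are the corresponding weak solutions of the continuity problem in (1), with $V_e$ replaced by $V_e^1$ and $V_e^2$, respectively, and with the same Dirichlet datum $U$, then $$\|\widehat u_1-\widehat u_2\|_{H^1(\Omega)}\le C_D\exp\big(4\max\{\|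V_e^1\|_{L^\infty(\Omega)},\|V_e^2\|_{L^\infty(\Omega)}\}\big)\,\|V_e^1-V_e^2\|_{L^\infty(\Omega)}.$$
   Context: Setting: $\Omega\subset\mathbb{R}^d$ ($d\ge1$) is a bounded domain with Lipschitz boundary and outward unit normal $\nu$. The boundary is partitioned as $\partial\Omega=\partial\Omega_D\cup\partial\Omega_N$, where $\partial\Omega_D=\Gamma_P\cup\Gamma_N$ is the union of two Ohmic contacts (of positive surface measure) and $\partial\Omega_N$ is the insulated part. The constants $\lambda,\delta,\mu_n$ are positive (scaled Debye length, square root of the scaled intrinsic number, electron mobility). The doping profile $C:\Omega\to\mathbb{R}$ is a bounded measurable function and the built-in potential $V_{\rm bi}$ is a bounded function on $\partial\Omega_D$ that is the restriction of the trace of an $H^1(\Omega)$ function (in the device model, $V_{\rm bi}=\operatorname{arsinh}(C/(2\delta^2))$ on $\partial\Omega_D$). The geometry $(\Omega,\partial\Omega_D,\partial\Omega_N)$ is fixed throughout; "depending only on the Dirichlet boundary datum" means that the constant may depend on $U$ and on this fixed geometry but not on $V_e$, $V_e^1$, $V_e^2$, $C$, $C_1$, $C_2$ or $V_{\rm bi}$. The space $H^{3/2}(\partial\Omega_D)$ is understood as the set of restrictions to $\partial\Omega_D$ of traces of functions in $H^2(\Omega)$. Weak solutions: let $H^1_D(\Omega)=\{\phi\in H^1(\Omega):\phi=0\text{ on }\partial\Omega_D\text{ in the sense of traces}\}$. A bounded weak solution of the equilibrium Poisson problem is a function $V_e\in H^1(\Omega)\cap L^\infty(\Omega)$ with trace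 $V_{\rm bi}$ on $\partial\Omega_D$ and $-\lambda^2\int_\Omega\nabla V_e\cdot\nabla\phi\,dx=\int_\Omega(\delta^2e^{V_e}-C)\phi\,dx$ for all $\phi\in H^1_D(\Omega)$. A weak solution of the continuity problem is a function $\widehat u\in H^1(\Omega)$ with trace $U$ on $\partial\Omega_D$ and $\int_\Omega \mu_n\delta^2 e^{V_e}\nabla\widehat u\cdot\nabla\phi\,dx=0$ for all $\phi\in H^1_D(\Omega)$. The norm is $\|u\|_{H^1(\Omega)}^2=\|u\|_{L^2(\Omega)}^2+\|\nabla u\|_{L^2(\Omega)}^2$. *)

theory Defs
  imports "HOL-Analysis.Analysis" "HOL-Probability.Essential_Supremum"
begin

section \<open>Hausdorff and surface measure\<close>

text \<open>The empty set is treated separately because \<^term>\<open>(0::real) ^ 0 = 1\<close>; that convention is what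
  makes the zero-dimensional measure the counting measure.\<close>

definition hausdorff_gauge :: "nat \<Rightarrow> 'a::metric_space set \<Rightarrow> ennreal" where
  "hausdorff_gauge k E =
     (if E = {} then 0 else ennreal (unit_ball_vol (real k) * (diameter E / 2) ^ k))"

definition hausdorff_pre :: "nat \<Rightarrow> real \<Rightarrow> 'a::metric_space set \<Rightarrow> ennreal" where
  "hausdorff_pre k r A =
     (INF E \<in> {E :: nat \<Rightarrow> 'a set. A \<subseteq> (\<Union>i. E i) \<and> (\<forall>i. bounded (E i) \<and> diameter (E i) \<le> r)}.
        \<Sum>i. hausdorff_gauge k (E i))"

definition hausdorff_outer :: "nat \<Rightarrow> 'a::metric_space set \<Rightarrow> ennreal" where
  "hausdorff_outer k A = (SUP r \<in> {0<..}. hausdorff_pre k r A)"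

definition hausdorff_measure :: "nat \<Rightarrow> 'a::metric_space measure" where
  "hausdorff_measure k = measure_of UNIV (sets borel) (hausdorff_outer k)"

text \<open>\<^term>\<open>hausdorff_measure\<close> would be the null measure if the outer measure were not countably
  additive on Borel sets; \<open>emeasure_hausdorff_measure\<close> below shows that it agrees with the outer
  measure.\<close>

lemma hausdorff_pre_le:
  assumes "A \<subseteq> (\<Union>i. E i)" "\<And>i. bounded (E i)" "\<And>i. diameter (E i) \<le> r"
  shows "hausdorff_pre k r A \<le> (\<Sum>i. hausdorff_gauge k (E i))"
  unfolding hausdorff_pre_def by (rule INF_lower) (use assms in auto)

lemma hausdorff_pre_greatest:
  assumes "\<And>E :: nat \<Rightarrow> 'a::metric_space set. A \<subseteq> (\<Union>i. E i) \<Longrightarrow> (\<And>i. bounded (E i)) \<Longrightarrow>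
    (\<And>i. diameter (E i) \<le> r) \<Longrightarrow> c \<le> (\<Sum>i. hausdorff_gauge k (E i))"
  shows "c \<le> hausdorff_pre k r A"
  unfolding hausdorff_pre_def by (rule INF_greatest) (use assms in auto)

lemma hausdorff_pre_mono: "A \<subseteq> B \<Longrightarrow> hausdorff_pre k r A \<le> hausdorff_pre k r B"
  by (rule hausdorff_pre_greatest, rule hausdorff_pre_le) auto

lemma hausdorff_pre_antimono: "r \<le> s \<Longrightarrow> hausdorff_pre k s A \<le> hausdorff_pre k r A"
  by (rule hausdorff_pre_greatest, rule hausdorff_pre_le) (auto intro: order_trans)

lemma hausdorff_pre_le_outer: "0 < r \<Longrightarrow> hausdorff_pre k r A \<le> hausdorff_outer k A"
  unfolding hausdorff_outer_def by (rule SUP_upper) auto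

lemma hausdorff_pre_UN:
  fixes A :: "nat \<Rightarrow> 'a::metric_space set"
  shows "hausdorff_pre k r (\<Union>n. A n) \<le> (\<Sum>n. hausdorff_pre k r (A n))"
proof (rule ennreal_le_epsilon)
  fix e :: real assume fin: "(\<Sum>n. hausdorff_pre k r (A n)) < top" and e: "0 < e"
  have lt: "hausdorff_pre k r (A n) < hausdorff_pre k r (A n) + ennreal (e * (1/2) ^ Suc n)" for n
  proof -
    have "hausdorff_pre k r (A n) \<noteq> top"
      using fin ennreal_suminf_lessD[of "\<lambda>n. hausdorff_pre k r (A n)" top n] by auto
    moreover have "0 < ennreal (e * (1/2) ^ Suc n)" using e by simp
    ultimately show ?thesis
      using ennreal_add_left_cancel_less[of "hausdorff_pre k r (A n)" 0] by simp
  qed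
  have "\<exists>E :: nat \<Rightarrow> 'a set. A n \<subseteq> (\<Union>i. E i) \<and> (\<forall>i. bounded (E i) \<and> diameter (E i) \<le> r) \<and>
      (\<Sum>i. hausdorff_gauge k (E i)) \<le> hausdorff_pre k r (A n) + ennreal (e * (1/2) ^ Suc n)" for n
    using lt[of n] unfolding hausdorff_pre_def INF_less_iff
    by (metis (mono_tags, lifting) mem_Collect_eq order_less_imp_le)
  then obtain E :: "nat \<Rightarrow> nat \<Rightarrow> 'a set" where E: "\<And>n. A n \<subseteq> (\<Union>i. E n i)"
    "\<And>n i. bounded (E n i)" "\<And>n i. diameter (E n i) \<le> r"
    "\<And>n. (\<Sum>i. hausdorff_gauge k (E n i)) \<le> hausdorff_pre k r (A n) + ennreal (e * (1/2) ^ Suc n)"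
    by metis
  define G where "G m = (case prod_decode m of (n, i) \<Rightarrow> E n i)" for m
  have cov: "(\<Union>n. A n) \<subseteq> (\<Union>m. G m)"
  proof
    fix x assume "x \<in> (\<Union>n. A n)"
    then obtain n i where "x \<in> E n i" using E(1) by blast
    then have "x \<in> G (prod_encode (n, i))" by (simp add: G_def)
    then show "x \<in> (\<Union>m. G m)" by blast
  qed
  have "hausdorff_pre k r (\<Union>n. A n) \<le> (\<Sum>m. hausdorff_gauge k (G m))"
    by (rule hausdorff_pre_le[OF cov]) (auto simp: G_def E split: prod.split)
  also have "\<dots> = (\<Sum>m. case prod_decode m of (n, i) \<Rightarrow> hausdorff_gauge k (E n i))"
    by (auto simp: G_def split: prod.split intro!: suminf_cong)
  also have "\<dots> = (\<Sum>n. \<Sum>i. hausdorff_gauge k (E n i))"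
    using suminf_ennreal_2dimen[of "\<lambda>n. \<Sum>i. hausdorff_gauge k (E n i)"
        "\<lambda>(n, i). hausdorff_gauge k (E n i)"]
    by (simp add: o_def)
  also have "\<dots> \<le> (\<Sum>n. hausdorff_pre k r (A n) + ennreal (e * (1/2) ^ Suc n))"
    by (intro suminf_le E) auto
  also have "\<dots> = (\<Sum>n. hausdorff_pre k r (A n)) + (\<Sum>n. ennreal (e * (1/2) ^ Suc n))"
    by (rule suminf_add[symmetric]) auto
  also have "(\<Sum>n. ennreal (e * (1/2) ^ Suc n)) = ennreal e"
  proof (rule suminf_ennreal_eq)
    show "(\<lambda>n. e * (1/2) ^ Suc n) sums e"
      using sums_mult[OF power_half_series, of e] by simp
  qed (use e in auto)
  finally show "hausdorff_pre k r (\<Union>n. A n) \<le> (\<Sum>n. hausdorff_pre k r (A n)) + ennreal e" .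
qed

lemma hausdorff_outer_empty: "hausdorff_outer k {} = 0"
proof -
  have "hausdorff_pre k r ({}::'a set) \<le> 0" if "0 < r" for r
    using hausdorff_pre_le[of "{}::'a set" "\<lambda>_. {}" r k] that
    by (simp add: hausdorff_gauge_def)
  then show ?thesis unfolding hausdorff_outer_def
    by (metis (no_types, lifting) SUP_least greaterThan_iff le_zero_eq)
qed

lemma hausdorff_outer_mono: "A \<subseteq> B \<Longrightarrow> hausdorff_outer k A \<le> hausdorff_outer k B"
  unfolding hausdorff_outer_def by (intro SUP_mono) (use hausdorff_pre_mono in blast)

lemma hausdorff_outer_UN: "hausdorff_outer k (\<Union>n::nat. A n) \<le> (\<Sum>n. hausdorff_outer k (A n))"
  unfolding hausdorff_outer_def[of k "\<Union>n. A n"]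
proof (rule SUP_least)
  fix r :: real assume "r \<in> {0<..}"
  then have "(\<Sum>n. hausdorff_pre k r (A n)) \<le> (\<Sum>n. hausdorff_outer k (A n))"
    by (intro suminf_le hausdorff_pre_le_outer) auto
  with hausdorff_pre_UN show "hausdorff_pre k r (\<Union>n. A n) \<le> (\<Sum>n. hausdorff_outer k (A n))"
    by (rule order_trans)
qed

lemma outer_measure_space_hausdorff:
  "outer_measure_space UNIV (hausdorff_outer k)"
  by (auto simp: outer_measure_space_def positive_def increasing_def countably_subadditive_def
      hausdorff_outer_empty hausdorff_outer_mono hausdorff_outer_UN)

lemma hausdorff_outer_Un:
  fixes A B :: "'a::metric_space set"
  shows "hausdorff_outer k (A \<union> B) \<le> hausdorff_outer k A + hausdorff_outer k B"
proof -
  interpret ring_of_sets UNIV "UNIV :: 'a set set"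
    using ring_of_sets_Pow[of "UNIV :: 'a set"] by simp
  have "subadditive UNIV (hausdorff_outer k :: 'a set \<Rightarrow> ennreal)"
    using outer_measure_space_hausdorff[of k]
    by (intro countably_subadditive_subadditive) (auto simp: outer_measure_space_def)
  then have "hausdorff_outer k (A \<union> (B - A)) \<le> hausdorff_outer k A + hausdorff_outer k (B - A)"
    by (rule subadditiveD) auto
  also have "\<dots> \<le> hausdorff_outer k A + hausdorff_outer k B"
    by (intro add_left_mono hausdorff_outer_mono) auto
  finally show ?thesis by simp
qed

lemma hausdorff_outer_separated:
  assumes d: "0 < d" "\<And>x y. x \<in> A \<Longrightarrow> y \<in> B \<Longrightarrow> d \<le> dist x y"
  shows "hausdorff_outer k A + hausdorff_outer k B \<le> hausdorff_outer k (A \<union> B)"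
proof -
  have le: "hausdorff_pre k r A + hausdorff_pre k r B \<le> hausdorff_pre k r (A \<union> B)"
    if r: "0 < r" "r < d" for r
  proof (rule hausdorff_pre_greatest)
    fix E :: "nat \<Rightarrow> 'a set"
    assume E: "A \<union> B \<subseteq> (\<Union>i. E i)" "\<And>i. bounded (E i)" "\<And>i. diameter (E i) \<le> r"
    define F where "F S i = (if E i \<inter> S = {} then {} else E i)" for S i
    have F: "hausdorff_pre k r S \<le> (\<Sum>i. hausdorff_gauge k (F S i))" if "S \<subseteq> A \<union> B" for S
    proof (rule hausdorff_pre_le)
      show "S \<subseteq> (\<Union>i. F S i)" using that E(1) by (force simp: F_def)
    qed (use E r in \<open>auto simp: F_def\<close>)
    have one: "E i \<inter> A = {} \<or> E i \<inter> B = {}" for i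
    proof (rule ccontr)
      assume "\<not> ?thesis"
      then obtain x y where "x \<in> E i" "x \<in> A" "y \<in> E i" "y \<in> B" by blast
      then show False
        using diameter_bounded_bound[OF E(2), of x i y] d(2)[of x y] E(3)[of i] r by auto
    qed
    have "hausdorff_pre k r A + hausdorff_pre k r B \<le>
        (\<Sum>i. hausdorff_gauge k (F A i)) + (\<Sum>i. hausdorff_gauge k (F B i))"
      by (intro add_mono F) auto
    also have "\<dots> = (\<Sum>i. hausdorff_gauge k (F A i) + hausdorff_gauge k (F B i))"
      by (rule suminf_add) auto
    also have "\<dots> \<le> (\<Sum>i. hausdorff_gauge k (E i))"
      by (intro suminf_le) (use one in \<open>auto simp: F_def hausdorff_gauge_def\<close>)
    finally show "hausdorff_pre k r A + hausdorff_pre k r B \<le> (\<Sum>i. hausdorff_gauge k (E i))" .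
  qed
  have *: "hausdorff_pre k r A + hausdorff_pre k s B \<le> hausdorff_outer k (A \<union> B)"
    if "0 < r" "0 < s" for r s
  proof -
    define t where "t = min (min r s) (d / 2)"
    have t: "0 < t" "t < d" "t \<le> r" "t \<le> s" using that d(1) by (auto simp: t_def min_def)
    have "hausdorff_pre k r A + hausdorff_pre k s B \<le> hausdorff_pre k t A + hausdorff_pre k t B"
      by (intro add_mono hausdorff_pre_antimono t)
    also have "\<dots> \<le> hausdorff_pre k t (A \<union> B)" by (rule le) (use t in auto)
    also have "\<dots> \<le> hausdorff_outer k (A \<union> B)" by (rule hausdorff_pre_le_outer) (use t in auto)
    finally show ?thesis .
  qed
  have ne: "{0::real<..} \<noteq> {}" by (auto intro: exI[of _ 1])
  have "hausdorff_outer k A + hausdorff_outer k B =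
      (SUP r\<in>{0<..}. SUP s\<in>{0<..}. hausdorff_pre k r A + hausdorff_pre k s B)"
    unfolding hausdorff_outer_def
    by (simp add: ennreal_SUP_add_left[OF ne, symmetric] ennreal_SUP_add_right[OF ne, symmetric])
  also have "\<dots> \<le> hausdorff_outer k (A \<union> B)" by (intro SUP_least *) auto
  finally show ?thesis .
qed

lemma hausdorff_outer_closed:
  fixes F :: "'a::metric_space set"
  assumes F: "closed F"
  shows "hausdorff_outer k (A \<inter> F) + hausdorff_outer k (A - F) \<le> hausdorff_outer k A"
proof (cases "F = {} \<or> hausdorff_outer k A = top")
  case True
  then show ?thesis by (auto simp: hausdorff_outer_empty)
next
  case False
  then have ne: "F \<noteq> {}" and fin: "hausdorff_outer k A < top"
    by (auto simp: top.not_eq_extremum)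
  let ?\<mu> = "hausdorff_outer k :: 'a set \<Rightarrow> ennreal"
  define q :: "nat \<Rightarrow> real" where "q n = 1 / Suc n" for n
  have q: "q n \<le> q m" "0 < q n" if "m \<le> n" for m n using that by (auto simp: q_def frac_le)
  have qs: "q (Suc n) < q n" for n by (auto simp: q_def frac_less2)
  define An where "An n = {x \<in> A. q n \<le> infdist x F}" for n
  define R where "R n = {x \<in> A. q (Suc n) \<le> infdist x F \<and> infdist x F < q n}" for n
  have sep: "c \<le> dist x y + infdist y F" if "c \<le> infdist x F" for c x y
    using infdist_triangle[of x F y] that by (simp add: dist_commute)
  have R_sum: "(\<Sum>n<m. ?\<mu> (R (2 * n + j))) \<le> ?\<mu> (\<Union>n<m. R (2 * n + j))" for m j
  proof (induction m)
    case (Suc m)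
    have "(\<Sum>n<Suc m. ?\<mu> (R (2 * n + j))) \<le> ?\<mu> (\<Union>n<m. R (2 * n + j)) + ?\<mu> (R (2 * m + j))"
      using Suc by (simp add: add_right_mono)
    also have "\<dots> \<le> ?\<mu> ((\<Union>n<m. R (2 * n + j)) \<union> R (2 * m + j))"
    proof (cases m)
      case 0
      then show ?thesis by (simp add: hausdorff_outer_empty)
    next
      case (Suc l)
      show ?thesis
      proof (rule hausdorff_outer_separated)
        show "0 < q (Suc (2 * l + j)) - q (2 * m + j)"
          using qs[of "Suc (2 * l + j)"] by (simp add: Suc)
        fix x y assume "x \<in> (\<Union>n<m. R (2 * n + j))" and y: "y \<in> R (2 * m + j)"
        then obtain n where n: "n \<le> l" "x \<in> R (2 * n + j)" by (auto simp: Suc less_Suc_eq_le)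
        then have "q (Suc (2 * l + j)) \<le> infdist x F"
          using q(1)[of "Suc (2 * n + j)" "Suc (2 * l + j)"] by (auto simp: R_def)
        then show "q (Suc (2 * l + j)) - q (2 * m + j) \<le> dist x y"
          using sep[of _ x y] y by (force simp: R_def)
      qed
    qed
    also have "(\<Union>n<m. R (2 * n + j)) \<union> R (2 * m + j) = (\<Union>n<Suc m. R (2 * n + j))"
      by (auto simp: less_Suc_eq)
    finally show ?case .
  qed (simp add: hausdorff_outer_empty)
  have R_fin: "(\<Sum>n. ?\<mu> (R (2 * n + j))) \<le> ?\<mu> A" for j
    by (intro suminf_le_const summableI order_trans[OF R_sum] hausdorff_outer_mono)
       (auto simp: R_def)
  have bound: "?\<mu> (A \<inter> F) + ?\<mu> (A - F) \<le>
      ?\<mu> A + ((\<Sum>i. ?\<mu> (R (2 * (i + n)))) + (\<Sum>i. ?\<mu> (R (2 * (i + n) + 1))))" for n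
  proof -
    have sub: "A - F \<subseteq> An (2 * n) \<union> ((\<Union>i. R (2 * (i + n))) \<union> (\<Union>i. R (2 * (i + n) + 1)))"
    proof
      fix x assume x: "x \<in> A - F"
      then have pos: "0 < infdist x F"
        using F ne by (metis DiffD2 in_closed_iff_infdist_zero infdist_nonneg less_eq_real_def)
      then obtain m0 where "q m0 < infdist x F"
        unfolding q_def using reals_Archimedean by (metis inverse_eq_divide)
      then have ex: "\<exists>m. q m \<le> infdist x F" by (auto intro: less_imp_le)
      define m where "m = (LEAST m. q m \<le> infdist x F)"
      have m: "q m \<le> infdist x F" unfolding m_def by (rule LeastI_ex[OF ex])
      show "x \<in> An (2 * n) \<union> ((\<Union>i. R (2 * (i + n))) \<union> (\<Union>i. R (2 * (i + n) + 1)))"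
      proof (cases "m \<le> 2 * n")
        case True
        then show ?thesis using m q(1)[OF True] x by (auto simp: An_def)
      next
        case False
        then obtain p where p: "m = Suc p" "2 * n \<le> p" by (cases m) auto
        have "\<not> q p \<le> infdist x F" using not_less_Least[of p "\<lambda>m. q m \<le> infdist x F"] p(1) unfolding m_def by linarith
        then have xR: "x \<in> R p" using m x p by (auto simp: R_def)
        have "\<exists>i. p = 2 * (i + n) \<or> p = 2 * (i + n) + 1" using p(2) by presburger
        then obtain i where "p = 2 * (i + n) \<or> p = 2 * (i + n) + 1" ..
        then have "x \<in> R (2 * (i + n)) \<or> x \<in> R (2 * (i + n) + 1)" using xR by metis
        then show ?thesis by blast
      qed
    qed
    have "?\<mu> (A - F) \<le> ?\<mu> (An (2 * n)) +
        ((\<Sum>i. ?\<mu> (R (2 * (i + n)))) + (\<Sum>i. ?\<mu> (R (2 * (i + n) + 1))))"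
      by (intro order_trans[OF hausdorff_outer_mono[OF sub]] order_trans[OF hausdorff_outer_Un]
          add_left_mono add_mono hausdorff_outer_UN)
    then have "?\<mu> (A \<inter> F) + ?\<mu> (A - F) \<le> (?\<mu> (A \<inter> F) + ?\<mu> (An (2 * n))) +
        ((\<Sum>i. ?\<mu> (R (2 * (i + n)))) + (\<Sum>i. ?\<mu> (R (2 * (i + n) + 1))))"
      by (simp add: add.assoc add_left_mono)
    also have "?\<mu> (A \<inter> F) + ?\<mu> (An (2 * n)) \<le> ?\<mu> (A \<inter> F \<union> An (2 * n))"
    proof (rule hausdorff_outer_separated)
      show "0 < q (2 * n)" using q by blast
      fix x y assume "x \<in> A \<inter> F" "y \<in> An (2 * n)"
      then show "q (2 * n) \<le> dist x y"
        using infdist_le[of x F y] by (auto simp: An_def dist_commute)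
    qed
    also have "\<dots> \<le> ?\<mu> A" by (rule hausdorff_outer_mono) (auto simp: An_def)
    finally show ?thesis by (simp add: add_right_mono)
  qed
  have tail: "(\<lambda>n. \<Sum>i. ?\<mu> (R (2 * (i + n) + j))) \<longlonglongrightarrow> 0" for j
  proof -
    let ?f = "\<lambda>n. enn2real (?\<mu> (R (2 * n + j)))"
    have lt: "(\<Sum>n. ?\<mu> (R (2 * n + j))) < top" using R_fin[of j] fin by (rule le_less_trans)
    have eq: "?\<mu> (R (2 * n + j)) = ennreal (?f n)" for n
      using ennreal_suminf_lessD[OF lt, of n] by simp
    have sm: "summable ?f"
    proof (rule summable_suminf_not_top)
      have "(\<Sum>n. ennreal (?f n)) = (\<Sum>n. ?\<mu> (R (2 * n + j)))"
        by (intro suminf_cong eq[symmetric])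
      then show "(\<Sum>n. ennreal (?f n)) \<noteq> top" using lt by simp
    qed auto
    have "(\<Sum>i. ?\<mu> (R (2 * (i + n) + j))) = ennreal (\<Sum>i. ?f (i + n))" for n
    proof -
      have "(\<Sum>i. ?\<mu> (R (2 * (i + n) + j))) = (\<Sum>i. ennreal (?f (i + n)))"
        by (intro suminf_cong eq)
      also have "\<dots> = ennreal (\<Sum>i. ?f (i + n))"
        by (intro suminf_ennreal2 summable_ignore_initial_segment sm) auto
      finally show ?thesis .
    qed
    moreover have "(\<lambda>n. ennreal (\<Sum>i. ?f (i + n))) \<longlonglongrightarrow> ennreal 0"
      by (intro tendsto_ennrealI suminf_exist_split2 sm)
    ultimately show ?thesis by simp
  qed
  have "(\<lambda>n. ?\<mu> A + ((\<Sum>i. ?\<mu> (R (2 * (i + n)))) + (\<Sum>i. ?\<mu> (R (2 * (i + n) + 1)))))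
      \<longlonglongrightarrow> ?\<mu> A + (0 + 0)"
    using tail[of 0] tail[of 1] by (intro tendsto_add tendsto_const) auto
  then show ?thesis
    using LIMSEQ_le_const[of _ "?\<mu> A" "?\<mu> (A \<inter> F) + ?\<mu> (A - F)"] bound by auto
qed

lemma emeasure_hausdorff_measure:
  fixes A :: "'a::metric_space set"
  assumes "A \<in> sets borel"
  shows "emeasure (hausdorff_measure k) A = hausdorff_outer k A"
proof -
  let ?L = "lambda_system UNIV UNIV (hausdorff_outer k :: 'a set \<Rightarrow> ennreal)"
  interpret sigma_algebra UNIV "UNIV :: 'a set set"
    using sigma_algebra_Pow[of "UNIV :: 'a set"] by simp
  have ms: "measure_space UNIV ?L (hausdorff_outer k)"
    by (rule caratheodory_lemma) (rule outer_measure_space_hausdorff)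
  then have L: "sigma_algebra UNIV ?L" by (simp add: measure_space_def)
  have "F \<in> ?L" if "closed F" for F
  proof -
    have "hausdorff_outer k (x \<inter> F) + hausdorff_outer k (x - F) = hausdorff_outer k x" for x
      using hausdorff_outer_closed[OF that, of k x] hausdorff_outer_Un[of k "x \<inter> F" "x - F"]
      by (simp add: Int_Diff_Un)
    then show ?thesis by (simp add: lambda_system_eq)
  qed
  then have "sigma_sets UNIV (Collect closed) \<subseteq> ?L"
    by (intro sigma_algebra.sigma_sets_subset[OF L]) auto
  then have sub: "sets borel \<subseteq> ?L" by (simp add: borel_eq_closed)
  have "positive (sets borel) (hausdorff_outer k :: 'a set \<Rightarrow> ennreal)"
    by (simp add: positive_def hausdorff_outer_empty)
  moreover have "countably_additive (sets borel) (hausdorff_outer k :: 'a set \<Rightarrow> ennreal)"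
    using ms sub unfolding measure_space_def countably_additive_def by (meson order_trans subsetD)
  ultimately show ?thesis
    unfolding hausdorff_measure_def
    by (intro emeasure_measure_of_sigma sets.sigma_algebra_axioms[of borel, simplified] assms)
qed

definition surface_measure :: "'a::euclidean_space set \<Rightarrow> 'a measure" where
  "surface_measure \<Omega> = restrict_space (hausdorff_measure (DIM('a) - 1)) (frontier \<Omega>)"


section \<open>Bounded Lipschitz domains\<close>

text \<open>Near every boundary point, after a rotation sending the last coordinate direction to \<open>e\<close>,
  the set is the region strictly above the graph of a Lipschitz function on the hyperplane
  orthogonal to \<open>e\<close>.\<close>

definition lipschitz_boundary :: "'a::euclidean_space set \<Rightarrow> bool" where
  "lipschitz_boundary \<Omega> \<longleftrightarrow>
     (\<forall>p\<in>frontier \<Omega>. \<exists>r>0. \<exists>e L. \<exists>\<gamma> :: 'a \<Rightarrow> real. norm e = 1 \<and>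
        L-lipschitz_on {y. y \<bullet> e = 0} \<gamma> \<and>
        \<Omega> \<inter> ball p r = {x \<in> ball p r. \<gamma> (x - (x \<bullet> e) *\<^sub>R e) < x \<bullet> e})"

definition bounded_lipschitz_domain :: "'a::euclidean_space set \<Rightarrow> bool" where
  "bounded_lipschitz_domain \<Omega> \<longleftrightarrow>
     open \<Omega> \<and> connected \<Omega> \<and> \<Omega> \<noteq> {} \<and> bounded \<Omega> \<and> lipschitz_boundary \<Omega>"


section \<open>Lebesgue spaces\<close>

definition L2 :: "'a measure \<Rightarrow> ('a \<Rightarrow> 'b::euclidean_space) set" where
  "L2 M = {f \<in> borel_measurable M. integrable M (\<lambda>x. (norm (f x))\<^sup>2)}"

definition L2_norm :: "'a measure \<Rightarrow> ('a \<Rightarrow> 'b::euclidean_space) \<Rightarrow> real" where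
  "L2_norm M f = sqrt (LINT x|M. (norm (f x))\<^sup>2)"

definition Linf :: "'a measure \<Rightarrow> ('a \<Rightarrow> real) set" where
  "Linf M = {f \<in> borel_measurable M. \<exists>K. AE x in M. \<bar>f x\<bar> \<le> K}"

definition Linf_norm :: "'a measure \<Rightarrow> ('a \<Rightarrow> real) \<Rightarrow> real" where
  "Linf_norm M f = real_of_ereal (esssup M (\<lambda>x. ereal \<bar>f x\<bar>))"


section \<open>Sobolev spaces\<close>

primrec Ck :: "nat \<Rightarrow> ('a::euclidean_space \<Rightarrow> real) \<Rightarrow> bool" where
  "Ck 0 f \<longleftrightarrow> continuous_on UNIV f"
| "Ck (Suc k) f \<longleftrightarrow>
     (\<exists>g. (\<forall>x. GDERIV f x :> g x) \<and> (\<forall>b\<in>Basis. Ck k (\<lambda>x. g x \<bullet> b)))"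

definition smooth :: "('a::euclidean_space \<Rightarrow> real) \<Rightarrow> bool" where
  "smooth f \<longleftrightarrow> (\<forall>k. Ck k f)"

definition test_function :: "'a::euclidean_space set \<Rightarrow> ('a \<Rightarrow> real) \<Rightarrow> bool" where
  "test_function \<Omega> \<phi> \<longleftrightarrow>
     smooth \<phi> \<and> compact (closure {x. \<phi> x \<noteq> 0}) \<and> closure {x. \<phi> x \<noteq> 0} \<subseteq> \<Omega>"

definition has_weak_gradient ::
    "'a::euclidean_space set \<Rightarrow> ('a \<Rightarrow> real) \<Rightarrow> ('a \<Rightarrow> 'a) \<Rightarrow> bool" where
  "has_weak_gradient \<Omega> u g \<longleftrightarrow>
     (\<forall>\<phi> \<phi>'. test_function \<Omega> \<phi> \<and> (\<forall>x. GDERIV \<phi> x :> \<phi>' x) \<longrightarrow>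
        (LINT x|lebesgue_on \<Omega>. u x *\<^sub>R \<phi>' x) = - (LINT x|lebesgue_on \<Omega>. \<phi> x *\<^sub>R g x))"

definition H1 :: "'a::euclidean_space set \<Rightarrow> ('a \<Rightarrow> real) set" where
  "H1 \<Omega> = {u \<in> L2 (lebesgue_on \<Omega>). \<exists>g\<in>L2 (lebesgue_on \<Omega>). has_weak_gradient \<Omega> u g}"

text \<open>The weak gradient is unique almost everywhere; a representative is chosen.\<close>

definition weak_gradient :: "'a::euclidean_space set \<Rightarrow> ('a \<Rightarrow> real) \<Rightarrow> 'a \<Rightarrow> 'a" where
  "weak_gradient \<Omega> u = (SOME g. g \<in> L2 (lebesgue_on \<Omega>) \<and> has_weak_gradient \<Omega> u g)"

definition H1_norm :: "'a::euclidean_space set \<Rightarrow> ('a \<Rightarrow> real) \<Rightarrow> real" where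
  "H1_norm \<Omega> u =
     sqrt ((L2_norm (lebesgue_on \<Omega>) u)\<^sup>2 + (L2_norm (lebesgue_on \<Omega>) (weak_gradient \<Omega> u))\<^sup>2)"

definition H2 :: "'a::euclidean_space set \<Rightarrow> ('a \<Rightarrow> real) set" where
  "H2 \<Omega> = {u \<in> H1 \<Omega>. \<forall>b\<in>Basis. (\<lambda>x. weak_gradient \<Omega> u x \<bullet> b) \<in> H1 \<Omega>}"


section \<open>Traces\<close>

text \<open>The trace operator \<open>H\<^sup>1(\<Omega>) \<rightarrow> L\<^sup>2(\<partial>\<Omega>)\<close> is the continuous extension of the restriction map
  \<open>\<phi> \<mapsto> \<phi>|\<^bsub>\<partial>\<Omega>\<^esub>\<close> from functions smooth up to the boundary; here it is given by its graph, the
  closure of the graph of the restriction map.\<close>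

definition has_trace ::
    "'a::euclidean_space set \<Rightarrow> ('a \<Rightarrow> real) \<Rightarrow> ('a \<Rightarrow> real) \<Rightarrow> bool" where
  "has_trace \<Omega> u h \<longleftrightarrow> u \<in> H1 \<Omega> \<and> h \<in> L2 (surface_measure \<Omega>) \<and>
     (\<exists>\<phi> :: nat \<Rightarrow> 'a \<Rightarrow> real. (\<forall>n. smooth (\<phi> n)) \<and>
        (\<lambda>n. H1_norm \<Omega> (\<lambda>x. \<phi> n x - u x)) \<longlonglongrightarrow> 0 \<and>
        (\<lambda>n. L2_norm (surface_measure \<Omega>) (\<lambda>x. \<phi> n x - h x)) \<longlonglongrightarrow> 0)"

definition has_trace_on ::
    "'a::euclidean_space set \<Rightarrow> 'a set \<Rightarrow> ('a \<Rightarrow> real) \<Rightarrow> ('a \<Rightarrow> real) \<Rightarrow> bool" where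
  "has_trace_on \<Omega> D u w \<longleftrightarrow>
     (\<exists>h. has_trace \<Omega> u h \<and> (AE x in surface_measure \<Omega>. x \<in> D \<longrightarrow> h x = w x))"

text \<open>Only the values on \<open>D\<close>, up to null sets, of elements of the next set are relevant.\<close>

definition H32 :: "'a::euclidean_space set \<Rightarrow> 'a set \<Rightarrow> ('a \<Rightarrow> real) set" where
  "H32 \<Omega> D = {w. \<exists>u\<in>H2 \<Omega>. has_trace_on \<Omega> D u w}"

definition H1_D :: "'a::euclidean_space set \<Rightarrow> 'a set \<Rightarrow> ('a \<Rightarrow> real) set" where
  "H1_D \<Omega> D = {\<phi> \<in> H1 \<Omega>. has_trace_on \<Omega> D \<phi> (\<lambda>x. 0)}"


section \<open>The equilibrium Poisson problem and the continuity problem\<close>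

definition device_geometry ::
    "'a::euclidean_space set \<Rightarrow> 'a set \<Rightarrow> 'a set \<Rightarrow> 'a set \<Rightarrow> 'a set \<Rightarrow> bool" where
  "device_geometry \<Omega> D N \<Gamma>P \<Gamma>N \<longleftrightarrow> bounded_lipschitz_domain \<Omega> \<and>
     frontier \<Omega> = D \<union> N \<and> D \<inter> N = {} \<and> D = \<Gamma>P \<union> \<Gamma>N \<and>
     \<Gamma>P \<in> sets borel \<and> \<Gamma>N \<in> sets borel \<and>
     0 < emeasure (surface_measure \<Omega>) \<Gamma>P \<and> 0 < emeasure (surface_measure \<Omega>) \<Gamma>N"

definition doping_profile :: "'a::euclidean_space set \<Rightarrow> ('a \<Rightarrow> real) \<Rightarrow> bool" where
  "doping_profile \<Omega> C \<longleftrightarrow> C \<in> borel_measurable (lebesgue_on \<Omega>) \<and> bounded (C ` \<Omega>)"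

definition builtin_potential ::
    "'a::euclidean_space set \<Rightarrow> 'a set \<Rightarrow> ('a \<Rightarrow> real) \<Rightarrow> bool" where
  "builtin_potential \<Omega> D Vbi \<longleftrightarrow> bounded (Vbi ` D) \<and> (\<exists>w\<in>H1 \<Omega>. has_trace_on \<Omega> D w Vbi)"

definition poisson_weak_solution ::
    "'a::euclidean_space set \<Rightarrow> 'a set \<Rightarrow> real \<Rightarrow> real \<Rightarrow> ('a \<Rightarrow> real) \<Rightarrow> ('a \<Rightarrow> real) \<Rightarrow>
      ('a \<Rightarrow> real) \<Rightarrow> bool" where
  "poisson_weak_solution \<Omega> D lam \<delta> C Vbi V \<longleftrightarrow>
     V \<in> H1 \<Omega> \<and> V \<in> Linf (lebesgue_on \<Omega>) \<and> has_trace_on \<Omega> D V Vbi \<and>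
     (\<forall>\<phi>\<in>H1_D \<Omega> D.
        - lam\<^sup>2 * (LINT x|lebesgue_on \<Omega>. weak_gradient \<Omega> V x \<bullet> weak_gradient \<Omega> \<phi> x) =
        (LINT x|lebesgue_on \<Omega>. (\<delta>\<^sup>2 * exp (V x) - C x) * \<phi> x))"

definition continuity_weak_solution ::
    "'a::euclidean_space set \<Rightarrow> 'a set \<Rightarrow> real \<Rightarrow> real \<Rightarrow> ('a \<Rightarrow> real) \<Rightarrow> ('a \<Rightarrow> real) \<Rightarrow>
      ('a \<Rightarrow> real) \<Rightarrow> bool" where
  "continuity_weak_solution \<Omega> D \<delta> \<mu> V U u \<longleftrightarrow>
     u \<in> H1 \<Omega> \<and> has_trace_on \<Omega> D u U \<and>
     (\<forall>\<phi>\<in>H1_D \<Omega> D.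
        (LINT x|lebesgue_on \<Omega>.
           \<mu> * \<delta>\<^sup>2 * exp (V x) * (weak_gradient \<Omega> u x \<bullet> weak_gradient \<Omega> \<phi> x)) = 0)"

end

theory Submission
  imports Defs
begin

text \<open>
  Let \<open>w\<close> be an \<open>H\<^sup>1\<close> extension of the boundary datum \<open>U\<close>. Testing the continuity equation with
  \<open>u - w\<close>, and the difference of two continuity equations with \<open>u\<^sub>1 - u\<^sub>2\<close>, bounds the gradients
  after Young's inequality, since \<open>exp V\<close> lies between \<open>exp (- m)\<close> and \<open>exp m\<close>. The zeroth order
  part needs a Poincare inequality on the functions whose trace vanishes on \<open>D\<close>. By the definition
  of traces it suffices to bound the \<open>L\<^sup>2\<close> norm of a smooth \<open>f\<close> by its gradient and its values on a
  contact \<open>\<Gamma>\<close>. No compactness in function spaces is used: if a set \<open>A\<close> can be pushed inside \<open>\<Omega>\<close>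
  along a vector into a set \<open>B\<close>, then control of \<open>f\<close> on \<open>B\<close> gives control on \<open>A\<close> by integrating
  along segments. Starting from a ball reached from \<open>\<Gamma>\<close> by transversal segments, this propagates
  to small balls in \<open>\<Omega>\<close> by connectedness, then to boundary neighbourhoods by the Lipschitz charts,
  and compactness of the closure of \<open>\<Omega>\<close> finishes. The only information on the surface measure is
  the upper bound \<open>O(\<rho>\<^bsup>d - 1\<^esup>)\<close> for pieces of Lipschitz graphs of diameter \<open>\<rho>\<close>.
\<close>

section \<open>Smooth functions\<close>

text \<open>A trace is given only as a limit of smooth functions, in \<open>H1_norm\<close> and in
  L2 of the surface at once. The Poincare inequality is therefore stated for smooth \<open>f\<close>
  with a boundary term \<open>f - h\<close>, \<open>h\<close> vanishing on the contact, so that it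
  survives this limit. Moreover \<open>weak_gradient\<close> is a choice: gradients of differences
  can be compared only after uniqueness almost everywhere, the purpose of the bump functions.
  Leaving the contact needs care. Joining a fixed x to all points of a ball brings in a weight |z -
  x|^(1-d), whose integral over the contact can be unbounded near it. So the direction
  \<open>v\<close> is fixed first: on a Lipschitz graph, cubes have small preimages under (x, s) to
  x + s v, and surface measure times ds is carried to a measure below a multiple of Lebesgue
  measure, uniformly for \<open>v\<close> in a ball. Averaging over \<open>v\<close> comes last. If
  m bounds both potentials and d is the norm of V1 - V2, the squared gradient norms of u and u1 - u2
  are at most exp(2m) and exp(6m) d^2 times that of w. In the norms this is exp(m) and exp(3m) d,
  within the exponents 2 and 4 of the theorem.\<close>

lemma GDERIV_unique: "GDERIV f x :> a \<Longrightarrow> GDERIV f x :> b \<Longrightarrow> a = b"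
  unfolding gderiv_def by (metis has_derivative_unique inner_commute vector_eq_rdot)

text \<open>The gradient of a product contains the factors themselves, which must be brought down to
  the order of their gradients before the induction hypothesis for products applies.\<close>

lemma Ck_Suc_imp_Ck: "Ck (Suc k) f \<Longrightarrow> Ck k f"
proof (induction k arbitrary: f)
  case 0
  then obtain g where "\<And>x. GDERIV f x :> g x" by auto
  then show ?case
    by (auto simp: gderiv_def continuous_on_eq_continuous_at intro: has_derivative_continuous)
next
  case (Suc k)
  then show ?case by (metis Ck.simps(2))
qed

lemma Ck_const: "Ck k (\<lambda>x. c)"
proof (induction k arbitrary: c)
  case (Suc k)
  then show ?case using GDERIV_const[of c] by (auto intro!: exI[of _ "\<lambda>x. 0"])
qed auto

lemma Ck_add: "Ck k f \<Longrightarrow> Ck k g \<Longrightarrow> Ck k (\<lambda>x. f x + g x)"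
proof (induction k arbitrary: f g)
  case (Suc k)
  then obtain f' g' where "\<And>x. GDERIV f x :> f' x" "\<And>b. b \<in> Basis \<Longrightarrow> Ck k (\<lambda>x. f' x \<bullet> b)"
    "\<And>x. GDERIV g x :> g' x" "\<And>b. b \<in> Basis \<Longrightarrow> Ck k (\<lambda>x. g' x \<bullet> b)"
    unfolding Ck.simps by blast
  then show ?case
    by (auto intro!: exI[of _ "\<lambda>x. f' x + g' x"] GDERIV_add simp: inner_add_left Suc.IH)
qed (auto intro: continuous_intros)

lemma Ck_mult: "Ck k f \<Longrightarrow> Ck k g \<Longrightarrow> Ck k (\<lambda>x. f x * g x)"
proof (induction k arbitrary: f g)
  case (Suc k)
  then obtain f' g' where d: "\<And>x. GDERIV f x :> f' x" "\<And>b. b \<in> Basis \<Longrightarrow> Ck k (\<lambda>x. f' x \<bullet> b)"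
    "\<And>x. GDERIV g x :> g' x" "\<And>b. b \<in> Basis \<Longrightarrow> Ck k (\<lambda>x. g' x \<bullet> b)"
    unfolding Ck.simps by blast
  have "Ck k f" "Ck k g" using Suc.prems Ck_Suc_imp_Ck by blast+
  with d show ?case
    by (auto intro!: exI[of _ "\<lambda>x. f x *\<^sub>R g' x + g x *\<^sub>R f' x"] GDERIV_mult Ck_add
        simp: inner_add_left Suc.IH)
qed (auto intro: continuous_intros)

lemma smooth_const: "smooth (\<lambda>x. c)"
  and smooth_add: "smooth f \<Longrightarrow> smooth g \<Longrightarrow> smooth (\<lambda>x. f x + g x)"
  and smooth_mult: "smooth f \<Longrightarrow> smooth g \<Longrightarrow> smooth (\<lambda>x. f x * g x)"
  by (auto simp: smooth_def Ck_const Ck_add Ck_mult)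

lemma smooth_diff: "smooth f \<Longrightarrow> smooth g \<Longrightarrow> smooth (\<lambda>x. f x - g x)"
  using smooth_add[of f "\<lambda>x. (- 1) * g x"] smooth_mult[OF smooth_const, of g "- 1"] by simp

lemma smooth_prod: "(\<And>i. i \<in> I \<Longrightarrow> smooth (f i)) \<Longrightarrow> smooth (\<lambda>x. \<Prod>i\<in>I. f i x)"
  by (induction I rule: infinite_finite_induct) (auto intro: smooth_const smooth_mult)

lemma smooth_continuous: "smooth f \<Longrightarrow> continuous_on S f"
  unfolding smooth_def by (metis Ck.simps(1) continuous_on_subset subset_UNIV)

lemma smooth_gradient:
  fixes f :: "'a::euclidean_space \<Rightarrow> real"
  assumes "smooth f"
  shows "\<exists>g. (\<forall>x. GDERIV f x :> g x) \<and> continuous_on UNIV g"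
proof -
  have "Ck (Suc 0) f" using assms by (auto simp: smooth_def)
  then obtain g where g: "\<forall>x. GDERIV f x :> g x"
    "\<forall>b\<in>Basis. continuous_on UNIV (\<lambda>x. g x \<bullet> b)" by auto
  have "continuous_on UNIV (\<lambda>x. \<Sum>b\<in>Basis. (g x \<bullet> b) *\<^sub>R b)"
    using g(2) by (intro continuous_on_sum continuous_on_scaleR continuous_on_const) auto
  then have "continuous_on UNIV g" by (simp add: euclidean_representation)
  with g(1) show ?thesis by metis
qed

section \<open>Smooth bump functions on boxes\<close>

text \<open>With all derivatives of \<open>h 0\<close> given as one sequence, the gradient of
  \<open>h j\<close> along an affine form is \<open>h (Suc j)\<close> times a constant vector, so
  the induction only shifts \<open>j\<close>.\<close>

lemma Ck_compose_affine:
  assumes "\<And>j t. DERIV (h j) t :> h (Suc j) t"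
  shows "Ck k (\<lambda>x. h j (c + x \<bullet> a))"
proof (induction k arbitrary: j)
  case 0
  have "continuous_on UNIV (h j)"
    using assms by (meson DERIV_isCont continuous_at_imp_continuous_on)
  then show ?case by (auto intro!: continuous_on_compose2[of UNIV "h j"] continuous_intros)
next
  case (Suc k)
  have d: "GDERIV (\<lambda>x. c + x \<bullet> a) x :> a" for x
    unfolding gderiv_def by (auto intro!: derivative_eq_intros)
  show ?case
    using GDERIV_DERIV_compose[OF d assms]
    by (auto intro!: exI[of _ "\<lambda>x. h (Suc j) (c + x \<bullet> a) *\<^sub>R a"] Ck_mult Suc Ck_const)
qed

text \<open>The functions \<open>p(1/t) exp(-c/t)\<close> are closed under differentiation.\<close>

definition exp_bump :: "real \<Rightarrow> real poly \<Rightarrow> real \<Rightarrow> real" where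
  "exp_bump c p t = (if t > 0 then poly p (1 / t) * exp (- c / t) else 0)"

text \<open>With y = 1/t, the derivative of p(y) exp(-c y) in t is y^2 (c p(y) - p'(y)) exp(-c y),
  since dy/dt = -y^2. The polynomial \<open>[:0, 0, 1:]\<close> is y^2.\<close>

definition exp_bump_step :: "real \<Rightarrow> real poly \<Rightarrow> real poly" where
  "exp_bump_step c p = [:0, 0, 1:] * (smult c p - pderiv p)"

text \<open>The free exponent \<open>k\<close> carries the induction over the coefficients: removing
  the constant term of the polynomial leaves a factor y, which is added to the power.\<close>

lemma poly_exp_decay:
  fixes c :: real assumes "c > 0"
  shows "((\<lambda>y. y ^ k * poly p y * exp (- c * y)) \<longlongrightarrow> 0) at_top"
proof (induction p arbitrary: k)
  case (pCons a p)
  have "((\<lambda>y. (c * y) ^ k / exp (c * y)) \<longlongrightarrow> 0) at_top"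
    by (rule filterlim_compose[OF tendsto_power_div_exp_0])
       (use assms in \<open>auto intro!: filterlim_tendsto_pos_mult_at_top filterlim_ident\<close>)
  from tendsto_mult[OF tendsto_const[of "a / c ^ k"] this]
  have "((\<lambda>y. a * y ^ k * exp (- c * y)) \<longlongrightarrow> 0) at_top"
    using assms by (simp add: power_mult_distrib exp_minus field_simps)
  from tendsto_add[OF this pCons.IH[of "Suc k"]] show ?case by (simp add: algebra_simps)
qed simp

lemma exp_bump_deriv:
  assumes "c > 0"
  shows "DERIV (exp_bump c p) t :> exp_bump c (exp_bump_step c p) t"
proof -
  consider "t > 0" | "t < 0" | "t = 0" by linarith
  then show ?thesis
  proof cases
    case 1
    define y where "y = 1 / t"
    have inv: "DERIV (\<lambda>t. 1 / t) t :> - (y * y)"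
      using 1 by (auto intro!: derivative_eq_intros simp: y_def)
    have "DERIV (\<lambda>t. poly p (1 / t)) t :> poly (pderiv p) y * - (y * y)"
      unfolding y_def by (rule DERIV_chain2[where f = "poly p" and g = "\<lambda>t. 1 / t", OF poly_DERIV inv[unfolded y_def]])
    moreover have "DERIV (\<lambda>t. exp (- c * (1 / t))) t :> exp (- c * y) * (- c * - (y * y))"
      unfolding y_def by (rule DERIV_chain2[where f = exp and g = "\<lambda>t. - c * (1 / t)", OF DERIV_exp DERIV_cmult[OF inv[unfolded y_def]]])
    ultimately have "DERIV (\<lambda>t. poly p (1 / t) * exp (- c * (1 / t))) t :>
        poly p (1 / t) * (exp (- c * y) * (- c * - (y * y))) + poly (pderiv p) y * - (y * y) * exp (- c * (1 / t))"
      by (rule DERIV_mult')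
    also have "poly p (1 / t) * (exp (- c * y) * (- c * - (y * y))) + poly (pderiv p) y * - (y * y) * exp (- c * (1 / t))
        = exp_bump c (exp_bump_step c p) t"
    proof -
      have y: "1 / t = y" and e: "- c / t = - c * y" by (simp_all add: y_def)
      show ?thesis using 1
        unfolding exp_bump_def exp_bump_step_def y e by (simp add: algebra_simps)
    qed
    finally have "DERIV (\<lambda>t. poly p (1 / t) * exp (- c / t)) t :> exp_bump c (exp_bump_step c p) t"
      by simp
    moreover have "eventually (\<lambda>s. exp_bump c p s = poly p (1 / s) * exp (- c / s)) (nhds t)"
      using eventually_nhds_in_open[of "{0<..}" t] 1
      by (auto elim!: eventually_mono simp: exp_bump_def)
    ultimately show ?thesis by (subst DERIV_cong_ev[OF refl _ refl])
  next
    case 2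
    have "DERIV (\<lambda>t. 0) t :> exp_bump c (exp_bump_step c p) t"
      using 2 by (simp add: exp_bump_def)
    moreover have "eventually (\<lambda>s. exp_bump c p s = 0) (nhds t)"
      using eventually_nhds_in_open[of "{..<0}" t] 2
      by (auto elim!: eventually_mono simp: exp_bump_def)
    ultimately show ?thesis by (subst DERIV_cong_ev[OF refl _ refl])
  next
    case 3
    \<comment> \<open>From the right, the difference quotient at 0 is y p(y) exp(-c y) with y = 1/t,
      the case \<open>k = 1\<close> of \<open>poly_exp_decay\<close>. From the left it is 0.\<close>
    have "((\<lambda>t. (1/t) ^ 1 * poly p (1/t) * exp (- c * (1/t))) \<longlongrightarrow> 0) (at_right 0)"
      by (rule filterlim_compose[OF poly_exp_decay[OF assms]])
         (use filterlim_inverse_at_top_right in \<open>simp add: inverse_eq_divide\<close>)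
    then have r: "((\<lambda>h. exp_bump c p h / h) \<longlongrightarrow> 0) (at_right 0)"
      by (rule Lim_transform_eventually)
         (auto simp: exp_bump_def eventually_at_filter intro!: always_eventually)
    have l: "((\<lambda>h. exp_bump c p h / h) \<longlongrightarrow> 0) (at_left 0)"
      by (rule Lim_transform_eventually[of "\<lambda>_. 0"])
         (auto simp: exp_bump_def eventually_at_filter intro!: always_eventually)
    have "((\<lambda>h. (exp_bump c p (0 + h) - exp_bump c p 0) / h) \<longlongrightarrow> 0) (at 0)"
      using filterlim_split_at[OF l r] by (simp add: exp_bump_def)
    then show ?thesis using 3 by (simp add: DERIV_def exp_bump_def)
  qed
qed

lemma smooth_exp_bump_affine:
  assumes "c > 0" shows "smooth (\<lambda>x. exp_bump c 1 (d + x \<bullet> a))"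
proof -
  have "DERIV (exp_bump c ((exp_bump_step c ^^ j) 1)) t :> exp_bump c ((exp_bump_step c ^^ Suc j) 1) t" for j t
    using exp_bump_deriv[OF assms] by simp
  from Ck_compose_affine[where h = "\<lambda>j. exp_bump c ((exp_bump_step c ^^ j) 1)" and j = 0
      and c = d and a = a, OF this]
  show ?thesis unfolding smooth_def by simp
qed

text \<open>The parameter \<open>c\<close> is kept free because each factor exp(-c/t) with t > 0
  tends to 1 as c tends to 0. The bumps thus fill the whole open box while their support stays the
  same.\<close>

definition box_bump :: "'a::euclidean_space \<Rightarrow> 'a \<Rightarrow> real \<Rightarrow> 'a \<Rightarrow> real" where
  "box_bump a b c x =
     (\<Prod>i\<in>Basis. exp_bump c 1 (x \<bullet> i - a \<bullet> i) * exp_bump c 1 (b \<bullet> i - x \<bullet> i))"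

lemma smooth_box_bump: "c > 0 \<Longrightarrow> smooth (box_bump a b c)"
  unfolding box_bump_def[abs_def]
  using smooth_exp_bump_affine[of c "- (a \<bullet> i)" i for i]
    smooth_exp_bump_affine[of c "b \<bullet> i" "- i" for i]
  by (intro smooth_prod smooth_mult) auto

lemma box_bump_bounds: "c > 0 \<Longrightarrow> 0 \<le> box_bump a b c x \<and> box_bump a b c x \<le> 1"
proof -
  assume c: "c > 0"
  have "0 \<le> exp_bump c 1 t \<and> exp_bump c 1 t \<le> 1" for t
    using c by (simp add: exp_bump_def)
  then show ?thesis unfolding box_bump_def
    by (auto intro!: prod_nonneg prod_le_1 mult_nonneg_nonneg mult_le_one)
qed

lemma box_bump_eq_0_iff: "box_bump a b c x = 0 \<longleftrightarrow> x \<notin> box a b"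
  by (auto simp: box_bump_def exp_bump_def box_def)

lemma test_function_box_bump:
  assumes "c > 0" "cbox a b \<subseteq> \<Omega>"
  shows "test_function \<Omega> (box_bump a b c)"
proof -
  have "{x. box_bump a b c x \<noteq> 0} \<subseteq> cbox a b" by (auto simp: box_bump_eq_0_iff mem_box less_imp_le)
  then have "closure {x. box_bump a b c x \<noteq> 0} \<subseteq> cbox a b"
    by (simp add: closure_minimal closed_cbox)
  then show ?thesis unfolding test_function_def using assms smooth_box_bump
    by (meson bounded_cbox bounded_subset closed_closure compact_eq_bounded_closed order_trans)
qed

lemma box_bump_tendsto_indicator:
  "(\<lambda>n. box_bump a b (1 / real (Suc n)) x) \<longlonglongrightarrow> indicator (box a b) x"
proof (cases "x \<in> box a b")
  case True
  have 1: "(\<lambda>n. exp_bump (1 / real (Suc n)) 1 t) \<longlonglongrightarrow> 1" if "t > 0" for t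
  proof -
    have "(\<lambda>n. exp (- (1 / real (Suc n)) / t)) \<longlonglongrightarrow> exp (- 0 / t)"
      using LIMSEQ_inverse_real_of_nat that by (intro tendsto_intros) (auto simp: inverse_eq_divide)
    then show ?thesis using that by (simp add: exp_bump_def)
  qed
  have "(\<lambda>n. box_bump a b (1 / real (Suc n)) x) \<longlonglongrightarrow> (\<Prod>i\<in>(Basis::'a set). 1 * 1)"
    unfolding box_bump_def using True by (intro tendsto_prod tendsto_mult 1) (auto simp: box_def)
  then show ?thesis using True by simp
next
  case False
  then have "box_bump a b (1 / real (Suc n)) x = 0" for n by (simp add: box_bump_eq_0_iff)
  then show ?thesis using False by simp
qed

section \<open>Square integrable functions\<close>

lemma norm_diff_power2_le:
  fixes a b :: "'a::real_normed_vector"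
  shows "(norm (a - b))\<^sup>2 \<le> 2 * (norm a)\<^sup>2 + 2 * (norm b)\<^sup>2"
proof -
  have "(norm (a - b))\<^sup>2 \<le> (norm a + norm b)\<^sup>2"
    by (intro power_mono norm_triangle_ineq4 norm_ge_zero)
  also have "\<dots> \<le> 2 * (norm a)\<^sup>2 + 2 * (norm b)\<^sup>2"
    using sum_squares_bound[of "norm a" "norm b"] by (simp add: power2_sum)
  finally show ?thesis .
qed

lemma abs_inner_le_squares: "\<bar>a \<bullet> b\<bar> \<le> ((norm a)\<^sup>2 + (norm b)\<^sup>2) / 2"
  using Cauchy_Schwarz_ineq2[of a b] sum_squares_bound[of "norm a" "norm b"] by simp

lemma L2_D:
  assumes "f \<in> L2 M"
  shows "f \<in> borel_measurable M" "integrable M (\<lambda>x. (norm (f x))\<^sup>2)"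
  using assms by (auto simp: L2_def)

lemma L2_norm_power2: "(L2_norm M f)\<^sup>2 = (LINT x|M. (norm (f x))\<^sup>2)"
  by (simp add: L2_norm_def integral_nonneg)

lemma L2_norm_nonneg [simp]: "0 \<le> L2_norm M f"
  by (simp add: L2_norm_def integral_nonneg)

lemma L2_diff:
  assumes "f \<in> L2 M" "g \<in> L2 M"
  shows "(\<lambda>x. f x - g x) \<in> L2 M"
proof -
  note [measurable] = L2_D(1)[OF assms(1)] L2_D(1)[OF assms(2)]
  have "integrable M (\<lambda>x. (norm (f x - g x))\<^sup>2)"
  proof (rule Bochner_Integration.integrable_bound)
    show "integrable M (\<lambda>x. 2 * (norm (f x))\<^sup>2 + 2 * (norm (g x))\<^sup>2)"
      using assms[THEN L2_D(2)] by simp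
  qed (use norm_diff_power2_le in \<open>auto intro!: AE_I2\<close>)
  then show ?thesis by (simp add: L2_def)
qed

text \<open>Integrating \<open>norm_diff_power2_le\<close> is enough for every limit and estimate
  below, where a factor 2 is harmless; the sharp triangle inequality in L2 is never invoked.\<close>

lemma L2_norm_diff_power2_le:
  assumes "f \<in> L2 M" "g \<in> L2 M"
  shows "(L2_norm M (\<lambda>x. f x - g x))\<^sup>2 \<le> 2 * (L2_norm M f)\<^sup>2 + 2 * (L2_norm M g)\<^sup>2"
proof -
  have "(LINT x|M. (norm (f x - g x))\<^sup>2) \<le> (LINT x|M. 2 * (norm (f x))\<^sup>2 + 2 * (norm (g x))\<^sup>2)"
    using L2_D(2)[OF L2_diff[OF assms]] assms[THEN L2_D(2)]
    by (intro integral_mono norm_diff_power2_le) simp_all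
  also have "\<dots> = 2 * (LINT x|M. (norm (f x))\<^sup>2) + 2 * (LINT x|M. (norm (g x))\<^sup>2)"
    using assms[THEN L2_D(2)] by simp
  finally show ?thesis by (simp add: L2_norm_power2)
qed

lemma L2_norm_cong_AE:
  assumes "f \<in> borel_measurable M" "g \<in> borel_measurable M" "AE x in M. f x = g x"
  shows "L2_norm M f = L2_norm M g"
  unfolding L2_norm_def using assms
  by (intro arg_cong[where f = sqrt] integral_cong_AE) auto

lemma L2_bounded:
  assumes "finite_measure M" "f \<in> borel_measurable M" "AE x in M. norm (f x) \<le> K"
  shows "f \<in> L2 M"
proof -
  interpret finite_measure M by fact
  have "integrable M (\<lambda>x. (norm (f x))\<^sup>2)"
    by (rule integrable_const_bound[where B = "K\<^sup>2"])
       (use assms in \<open>auto elim!: eventually_mono intro!: power_mono\<close>)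
  then show ?thesis using assms by (simp add: L2_def)
qed

lemma L2_integrable:
  assumes "finite_measure M" "f \<in> L2 M"
  shows "integrable M f"
proof -
  interpret finite_measure M by fact
  show ?thesis
  proof (rule Bochner_Integration.integrable_bound)
    show "integrable M (\<lambda>x. 1 + (norm (f x))\<^sup>2)" using L2_D[OF assms(2)] by auto
    have "t \<le> 1 + t\<^sup>2" for t :: real
      using zero_le_power2[of "t - 1/2"] by (simp add: power2_eq_square algebra_simps)
    then show "AE x in M. norm (f x) \<le> norm (1 + (norm (f x))\<^sup>2)" by simp
  qed (use L2_D[OF assms(2)] in auto)
qed

lemma integrable_scaleR_bounded:
  fixes f :: "'a \<Rightarrow> real" and g :: "'a \<Rightarrow> 'b::euclidean_space"
  assumes "integrable M f" "g \<in> borel_measurable M" "\<And>x. norm (g x) \<le> K"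
  shows "integrable M (\<lambda>x. f x *\<^sub>R g x)"
proof (rule Bochner_Integration.integrable_bound)
  show "integrable M (\<lambda>x. K * f x)" using assms by auto
  show "(\<lambda>x. f x *\<^sub>R g x) \<in> borel_measurable M" using assms by measurable
  have "0 \<le> K" using assms(3) norm_ge_zero order_trans by blast
  then show "AE x in M. norm (f x *\<^sub>R g x) \<le> norm (K * f x)"
    using assms(3) by (auto intro!: AE_I2 mult_left_mono simp: abs_mult mult.commute[of K])
qed

lemma integrable_bounded_scaleR:
  fixes f :: "'a \<Rightarrow> real" and g :: "'a \<Rightarrow> 'b::euclidean_space"
  assumes "integrable M g" "f \<in> borel_measurable M" "\<And>x. \<bar>f x\<bar> \<le> K"
  shows "integrable M (\<lambda>x. f x *\<^sub>R g x)"
proof (rule Bochner_Integration.integrable_bound)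
  show "integrable M (\<lambda>x. K *\<^sub>R g x)" using assms by auto
  show "(\<lambda>x. f x *\<^sub>R g x) \<in> borel_measurable M" using assms by measurable
  have "0 \<le> K" using assms(3) abs_ge_zero order_trans by blast
  then show "AE x in M. norm (f x *\<^sub>R g x) \<le> norm (K *\<^sub>R g x)"
    using assms(3) by (auto intro!: AE_I2 mult_right_mono)
qed

lemma integrable_weighted_inner:
  assumes "w \<in> borel_measurable M" "AE x in M. \<bar>w x\<bar> \<le> K" "f \<in> L2 M" "g \<in> L2 M"
  shows "integrable M (\<lambda>x. w x * (f x \<bullet> g x))"
proof (rule Bochner_Integration.integrable_bound)
  show "integrable M (\<lambda>x. K * (((norm (f x))\<^sup>2 + (norm (g x))\<^sup>2) / 2))"
    using assms(3,4)[THEN L2_D(2)] by simp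
  show "(\<lambda>x. w x * (f x \<bullet> g x)) \<in> borel_measurable M"
    using assms(1) L2_D(1)[OF assms(3)] L2_D(1)[OF assms(4)] by measurable
  show "AE x in M. norm (w x * (f x \<bullet> g x)) \<le> norm (K * (((norm (f x))\<^sup>2 + (norm (g x))\<^sup>2) / 2))"
    using assms(2)
  proof eventually_elim
    case (elim x)
    have "\<bar>w x\<bar> * \<bar>f x \<bullet> g x\<bar> \<le> \<bar>K\<bar> * \<bar>((norm (f x))\<^sup>2 + (norm (g x))\<^sup>2) / 2\<bar>"
      using elim abs_inner_le_squares[of "f x" "g x"] by (intro mult_mono) auto
    then show ?case by (simp only: real_norm_def abs_mult)
  qed
qed

section \<open>Weak gradients\<close>

text \<open>A Dynkin argument: boxes are stable under intersection and generate the Borel sets, and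
  the sets over which \<open>f\<close> integrates to zero are closed under complements and disjoint
  countable unions. Hence \<open>f\<close> and 0 are densities of the same signed measure.\<close>

lemma AE_zero_if_box_integrals_zero:
  fixes f :: "'a::euclidean_space \<Rightarrow> real"
  assumes f: "integrable lborel f"
    and box: "\<And>a b. (LINT x|lborel. indicator (box a b) x * f x) = 0"
  shows "AE x in lborel. f x = 0"
proof (rule density_unique_real[OF f integrable_zero])
  have int: "integrable lborel (\<lambda>x. indicator A x * f x)" if "A \<in> sets borel" for A
    using integrable_real_mult_indicator[OF _ f, of A] that by (simp add: mult.commute)
  \<comment> \<open>Closure under complements needs the integral over the whole space, which is not
    a box; it is the limit over growing boxes.\<close>
  have total: "(LINT x|lborel. f x) = 0"
  proof -
    let ?B = "\<lambda>n. box (- (real n *\<^sub>R One)) (real n *\<^sub>R One) :: 'a set"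
    have "(\<lambda>n. LINT x|lborel. indicator (?B n) x * f x) \<longlonglongrightarrow> (LINT x|lborel. f x)"
    proof (rule integral_dominated_convergence[where w = "\<lambda>x. norm (f x)"])
      show "AE x in lborel. (\<lambda>n. indicator (?B n) x * f x) \<longlonglongrightarrow> f x"
      proof (rule AE_I2, rule tendsto_eventually)
        fix x :: 'a
        obtain n0 where n0: "norm x < real n0" using reals_Archimedean2 by blast
        have "x \<in> ?B n" if "n \<ge> n0" for n
        proof -
          have "\<bar>x \<bullet> i\<bar> < real n" if "i \<in> Basis" for i
            using Basis_le_norm[OF that, of x] n0 \<open>n \<ge> n0\<close> by linarith
          then show ?thesis by (fastforce simp: mem_box abs_less_iff)
        qed
        then show "\<forall>\<^sub>F n in sequentially. indicator (?B n) x * f x = f x"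
          by (auto simp: eventually_sequentially intro!: exI[of _ n0])
      qed
    qed (use f in \<open>auto simp: indicator_def\<close>)
    then show ?thesis using box by (simp add: LIMSEQ_const_iff)
  qed
  fix A assume "A \<in> sets (lborel :: 'a measure)"
  then have "A \<in> sigma_sets UNIV (range (\<lambda>(a, b). box a b))"
    by (simp add: borel_eq_box)
  then have "(LINT x|lborel. indicator A x * f x) = 0"
  proof (rule sigma_sets_induct_disjoint[where P = "\<lambda>A. (LINT x|lborel. indicator A x * f x) = 0", rotated 2])
    fix A :: "'a set" assume "A \<in> sigma_sets UNIV (range (\<lambda>(a, b). box a b))"
      and 0: "(LINT x|lborel. indicator A x * f x) = 0"
    then have A: "A \<in> sets borel" by (simp add: borel_eq_box)
    have "(LINT x|lborel. indicator (UNIV - A) x * f x)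
        = (LINT x|lborel. f x - indicator A x * f x)"
      by (intro Bochner_Integration.integral_cong) (auto simp: indicator_def)
    also have "\<dots> = 0" using 0 f int[OF A] total by simp
    finally show "(LINT x|lborel. indicator (UNIV - A) x * f x) = 0" .
  next
    fix A :: "nat \<Rightarrow> 'a set" assume disj: "disjoint_family A"
      and "range A \<subseteq> sigma_sets UNIV (range (\<lambda>(a, b). box a b))"
      and 0: "\<And>i. (LINT x|lborel. indicator (A i) x * f x) = 0"
    then have A: "A i \<in> sets borel" for i by (auto simp: borel_eq_box)
    have "(LINT x:(\<Union>i. A i)|lborel. f x) = (\<Sum>i. LINT x:A i|lborel. f x)"
      using disj A int[of "\<Union>i. A i"]
      by (intro lebesgue_integral_countable_add) (auto simp: disjoint_family_on_def set_integrable_def)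
    then show "(LINT x|lborel. indicator (\<Union>i. A i) x * f x) = 0"
      using 0 by (simp add: set_lebesgue_integral_def)
  qed (use box in \<open>auto simp: Int_stable_def box_Int_box\<close>)
  then show "(\<integral>x\<in>A. f x \<partial>lborel) = (\<integral>x\<in>A. 0 \<partial>lborel)"
    by (simp add: set_lebesgue_integral_def)
qed

section \<open>Integration by parts for smooth functions\<close>

lemma DERIV_along_line:
  assumes "\<And>x. GDERIV F x :> G x"
  shows "DERIV (\<lambda>t. F (x + t *\<^sub>R v)) t :> G (x + t *\<^sub>R v) \<bullet> v"
proof -
  have "((\<lambda>t. x + t *\<^sub>R v) has_derivative (\<lambda>h. h *\<^sub>R v)) (at t)"
    by (auto intro!: derivative_eq_intros)
  from has_derivative_compose[OF this assms[unfolded gderiv_def]] show ?thesis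
    unfolding has_field_derivative_def by (rule has_derivative_eq_rhs) (auto simp: inner_commute)
qed

lemma gradient_bound_imp_lipschitz:
  assumes "\<And>x. GDERIV F x :> G x" "\<And>x. norm (G x) \<le> B"
  shows "\<bar>F (x + v) - F x\<bar> \<le> B * norm v"
proof -
  have "norm (F (x + 1 *\<^sub>R v) - F (x + 0 *\<^sub>R v)) \<le> (B * norm v) * norm (1 - 0 :: real)"
  proof (rule field_differentiable_bound[of UNIV])
    fix t :: real
    show "((\<lambda>t. F (x + t *\<^sub>R v)) has_real_derivative G (x + t *\<^sub>R v) \<bullet> v) (at t within UNIV)"
      using DERIV_along_line[OF assms(1)] by simp
    show "norm (G (x + t *\<^sub>R v) \<bullet> v) \<le> B * norm v"
      using order_trans[OF Cauchy_Schwarz_ineq2 mult_right_mono[OF assms(2) norm_ge_zero]] by simp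
  qed auto
  then show ?thesis by simp
qed

lemma gradient_eq_0_on_open:
  assumes "GDERIV F x :> g" "open S" "x \<in> S" "\<And>y. y \<in> S \<Longrightarrow> F y = 0"
  shows "g = 0"
proof -
  have "GDERIV (\<lambda>_. 0) x :> g"
    unfolding gderiv_def
    by (rule has_derivative_transform_within_open[OF assms(1)[unfolded gderiv_def] assms(2-4)])
  then show ?thesis by (rule GDERIV_unique[OF _ GDERIV_const])
qed

lemma bounded_if_compact_support:
  fixes f :: "'a::euclidean_space \<Rightarrow> 'b::real_normed_vector"
  assumes "continuous_on UNIV f" "compact K" "\<And>x. x \<notin> K \<Longrightarrow> f x = 0"
  shows "\<exists>B\<ge>0. \<forall>x. norm (f x) \<le> B"
proof -
  have "bounded (f ` K)"
    using assms by (meson compact_continuous_image compact_imp_bounded continuous_on_subset subset_UNIV)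
  then obtain B where "B > 0" "\<forall>y\<in>f ` K. norm y \<le> B" using bounded_pos by blast
  then have "norm (f x) \<le> B" for x using assms(3)[of x] by (cases "x \<in> K") auto
  then show ?thesis using \<open>B > 0\<close> by (auto intro!: exI[of _ B])
qed

lemma integrable_if_compact_support:
  fixes f :: "'a::euclidean_space \<Rightarrow> 'b::euclidean_space"
  assumes "continuous_on UNIV f" "compact K" "\<And>x. x \<notin> K \<Longrightarrow> f x = 0"
  shows "integrable lborel f"
proof -
  have "integrable lborel (\<lambda>x. indicator K x *\<^sub>R f x)"
    using assms by (intro borel_integrable_compact) (auto intro: continuous_on_subset)
  also have "(\<lambda>x. indicator K x *\<^sub>R f x) = f" using assms(3) by (auto simp: indicator_def)
  finally show ?thesis .
qed

text \<open>The difference quotients have vanishing integral by translation invariance.\<close>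

lemma integral_gradient_zero:
  fixes F :: "'a::euclidean_space \<Rightarrow> real"
  assumes G: "\<And>x. GDERIV F x :> G x" "continuous_on UNIV G"
    and K: "compact K" "\<And>x. x \<notin> K \<Longrightarrow> F x = 0"
  shows "(LINT x|lborel. G x \<bullet> v) = 0"
proof -
  have contF: "continuous_on UNIV F"
    using G(1) by (auto simp: gderiv_def continuous_on_eq_continuous_at intro: has_derivative_continuous)
  have "G x = 0" if "x \<notin> K" for x
    by (rule gradient_eq_0_on_open[OF G(1), of "- K"]) (use K that compact_imp_closed in auto)
  then obtain B where "B \<ge> 0" "\<forall>x. norm (G x) \<le> B"
    using bounded_if_compact_support[OF G(2) K(1)] by blast
  then have B: "B \<ge> 0" "norm (G x) \<le> B" for x by auto
  obtain R where R: "\<And>x. x \<in> K \<Longrightarrow> norm x \<le> R"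
    using compact_imp_bounded[OF K(1)] bounded_iff by blast
  have [measurable]: "F \<in> borel_measurable borel" using contF by (rule borel_measurable_continuous_onI)
  define h where "h n = 1 / real (Suc n)" for n
  have h: "0 < h n" "h n \<le> 1" for n by (auto simp: h_def)
  define D where "D n x = (F (x + h n *\<^sub>R v) - F x) / h n" for n x
  have intF: "integrable lborel F" by (rule integrable_if_compact_support[OF contF K])
  have shift: "integrable lborel (\<lambda>x. F (x + c))" "(LINT x|lborel. F (x + c)) = (LINT x|lborel. F x)" for c
  proof -
    have "integrable (distr lborel borel ((+) c)) F" using intF by (simp only: lborel_distr_plus)
    then show "integrable lborel (\<lambda>x. F (x + c))" by (simp add: integrable_distr_eq add.commute)
    have "(LINT x|distr lborel borel ((+) c). F x) = (LINT x|lborel. F (c + x))"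
      by (rule integral_distr) auto
    then show "(LINT x|lborel. F (x + c)) = (LINT x|lborel. F x)"
      by (simp only: lborel_distr_plus add.commute)
  qed
  have "(\<lambda>n. LINT x|lborel. D n x) \<longlonglongrightarrow> (LINT x|lborel. G x \<bullet> v)"
  proof (rule integral_dominated_convergence)
    show "(\<lambda>x. G x \<bullet> v) \<in> borel_measurable lborel"
      using borel_measurable_continuous_onI[OF G(2)] by simp
    show "D n \<in> borel_measurable lborel" for n
      unfolding D_def by measurable
    \<comment> \<open>The dominating function: the quotients are bounded by the Lipschitz constant
      of \<open>F\<close> in direction \<open>v\<close>, and since \<open>h n \<le> 1\<close> they
      vanish outside the ball of radius \<open>R + norm v\<close>.\<close>
    show "integrable lborel (\<lambda>x::'a. indicator (cball 0 (R + norm v)) x * (B * norm v))"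
      using borel_integrable_compact[OF compact_cball continuous_on_const,
          of 0 "R + norm v" "B * norm v"] by simp
    show "AE x in lborel. (\<lambda>n. D n x) \<longlonglongrightarrow> G x \<bullet> v"
    proof (rule AE_I2)
      fix x
      have "((\<lambda>h. (F (x + (0 + h) *\<^sub>R v) - F (x + 0 *\<^sub>R v)) / h) \<longlongrightarrow> G (x + 0 *\<^sub>R v) \<bullet> v) (at 0)"
        using DERIV_along_line[of F G x v 0] G(1) by (simp add: DERIV_def)
      moreover have "filterlim h (at 0) sequentially"
        using LIMSEQ_inverse_real_of_nat by (auto simp: filterlim_at inverse_eq_divide h_def[abs_def])
      ultimately have "(\<lambda>n. (F (x + (0 + h n) *\<^sub>R v) - F (x + 0 *\<^sub>R v)) / h n)
          \<longlonglongrightarrow> G (x + 0 *\<^sub>R v) \<bullet> v"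
        by (rule filterlim_compose)
      then show "(\<lambda>n. D n x) \<longlonglongrightarrow> G x \<bullet> v" by (simp add: D_def)
    qed
    show "AE x in lborel. norm (D n x) \<le> indicator (cball 0 (R + norm v)) x * (B * norm v)" for n
    proof (rule AE_I2)
      fix x
      show "norm (D n x) \<le> indicator (cball 0 (R + norm v)) x * (B * norm v)"
      proof (cases "x \<in> cball 0 (R + norm v)")
        case True
        have "\<bar>F (x + h n *\<^sub>R v) - F x\<bar> \<le> B * norm (h n *\<^sub>R v)"
          by (rule gradient_bound_imp_lipschitz[of F G B, OF G(1) B(2)])
        then have "\<bar>F (x + h n *\<^sub>R v) - F x\<bar> \<le> (B * norm v) * h n"
          using h[of n] by (simp add: mult_ac)
        then have "\<bar>D n x\<bar> \<le> B * norm v"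
          using h[of n] by (simp add: D_def pos_divide_le_eq)
        then show ?thesis using True by simp
      next
        case False
        then have "R + norm v < norm x" by simp
        moreover have "norm x \<le> norm (x + h n *\<^sub>R v) + norm (h n *\<^sub>R v)"
          using norm_triangle_ineq4[of "x + h n *\<^sub>R v" "h n *\<^sub>R v"] by simp
        moreover have "norm (h n *\<^sub>R v) \<le> norm v"
          using h[of n] by (simp add: mult_left_le_one_le)
        ultimately have "\<not> norm x \<le> R" "\<not> norm (x + h n *\<^sub>R v) \<le> R"
          using norm_ge_zero[of v] by linarith+
        then have "x \<notin> K" "x + h n *\<^sub>R v \<notin> K" using R by blast+
        then show ?thesis using K(2) B by (simp add: D_def)
      qed
    qed
  qed
  moreover have "(LINT x|lborel. D n x) = 0" for n
    using shift[of "h n *\<^sub>R v"] intF by (simp add: D_def)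
  ultimately show ?thesis by (simp add: LIMSEQ_const_iff)
qed

lemma smooth_gradient_continuous:
  fixes \<phi> :: "'a::euclidean_space \<Rightarrow> real"
  assumes "smooth \<phi>" "\<And>x. GDERIV \<phi> x :> g x"
  shows "continuous_on UNIV g"
proof -
  obtain g' where g': "\<forall>x. GDERIV \<phi> x :> g' x" "continuous_on UNIV g'"
    using smooth_gradient[OF assms(1)] by blast
  have "g' = g" by (intro ext GDERIV_unique[OF g'(1)[rule_format] assms(2)])
  then show ?thesis using g'(2) by simp
qed

lemma test_function_gradient:
  assumes "test_function \<Omega> \<phi>" "\<And>x. GDERIV \<phi> x :> \<phi>' x"
  shows "continuous_on UNIV \<phi>" "continuous_on UNIV \<phi>'"
    "\<exists>K. compact K \<and> K \<subseteq> \<Omega> \<and> (\<forall>x. x \<notin> K \<longrightarrow> \<phi> x = 0 \<and> \<phi>' x = 0)"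
proof -
  define K where "K = closure {x. \<phi> x \<noteq> 0}"
  have K: "compact K" "K \<subseteq> \<Omega>" and smooth: "smooth \<phi>"
    using assms(1) by (simp_all add: test_function_def K_def)
  have z: "\<phi> x = 0" if "x \<notin> K" for x
    using that closure_subset[of "{x. \<phi> x \<noteq> 0}"] unfolding K_def by auto
  have op: "open (- K)" using K(1) by (simp add: compact_imp_closed open_Compl)
  have "\<phi>' x = 0" if "x \<notin> K" for x
    by (rule gradient_eq_0_on_open[OF assms(2) op]) (use that z in simp_all)
  with K z show "\<exists>K. compact K \<and> K \<subseteq> \<Omega> \<and> (\<forall>x. x \<notin> K \<longrightarrow> \<phi> x = 0 \<and> \<phi>' x = 0)"
    by (intro exI[of _ K]) simp
  show "continuous_on UNIV \<phi>" "continuous_on UNIV \<phi>'"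
    using smooth_gradient_continuous[OF smooth assms(2)] smooth_continuous[OF smooth] by auto
qed

lemma integral_lebesgue_on_eq_lborel:
  fixes f :: "'a::euclidean_space \<Rightarrow> 'b::euclidean_space"
  assumes "f \<in> borel_measurable borel" "S \<in> sets lebesgue" "\<And>x. x \<notin> S \<Longrightarrow> f x = 0"
  shows "(LINT x|lebesgue_on S. f x) = (LINT x|lborel. f x)"
proof -
  have "(LINT x|lebesgue_on S. f x) = (LINT x|lebesgue. indicator S x *\<^sub>R f x)"
    using assms by (simp add: integral_restrict_space)
  also have "\<dots> = (LINT x|lebesgue. f x)"
    using assms(3) by (intro Bochner_Integration.integral_cong) (auto simp: indicator_def)
  also have "\<dots> = (LINT x|lborel. f x)"
    using assms(1) by (intro integral_completion) simp
  finally show ?thesis .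
qed

text \<open>The product of \<phi> with a test function has compact support, so by
  \<open>integral_gradient_zero\<close> every component of its gradient has integral zero. The
  product rule turns this into the defining identity.\<close>

lemma has_weak_gradient_smooth:
  fixes \<phi> :: "'a::euclidean_space \<Rightarrow> real"
  assumes "smooth \<phi>" "\<And>x. GDERIV \<phi> x :> g x" "\<Omega> \<in> sets lebesgue"
  shows "has_weak_gradient \<Omega> \<phi> g"
  unfolding has_weak_gradient_def
proof (intro allI impI, elim conjE)
  fix \<psi> :: "'a \<Rightarrow> real" and \<psi>' assume test: "test_function \<Omega> \<psi>" and "\<forall>x. GDERIV \<psi> x :> \<psi>' x"
  then have d: "\<And>x. GDERIV \<psi> x :> \<psi>' x" by blast
  note c = test_function_gradient(1,2)[OF test d]
  obtain K where "compact K" "K \<subseteq> \<Omega>" "\<forall>x. x \<notin> K \<longrightarrow> \<psi> x = 0 \<and> \<psi>' x = 0"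
    using test_function_gradient(3)[OF test d] by blast
  then have K: "compact K" "K \<subseteq> \<Omega>" "x \<notin> K \<Longrightarrow> \<psi> x = 0" "x \<notin> K \<Longrightarrow> \<psi>' x = 0" for x
    by auto
  have c\<phi>: "continuous_on UNIV \<phi>" "continuous_on UNIV g"
    using smooth_continuous[OF assms(1)] smooth_gradient_continuous[OF assms(1,2)] by auto
  have c1: "continuous_on UNIV (\<lambda>x. \<phi> x *\<^sub>R \<psi>' x)" and c2: "continuous_on UNIV (\<lambda>x. \<psi> x *\<^sub>R g x)"
    by (intro continuous_on_scaleR c c\<phi>)+
  have i1: "integrable lborel (\<lambda>x. \<phi> x *\<^sub>R \<psi>' x)" and i2: "integrable lborel (\<lambda>x. \<psi> x *\<^sub>R g x)"
    using K by (intro integrable_if_compact_support[OF _ K(1)] c1 c2; simp)+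
  have "(LINT x|lborel. \<phi> x *\<^sub>R \<psi>' x) + (LINT x|lborel. \<psi> x *\<^sub>R g x)
      = (LINT x|lborel. \<phi> x *\<^sub>R \<psi>' x + \<psi> x *\<^sub>R g x)" (is "_ = ?I")
    using i1 i2 by simp
  also have "?I = 0"
  proof (rule euclidean_eqI)
    fix b :: 'a assume "b \<in> Basis"
    have "?I \<bullet> b = (LINT x|lborel. (\<phi> x *\<^sub>R \<psi>' x + \<psi> x *\<^sub>R g x) \<bullet> b)"
      using i1 i2 by (intro integral_inner_left[symmetric]) auto
    also have "\<dots> = 0"
    proof (rule integral_gradient_zero[OF _ _ K(1)])
      show "GDERIV (\<lambda>x. \<phi> x * \<psi> x) x :> \<phi> x *\<^sub>R \<psi>' x + \<psi> x *\<^sub>R g x" for x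
        by (rule GDERIV_mult[OF assms(2) d])
    qed (use K c1 c2 in \<open>auto intro!: continuous_on_add\<close>)
    finally show "?I \<bullet> b = 0 \<bullet> b" by simp
  qed
  finally have "(LINT x|lborel. \<phi> x *\<^sub>R \<psi>' x) = - (LINT x|lborel. \<psi> x *\<^sub>R g x)"
    by (simp add: eq_neg_iff_add_eq_0)
  moreover have "(LINT x|lebesgue_on \<Omega>. \<phi> x *\<^sub>R \<psi>' x) = (LINT x|lborel. \<phi> x *\<^sub>R \<psi>' x)"
    using K by (intro integral_lebesgue_on_eq_lborel borel_measurable_continuous_onI c1 assms(3)) auto
  moreover have "(LINT x|lebesgue_on \<Omega>. \<psi> x *\<^sub>R g x) = (LINT x|lborel. \<psi> x *\<^sub>R g x)"
    using K by (intro integral_lebesgue_on_eq_lborel borel_measurable_continuous_onI c2 assms(3)) auto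
  ultimately show "(LINT x|lebesgue_on \<Omega>. \<phi> x *\<^sub>R \<psi>' x) = - (LINT x|lebesgue_on \<Omega>. \<psi> x *\<^sub>R g x)"
    by simp
qed

section \<open>Uniqueness of weak gradients and calculus in H1\<close>

lemma test_function_gradient_ex: "test_function \<Omega> \<phi> \<Longrightarrow> \<exists>\<phi>'. \<forall>x. GDERIV \<phi> x :> \<phi>' x"
  using smooth_gradient unfolding test_function_def by blast

lemma measurable_lebesgue_on_if_continuous:
  fixes f :: "'a::euclidean_space \<Rightarrow> 'b::euclidean_space"
  assumes "continuous_on UNIV f"
  shows "f \<in> borel_measurable (lebesgue_on \<Omega>)"
  using borel_measurable_continuous_onI[OF assms]
  by (simp add: measurable_completion measurable_restrict_space1)

lemma integrable_test_function:
  fixes g :: "'a::euclidean_space \<Rightarrow> 'a"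
  assumes "\<Omega> \<in> lmeasurable" "test_function \<Omega> \<phi>" "g \<in> L2 (lebesgue_on \<Omega>)"
  shows "integrable (lebesgue_on \<Omega>) (\<lambda>x. \<phi> x *\<^sub>R g x)"
proof -
  obtain \<phi>' where "\<forall>x. GDERIV \<phi> x :> \<phi>' x" using test_function_gradient_ex[OF assms(2)] by blast
  then have d: "GDERIV \<phi> x :> \<phi>' x" for x by blast
  note c = test_function_gradient(1)[OF assms(2) d]
  obtain K where "compact K" "\<forall>x. x \<notin> K \<longrightarrow> \<phi> x = 0"
    using test_function_gradient(3)[OF assms(2) d] by blast
  then obtain B where "\<forall>x. norm (\<phi> x) \<le> B" using bounded_if_compact_support[OF c] by blast
  then show ?thesis
    using L2_integrable[OF finite_measure_lebesgue_on[OF assms(1)] assms(3)] c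
    by (intro integrable_bounded_scaleR[of _ _ _ B] measurable_lebesgue_on_if_continuous) auto
qed

lemma integrable_test_function_gradient:
  fixes u :: "'a::euclidean_space \<Rightarrow> real"
  assumes "\<Omega> \<in> lmeasurable" "test_function \<Omega> \<phi>" "\<And>x. GDERIV \<phi> x :> \<phi>' x" "u \<in> L2 (lebesgue_on \<Omega>)"
  shows "integrable (lebesgue_on \<Omega>) (\<lambda>x. u x *\<^sub>R \<phi>' x)"
proof -
  note c = test_function_gradient(2)[OF assms(2,3)]
  obtain K where "compact K" "\<forall>x. x \<notin> K \<longrightarrow> \<phi>' x = 0"
    using test_function_gradient(3)[OF assms(2,3)] by blast
  then obtain B where "\<forall>x. norm (\<phi>' x) \<le> B" using bounded_if_compact_support[OF c] by blast
  then show ?thesis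
    using L2_integrable[OF finite_measure_lebesgue_on[OF assms(1)] assms(4)] c
    by (intro integrable_scaleR_bounded[of _ _ _ B] measurable_lebesgue_on_if_continuous) auto
qed

lemma has_weak_gradient_diff:
  assumes "\<Omega> \<in> lmeasurable" "u \<in> L2 (lebesgue_on \<Omega>)" "v \<in> L2 (lebesgue_on \<Omega>)"
    "g \<in> L2 (lebesgue_on \<Omega>)" "h \<in> L2 (lebesgue_on \<Omega>)"
    "has_weak_gradient \<Omega> u g" "has_weak_gradient \<Omega> v h"
  shows "has_weak_gradient \<Omega> (\<lambda>x. u x - v x) (\<lambda>x. g x - h x)"
  unfolding has_weak_gradient_def
proof (intro allI impI, elim conjE)
  fix \<phi> \<phi>' assume t: "test_function \<Omega> \<phi>" and d: "\<forall>x. GDERIV \<phi> x :> \<phi>' x"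
  note int = integrable_test_function_gradient[OF assms(1) t d[rule_format]]
    integrable_test_function[OF assms(1) t]
  have "(LINT x|lebesgue_on \<Omega>. u x *\<^sub>R \<phi>' x) = - (LINT x|lebesgue_on \<Omega>. \<phi> x *\<^sub>R g x)"
    "(LINT x|lebesgue_on \<Omega>. v x *\<^sub>R \<phi>' x) = - (LINT x|lebesgue_on \<Omega>. \<phi> x *\<^sub>R h x)"
    using assms(6,7) t d unfolding has_weak_gradient_def by blast+
  then show "(LINT x|lebesgue_on \<Omega>. (u x - v x) *\<^sub>R \<phi>' x) = - (LINT x|lebesgue_on \<Omega>. \<phi> x *\<^sub>R (g x - h x))"
    using int assms(2-5) by (simp add: scaleR_diff_left scaleR_diff_right)
qed

text \<open>The bumps approximate the indicator of a box, and boxes generate the Borel sets.\<close>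

lemma AE_zero_if_orthogonal_to_test_functions:
  fixes g :: "'a::euclidean_space \<Rightarrow> 'a"
  assumes \<Omega>: "open \<Omega>" "\<Omega> \<in> lmeasurable" and g: "g \<in> L2 (lebesgue_on \<Omega>)"
    and orth: "\<And>\<phi>. test_function \<Omega> \<phi> \<Longrightarrow> (LINT x|lebesgue_on \<Omega>. \<phi> x *\<^sub>R g x) = 0"
  shows "AE x in lebesgue_on \<Omega>. g x = 0"
proof -
  have gi: "integrable (lebesgue_on \<Omega>) g"
    by (rule L2_integrable[OF finite_measure_lebesgue_on[OF \<Omega>(2)] g])
  have \<Omega>l: "\<Omega> \<in> sets lebesgue" using \<Omega>(2) by blast
  have gl: "integrable lebesgue (\<lambda>x. indicator \<Omega> x *\<^sub>R g x)"
    using gi \<Omega>l by (simp add: integrable_restrict_space)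
  have box: "(LINT x|lebesgue. indicator (box a b) x *\<^sub>R g x) = 0" if ab: "cbox a b \<subseteq> \<Omega>" for a b
  proof -
    have sub: "box a b \<subseteq> \<Omega>" using ab box_subset_cbox by blast
    have "(\<lambda>n. LINT x|lebesgue_on \<Omega>. box_bump a b (1 / real (Suc n)) x *\<^sub>R g x)
        \<longlonglongrightarrow> (LINT x|lebesgue_on \<Omega>. indicator (box a b) x *\<^sub>R g x)"
    proof (rule integral_dominated_convergence[where w = "\<lambda>x. norm (g x)"])
      have "box a b \<in> sets (lebesgue_on \<Omega>)"
        using \<Omega>l sub by (auto simp: sets_restrict_space_iff)
      then show "(\<lambda>x. indicator (box a b) x *\<^sub>R g x) \<in> borel_measurable (lebesgue_on \<Omega>)"
        using L2_D(1)[OF g] by (intro borel_measurable_scaleR borel_measurable_indicator)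
      show "(\<lambda>x. box_bump a b (1 / real (Suc n)) x *\<^sub>R g x) \<in> borel_measurable (lebesgue_on \<Omega>)" for n
        by (intro borel_measurable_scaleR L2_D(1)[OF g] measurable_lebesgue_on_if_continuous
            smooth_continuous smooth_box_bump) simp
      show "AE x in lebesgue_on \<Omega>. (\<lambda>n. box_bump a b (1 / real (Suc n)) x *\<^sub>R g x)
          \<longlonglongrightarrow> indicator (box a b) x *\<^sub>R g x"
        by (intro AE_I2 tendsto_intros box_bump_tendsto_indicator)
      show "AE x in lebesgue_on \<Omega>. norm (box_bump a b (1 / real (Suc n)) x *\<^sub>R g x) \<le> norm (g x)" for n
        using box_bump_bounds[of "1 / real (Suc n)" a b]
        by (intro AE_I2) (auto intro!: mult_left_le_one_le)
    qed (use gi in auto)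
    moreover have "(LINT x|lebesgue_on \<Omega>. box_bump a b (1 / real (Suc n)) x *\<^sub>R g x) = 0" for n
      by (intro orth test_function_box_bump ab) auto
    ultimately have "(LINT x|lebesgue_on \<Omega>. indicator (box a b) x *\<^sub>R g x) = 0"
      by (simp add: LIMSEQ_const_iff)
    then have "(LINT x|lebesgue. indicator \<Omega> x *\<^sub>R (indicator (box a b) x *\<^sub>R g x)) = 0"
      using \<Omega>l by (simp add: integral_restrict_space)
    also have "(\<lambda>x. indicator \<Omega> x *\<^sub>R (indicator (box a b) x *\<^sub>R g x)) = (\<lambda>x. indicator (box a b) x *\<^sub>R g x)"
      using sub by (auto simp: indicator_def fun_eq_iff)
    finally show ?thesis .
  qed
  have comp: "AE x in lebesgue. x \<in> box p q \<longrightarrow> g x \<bullet> i = 0"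
    if pq: "cbox p q \<subseteq> \<Omega>" and i: "i \<in> Basis" for p q i
  proof -
    have sub: "box p q \<subseteq> \<Omega>" using pq box_subset_cbox by blast
    let ?f = "\<lambda>x. indicator (box p q) x * (g x \<bullet> i)"
    have "integrable lebesgue (\<lambda>x. indicator (box p q) x *\<^sub>R (indicator \<Omega> x *\<^sub>R g x))"
      by (rule integrable_mult_indicator[OF _ gl]) auto
    also have "(\<lambda>x. indicator (box p q) x *\<^sub>R (indicator \<Omega> x *\<^sub>R g x)) = (\<lambda>x. indicator (box p q) x *\<^sub>R g x)"
      using sub by (auto simp: indicator_def fun_eq_iff)
    finally have fi: "integrable lebesgue ?f"
      using integrable_inner_left[of i lebesgue "\<lambda>x. indicator (box p q) x *\<^sub>R g x"] by simp
    then have "?f \<in> borel_measurable (completion lborel)" by auto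
    \<comment> \<open>The box criterion is about \<open>lborel\<close>, whereas \<open>g\<close> is
      only Lebesgue measurable; hence the passage to a Borel representative \<open>f'\<close>, equal
      almost everywhere.\<close>
    then obtain f' where f'[measurable]: "f' \<in> borel_measurable lborel" and eq: "AE x in lborel. ?f x = f' x"
      using completion_ex_borel_measurable_real by blast
    have eql: "AE x in lebesgue. ?f x = f' x" using eq by (rule AE_completion)
    have f'i: "integrable lborel f'"
    proof -
      have "integrable lebesgue f'"
        using integrable_cong_AE[OF _ _ eql] fi f' by (auto simp: measurable_completion)
      then show ?thesis using f' by (simp add: integrable_completion)
    qed
    have "(LINT x|lborel. indicator (box a b) x * f' x) = 0" for a b
    proof -
      obtain c d where cd: "box a b \<inter> box p q = box c d" "cbox c d \<subseteq> cbox p q"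
        using box_Int_box[of a b p q] Int_interval[of a b p q] by (metis Int_lower2)
      have "(LINT x|lborel. indicator (box a b) x * f' x) = (LINT x|lebesgue. indicator (box a b) x * f' x)"
        by (rule integral_completion[symmetric]) simp
      also have "\<dots> = (LINT x|lebesgue. indicator (box a b) x * ?f x)"
      proof (rule integral_cong_AE)
        show "(\<lambda>x. indicator (box a b) x * f' x) \<in> borel_measurable lebesgue"
          by (rule borel_measurable_times[OF borel_measurable_indicator measurable_completion[OF f']]) simp
        show "(\<lambda>x. indicator (box a b) x * ?f x) \<in> borel_measurable lebesgue"
          by (rule borel_measurable_times[OF borel_measurable_indicator borel_measurable_integrable[OF fi]]) simp
        show "AE x in lebesgue. indicator (box a b) x * f' x = indicator (box a b) x * ?f x"
          using eql by eventually_elim simp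
      qed
      also have "\<dots> = (LINT x|lebesgue. (indicator (box c d) x *\<^sub>R g x) \<bullet> i)"
        unfolding cd(1)[symmetric] by (intro Bochner_Integration.integral_cong) (auto simp: indicator_def)
      also have "\<dots> = (LINT x|lebesgue. indicator (box c d) x *\<^sub>R g x) \<bullet> i"
      proof (rule integral_inner_left)
        have "box c d \<subseteq> \<Omega>" using cd(1) sub by blast
        then have "(\<lambda>x. indicator (box c d) x *\<^sub>R (indicator \<Omega> x *\<^sub>R g x)) = (\<lambda>x. indicator (box c d) x *\<^sub>R g x)"
          by (auto simp: indicator_def fun_eq_iff)
        moreover have "integrable lebesgue (\<lambda>x. indicator (box c d) x *\<^sub>R (indicator \<Omega> x *\<^sub>R g x))"
          by (rule integrable_mult_indicator[OF _ gl]) auto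
        ultimately show "integrable lebesgue (\<lambda>x. indicator (box c d) x *\<^sub>R g x)" by simp
      qed
      also have "\<dots> = 0" using box[of c d] cd(2) pq by auto
      finally show ?thesis .
    qed
    then have "AE x in lborel. f' x = 0" by (rule AE_zero_if_box_integrals_zero[OF f'i])
    then have "AE x in lebesgue. f' x = 0" by (rule AE_completion)
    with eql show ?thesis by eventually_elim (auto simp: indicator_def)
  qed
  \<comment> \<open>Countably many closed boxes exhaust \<Omega>. Their faces are null sets, so it
    is enough that \<open>g\<close> vanishes almost everywhere in the open boxes.\<close>
  obtain \<D> where \<D>: "countable \<D>" "\<D> \<subseteq> Pow \<Omega>" "\<And>X. X \<in> \<D> \<Longrightarrow> \<exists>a b. X = cbox a b" "\<Union>\<D> = \<Omega>"
    using open_countable_Union_open_cbox[OF \<Omega>(1)] by metis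
  have "AE x in lebesgue. x \<in> X \<longrightarrow> g x = 0" if "X \<in> \<D>" for X
  proof -
    obtain p q where X: "X = cbox p q" using \<D>(3)[OF \<open>X \<in> \<D>\<close>] by blast
    then have "cbox p q \<subseteq> \<Omega>" using \<D>(2) \<open>X \<in> \<D>\<close> by blast
    then have "AE x in lebesgue. \<forall>i\<in>Basis. x \<in> box p q \<longrightarrow> g x \<bullet> i = 0"
      by (intro AE_finite_allI comp) auto
    moreover have "AE x in lebesgue. x \<notin> cbox p q - box p q"
      using negligible_frontier_interval[of p q] by (intro AE_not_in) (simp add: negligible_iff_null_sets)
    ultimately show ?thesis by eventually_elim (auto simp: X intro!: euclidean_eqI[of "g _"])
  qed
  then have "AE x in lebesgue. \<forall>X\<in>\<D>. x \<in> X \<longrightarrow> g x = 0"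
    by (subst AE_ball_countable[OF \<D>(1)]) blast
  then have "AE x in lebesgue. x \<in> \<Omega> \<longrightarrow> g x = 0"
    by eventually_elim (use \<D>(4) in blast)
  then show ?thesis using \<Omega>l by (simp add: AE_restrict_space_iff)
qed

text \<open>The difference of the two candidates is orthogonal to all test functions. This is what
  makes the choice in \<open>weak_gradient\<close> harmless: any explicitly known weak gradient may
  replace it inside integrals.\<close>

lemma has_weak_gradient_unique:
  fixes g h :: "'a::euclidean_space \<Rightarrow> 'a"
  assumes \<Omega>: "open \<Omega>" "\<Omega> \<in> lmeasurable" and g: "g \<in> L2 (lebesgue_on \<Omega>)" "h \<in> L2 (lebesgue_on \<Omega>)"
    and w: "has_weak_gradient \<Omega> u g" "has_weak_gradient \<Omega> u h"
  shows "AE x in lebesgue_on \<Omega>. g x = h x"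
proof -
  have "AE x in lebesgue_on \<Omega>. g x - h x = 0"
  proof (rule AE_zero_if_orthogonal_to_test_functions[OF \<Omega> L2_diff[OF g]])
    fix \<phi> assume t: "test_function \<Omega> \<phi>"
    obtain \<phi>' where d: "\<forall>x. GDERIV \<phi> x :> \<phi>' x" using test_function_gradient_ex[OF t] by blast
    have "(LINT x|lebesgue_on \<Omega>. u x *\<^sub>R \<phi>' x) = - (LINT x|lebesgue_on \<Omega>. \<phi> x *\<^sub>R g x)"
      "(LINT x|lebesgue_on \<Omega>. u x *\<^sub>R \<phi>' x) = - (LINT x|lebesgue_on \<Omega>. \<phi> x *\<^sub>R h x)"
      using w t d unfolding has_weak_gradient_def by blast+
    then show "(LINT x|lebesgue_on \<Omega>. \<phi> x *\<^sub>R (g x - h x)) = 0"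
      using integrable_test_function[OF \<Omega>(2) t] g by (simp add: scaleR_diff_right)
  qed
  then show ?thesis by simp
qed

lemma H1_weak_gradient:
  assumes "u \<in> H1 \<Omega>"
  shows "u \<in> L2 (lebesgue_on \<Omega>)" "weak_gradient \<Omega> u \<in> L2 (lebesgue_on \<Omega>)"
    "has_weak_gradient \<Omega> u (weak_gradient \<Omega> u)"
proof -
  have "\<exists>g. g \<in> L2 (lebesgue_on \<Omega>) \<and> has_weak_gradient \<Omega> u g" using assms by (auto simp: H1_def)
  from someI_ex[OF this] show "weak_gradient \<Omega> u \<in> L2 (lebesgue_on \<Omega>)"
    "has_weak_gradient \<Omega> u (weak_gradient \<Omega> u)" by (simp_all add: weak_gradient_def)
qed (use assms in \<open>simp add: H1_def\<close>)

lemma weak_gradient_eq: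
  assumes "open \<Omega>" "\<Omega> \<in> lmeasurable" "u \<in> L2 (lebesgue_on \<Omega>)" "g \<in> L2 (lebesgue_on \<Omega>)"
    "has_weak_gradient \<Omega> u g"
  shows "u \<in> H1 \<Omega>" "AE x in lebesgue_on \<Omega>. weak_gradient \<Omega> u x = g x"
proof -
  show *: "u \<in> H1 \<Omega>" using assms by (auto simp: H1_def)
  show "AE x in lebesgue_on \<Omega>. weak_gradient \<Omega> u x = g x"
    by (rule has_weak_gradient_unique[OF assms(1,2) H1_weak_gradient(2)[OF *] assms(4)
          H1_weak_gradient(3)[OF *] assms(5)])
qed

lemma H1_diff:
  assumes "open \<Omega>" "\<Omega> \<in> lmeasurable" "u \<in> H1 \<Omega>" "v \<in> H1 \<Omega>"
  shows "(\<lambda>x. u x - v x) \<in> H1 \<Omega>"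
    "AE x in lebesgue_on \<Omega>. weak_gradient \<Omega> (\<lambda>x. u x - v x) x = weak_gradient \<Omega> u x - weak_gradient \<Omega> v x"
proof -
  note u = H1_weak_gradient[OF assms(3)] and v = H1_weak_gradient[OF assms(4)]
  note * = weak_gradient_eq[OF assms(1,2) L2_diff[OF u(1) v(1)] L2_diff[OF u(2) v(2)]
      has_weak_gradient_diff[OF assms(2) u(1) v(1) u(2) v(2) u(3) v(3)]]
  show "(\<lambda>x. u x - v x) \<in> H1 \<Omega>" by (rule *(1))
  show "AE x in lebesgue_on \<Omega>. weak_gradient \<Omega> (\<lambda>x. u x - v x) x = weak_gradient \<Omega> u x - weak_gradient \<Omega> v x"
    by (rule *(2))
qed

lemma L2_continuous:
  fixes f :: "'a::euclidean_space \<Rightarrow> 'b::euclidean_space"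
  assumes "finite_measure M" "f \<in> borel_measurable M" "continuous_on UNIV f" "space M \<subseteq> K" "compact K"
  shows "f \<in> L2 M"
proof -
  have "bounded (f ` K)"
    using assms(3,5) by (meson compact_continuous_image compact_imp_bounded continuous_on_subset subset_UNIV)
  then obtain B where "\<forall>x\<in>K. norm (f x) \<le> B" unfolding bounded_iff by auto
  then have "AE x in M. norm (f x) \<le> B" using assms(4) by (intro AE_I2) auto
  then show ?thesis by (rule L2_bounded[OF assms(1,2)])
qed

lemma L2_lebesgue_on_continuous:
  fixes f :: "'a::euclidean_space \<Rightarrow> 'b::euclidean_space"
  assumes "bounded \<Omega>" "\<Omega> \<in> lmeasurable" "continuous_on UNIV f"
  shows "f \<in> L2 (lebesgue_on \<Omega>)"
  by (rule L2_continuous[OF finite_measure_lebesgue_on[OF assms(2)]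
        measurable_lebesgue_on_if_continuous[OF assms(3)] assms(3), of "closure \<Omega>"])
     (use assms(1) closure_subset in auto)

lemma H1_smooth:
  assumes "open \<Omega>" "bounded \<Omega>" "smooth \<phi>" "\<And>x. GDERIV \<phi> x :> g x"
  shows "\<phi> \<in> H1 \<Omega>" "AE x in lebesgue_on \<Omega>. weak_gradient \<Omega> \<phi> x = g x"
proof -
  have \<Omega>: "\<Omega> \<in> lmeasurable" using assms by (simp add: lmeasurable_open)
  note L2 = L2_lebesgue_on_continuous[OF assms(2) \<Omega>]
  have "continuous_on UNIV g" by (rule smooth_gradient_continuous[OF assms(3,4)])
  then have "has_weak_gradient \<Omega> \<phi> g" "g \<in> L2 (lebesgue_on \<Omega>)"
    using has_weak_gradient_smooth[OF assms(3,4)] \<Omega> L2 by auto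
  note * = weak_gradient_eq[OF assms(1) \<Omega> L2[OF smooth_continuous[OF assms(3)]] this(2,1)]
  show "\<phi> \<in> H1 \<Omega>" by (rule *(1))
  show "AE x in lebesgue_on \<Omega>. weak_gradient \<Omega> \<phi> x = g x" by (rule *(2))
qed

section \<open>Surface measure of Lipschitz graphs\<close>

lemma space_hausdorff_measure [simp]: "space (hausdorff_measure k) = UNIV"
  by (simp add: hausdorff_measure_def space_measure_of_conv)

lemma sets_hausdorff_measure [simp, measurable_cong]:
  "sets (hausdorff_measure k :: 'a::metric_space measure) = sets borel"
  using sets.sigma_sets_eq[of "borel :: 'a measure"]
  by (simp add: hausdorff_measure_def)

text \<open>A finite family becomes an admissible sequence by padding with the empty set, which
  costs nothing even for \<open>k = 0\<close> because \<open>hausdorff_gauge\<close> treats it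
  separately.\<close>

lemma hausdorff_pre_finite_cover:
  fixes F :: "'i \<Rightarrow> 'a::metric_space set"
  assumes "finite I" "S \<subseteq> (\<Union>i\<in>I. F i)" "0 \<le> r"
    and F: "\<And>i. i \<in> I \<Longrightarrow> bounded (F i)" "\<And>i. i \<in> I \<Longrightarrow> diameter (F i) \<le> r"
  shows "hausdorff_pre k r S \<le> (\<Sum>i\<in>I. hausdorff_gauge k (F i))"
proof -
  obtain h where h: "bij_betw h {0..<card I} I"
    using ex_bij_betw_nat_finite[OF assms(1)] by blast
  define E where "E n = (if n < card I then F (h n) else {})" for n
  have hI: "h n \<in> I" if "n < card I" for n using h that by (auto simp: bij_betw_def)
  have "hausdorff_pre k r S \<le> (\<Sum>n. hausdorff_gauge k (E n))"
  proof (rule hausdorff_pre_le)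
    show "S \<subseteq> (\<Union>n. E n)"
    proof
      fix x assume "x \<in> S"
      then obtain i where i: "i \<in> I" "x \<in> F i" using assms(2) by blast
      then have "i \<in> h ` {0..<card I}" using h by (simp add: bij_betw_def)
      then obtain n where "n < card I" "h n = i" by auto
      then show "x \<in> (\<Union>n. E n)" using i by (auto simp: E_def intro!: exI[of _ n])
    qed
    show "bounded (E n)" "diameter (E n) \<le> r" for n
      using F hI[of n] assms(3) by (auto simp: E_def)
  qed
  also have "\<dots> = (\<Sum>n\<in>{0..<card I}. hausdorff_gauge k (E n))"
    by (rule suminf_finite) (auto simp: E_def hausdorff_gauge_def)
  also have "\<dots> = (\<Sum>n\<in>{0..<card I}. hausdorff_gauge k (F (h n)))"
    by (rule sum.cong) (auto simp: E_def)
  also have "\<dots> = (\<Sum>i\<in>I. hausdorff_gauge k (F i))"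
    by (rule sum.reindex_bij_betw[OF h])
  finally show ?thesis .
qed

text \<open>A grid of \<open>N ^ (d - 1)\<close> cells in the hyperplane orthogonal to \<open>i\<close> is pulled back along \<open>Q\<close>.\<close>

lemma hausdorff_outer_le_if_inverse_lipschitz:
  fixes S :: "'a::euclidean_space set" and Q :: "'a \<Rightarrow> 'a"
  assumes i: "i \<in> Basis" and S: "bounded S" and s: "s > 0" and M: "M > 0"
    and lip: "\<And>x y. x \<in> S \<Longrightarrow> y \<in> S \<Longrightarrow> norm (x - y) \<le> M * norm (Q x - Q y)"
    and flat: "\<And>x. x \<in> S \<Longrightarrow> Q x \<bullet> i = 0"
    and cube: "\<And>x j. x \<in> S \<Longrightarrow> j \<in> Basis \<Longrightarrow> a j \<le> Q x \<bullet> j \<and> Q x \<bullet> j \<le> a j + s"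
  defines "k \<equiv> DIM('a) - 1"
  shows "hausdorff_outer k S \<le> ennreal (unit_ball_vol (real k) * (M * DIM('a) * s / 2) ^ k)"
  unfolding hausdorff_outer_def
proof (rule SUP_least)
  fix r :: real assume "r \<in> {0<..}"
  \<comment> \<open>The image under \<open>Q\<close> of one cell has norm diameter at most
    \<open>DIM('a) * (s / N)\<close>, by comparison with the l1 norm; the inverse Lipschitz constant
    \<open>M\<close> makes this \<open>D / N\<close> in \<open>S\<close>.\<close>
  define D where "D = M * DIM('a) * s"
  have D: "D > 0" using M s by (simp add: D_def)
  obtain n where n: "D / r < real n" using reals_Archimedean2 by blast
  define N where "N = Suc n"
  have N: "D / real N \<le> r" "N > 0"
  proof -
    have "D < real N * r" using n \<open>r \<in> _\<close> by (auto simp: N_def field_simps)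
    then show "D / real N \<le> r" by (simp add: N_def field_simps)
  qed (simp add: N_def)
  define I where "I = PiE (Basis - {i}) (\<lambda>_. {..<N})"
  define F where "F f = {x \<in> S. \<forall>j\<in>Basis - {i}. a j + s * real (f j) / real N \<le> Q x \<bullet> j \<and>
      Q x \<bullet> j \<le> a j + s * (real (f j) + 1) / real N}" for f
  have I: "finite I" "card I = N ^ k"
    using i by (auto simp: I_def k_def card_PiE card_Diff_singleton intro!: finite_PiE)
  have near: "norm (x - y) \<le> D / real N" if "x \<in> F f" "y \<in> F f" for x y f
  proof -
    have xy: "x \<in> S" "y \<in> S" using that by (auto simp: F_def)
    have "\<bar>(Q x - Q y) \<bullet> j\<bar> \<le> s / real N" if "j \<in> Basis" for j
    proof (cases "j = i")
      case True
      then show ?thesis using flat xy s by (simp add: inner_diff_left)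
    next
      case False
      have "s * (real (f j) + 1) / real N = s * real (f j) / real N + s / real N"
        by (simp add: algebra_simps add_divide_distrib)
      moreover have "a j + s * real (f j) / real N \<le> Q x \<bullet> j" "Q x \<bullet> j \<le> a j + s * (real (f j) + 1) / real N"
        "a j + s * real (f j) / real N \<le> Q y \<bullet> j" "Q y \<bullet> j \<le> a j + s * (real (f j) + 1) / real N"
        using \<open>x \<in> F f\<close> \<open>y \<in> F f\<close> False \<open>j \<in> Basis\<close> by (auto simp: F_def)
      ultimately show ?thesis by (simp add: inner_diff_left abs_le_iff)
    qed
    then have "norm (Q x - Q y) \<le> (\<Sum>j\<in>(Basis::'a set). s / real N)"
      by (intro order_trans[OF norm_le_l1] sum_mono) auto
    then have "norm (Q x - Q y) \<le> DIM('a) * (s / real N)" by simp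
    then have "M * norm (Q x - Q y) \<le> M * (DIM('a) * (s / real N))"
      using M by (intro mult_left_mono) auto
    then show ?thesis using lip[OF xy] by (simp add: D_def mult_ac)
  qed
  have diam: "diameter (F f) \<le> D / real N" for f
    by (rule diameter_le) (use near D in auto)
  have "hausdorff_pre k r S \<le> (\<Sum>f\<in>I. hausdorff_gauge k (F f))"
  proof (rule hausdorff_pre_finite_cover[OF I(1)])
    show "S \<subseteq> (\<Union>f\<in>I. F f)"
    proof
      fix x assume x: "x \<in> S"
      \<comment> \<open>The floor finds the cell containing \<open>Q x\<close>. The minimum with
        \<open>N - 1\<close> assigns the far face, where the floor is \<open>N\<close>, to the last
        cell; \<open>undefined\<close> outside the index set is what \<open>PiE\<close>
        requires.\<close>
      define f where "f j = (if j \<in> Basis - {i} then min (N - 1) (nat \<lfloor>(Q x \<bullet> j - a j) * real N / s\<rfloor>) else undefined)" for j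
      have "min (N - 1) m < N" for m using N(2) by linarith
      then have "f \<in> I" by (auto simp: I_def f_def PiE_def extensional_def)
      moreover
      have "x \<in> F f"
      proof -
        have "a j + s * real (f j) / real N \<le> Q x \<bullet> j \<and> Q x \<bullet> j \<le> a j + s * (real (f j) + 1) / real N"
          if j: "j \<in> Basis - {i}" for j
        proof -
          define t where "t = (Q x \<bullet> j - a j) * real N / s"
          have jb: "j \<in> Basis" using j by simp
          have Nr: "real N > 0" using N(2) by simp
          have t: "0 \<le> t" "t \<le> real N"
            using cube[OF x jb] s Nr by (auto simp: t_def divide_le_eq mult.commute intro!: mult_mono)
          have Qt: "Q x \<bullet> j = a j + s * t / real N" using s Nr by (simp add: t_def)
          have fj: "f j = min (N - 1) (nat \<lfloor>t\<rfloor>)" using j by (simp add: f_def t_def)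
          have nt: "real (nat \<lfloor>t\<rfloor>) \<le> t" "t < real (nat \<lfloor>t\<rfloor>) + 1"
            using t(1) by (simp_all add: of_nat_nat)
          have "real (f j) \<le> t" using nt fj by simp
          moreover have "t \<le> real (f j) + 1"
            using nt t(2) N(2) fj by (cases "nat \<lfloor>t\<rfloor> \<le> N - 1") (auto simp: of_nat_diff)
          ultimately show ?thesis unfolding Qt using s Nr
            by (auto intro!: divide_right_mono mult_left_mono)
        qed
        then show ?thesis using x by (simp add: F_def)
      qed
      ultimately show "x \<in> (\<Union>f\<in>I. F f)" by blast
    qed
    show "bounded (F f)" for f using S by (rule bounded_subset) (auto simp: F_def)
    show "diameter (F f) \<le> r" for f using diam[of f] N(1) by linarith
  qed (use \<open>r \<in> _\<close> in auto)
  also have "\<dots> \<le> (\<Sum>f\<in>I. ennreal (unit_ball_vol (real k) * (D / real N / 2) ^ k))"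
  proof (rule sum_mono)
    fix f
    have "diameter (F f) \<ge> 0" by (rule diameter_ge_0) (use S in \<open>auto simp: F_def intro: bounded_subset\<close>)
    then show "hausdorff_gauge k (F f) \<le> ennreal (unit_ball_vol (real k) * (D / real N / 2) ^ k)"
      unfolding hausdorff_gauge_def using diam[of f]
      by (auto intro!: ennreal_leI mult_left_mono power_mono divide_right_mono)
  qed
  \<comment> \<open>There are \<open>N ^ k\<close> cells, each contributing a multiple of
    \<open>(D / N) ^ k\<close>. The powers of \<open>N\<close> cancel, so the bound does not depend
    on the mesh \<open>r\<close>.\<close>
  also have "\<dots> = ennreal (real (N ^ k) * (unit_ball_vol (real k) * (D / real N / 2) ^ k))"
    using D by (simp only: sum_constant I(2) ennreal_of_nat_eq_real_of_nat) (simp add: ennreal_mult[symmetric])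
  also have "real (N ^ k) * (unit_ball_vol (real k) * (D / real N / 2) ^ k)
      = unit_ball_vol (real k) * (D / 2) ^ k"
    using N(2) by (simp add: power_divide)
  finally show "hausdorff_pre k r S \<le> ennreal (unit_ball_vol (real k) * (M * DIM('a) * s / 2) ^ k)"
    by (simp add: D_def)
qed

text \<open>A two-point form of lying on a graph of slope \<open>L\<close> over the hyperplane
  orthogonal to \<open>e\<close>. It mentions no function, so it passes to subsets and feeds
  directly into distance estimates.\<close>

definition lipschitz_graph :: "'a::euclidean_space \<Rightarrow> real \<Rightarrow> 'a set \<Rightarrow> bool" where
  "lipschitz_graph e L S \<longleftrightarrow>
     (\<forall>x\<in>S. \<forall>y\<in>S. \<bar>(x - y) \<bullet> e\<bar> \<le> L * norm ((x - y) - ((x - y) \<bullet> e) *\<^sub>R e))"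

lemma norm_orthogonal_part_le:
  fixes e z :: "'a::real_inner"
  assumes "norm e = 1" shows "norm (z - (z \<bullet> e) *\<^sub>R e) \<le> norm z"
proof -
  have "e \<bullet> e = 1" using assms by (simp add: dot_square_norm)
  then have "(norm (z - (z \<bullet> e) *\<^sub>R e))\<^sup>2 = (norm z)\<^sup>2 - (z \<bullet> e)\<^sup>2"
    unfolding power2_norm_eq_inner
    by (simp add: inner_diff_left inner_diff_right inner_commute power2_eq_square)
  also have "\<dots> \<le> (norm z)\<^sup>2" by simp
  finally show ?thesis by (rule power2_le_imp_le) simp
qed

text \<open>Projecting a graph in direction \<open>e\<close> along \<open>e\<close> onto a coordinate hyperplane not containing
  \<open>e\<close> has a Lipschitz inverse; this avoids rotating coordinates.\<close>

lemma hausdorff_outer_lipschitz_graph: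
  fixes e :: "'a::euclidean_space"
  assumes e: "norm e = 1" and L: "L \<ge> 0"
  shows "\<exists>C\<ge>0. \<forall>S \<rho>. lipschitz_graph e L S \<and> \<rho> > 0 \<and> (\<forall>x\<in>S. \<forall>y\<in>S. norm (x - y) \<le> \<rho>) \<longrightarrow>
    hausdorff_outer (DIM('a) - 1) S \<le> ennreal (C * \<rho> ^ (DIM('a) - 1))"
proof -
  obtain i where i: "i \<in> Basis" "e \<bullet> i \<noteq> 0"
    using e by (metis euclidean_all_zero_iff norm_zero zero_neq_one)
  define Q where "Q z = z - ((z \<bullet> i) / (e \<bullet> i)) *\<^sub>R e" for z
  \<comment> \<open>\<open>K\<close> bounds the operator norm of \<open>Q\<close>, so a set of
    diameter \<rho> containing \<open>x0\<close> has its image in the cube of side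
    \<open>2 * K * \<rho>\<close> centred at \<open>Q x0\<close>.\<close>
  define K where "K = 1 + 1 / \<bar>e \<bullet> i\<bar>"
  define k where "k = DIM('a) - 1"
  define C where "C = unit_ball_vol (real k) * ((1 + L) * DIM('a) * (2 * K) / 2) ^ k"
  have K: "K > 0" by (simp add: K_def add_pos_nonneg)
  have Q_diff: "Q x - Q y = Q (x - y)" for x y
    by (simp add: Q_def inner_diff_left diff_divide_distrib scaleR_diff_left)
  have normQ: "norm (Q z) \<le> K * norm z" for z
  proof -
    have "norm (Q z) \<le> norm z + norm (((z \<bullet> i) / (e \<bullet> i)) *\<^sub>R e)"
      unfolding Q_def by (rule norm_triangle_ineq4)
    also have "norm (((z \<bullet> i) / (e \<bullet> i)) *\<^sub>R e) = \<bar>z \<bullet> i\<bar> / \<bar>e \<bullet> i\<bar>" using e by simp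
    also have "\<dots> \<le> norm z / \<bar>e \<bullet> i\<bar>"
      using Basis_le_norm[OF i(1)] by (intro divide_right_mono) auto
    finally show ?thesis by (simp add: K_def algebra_simps)
  qed
  have "hausdorff_outer k S \<le> ennreal (C * \<rho> ^ k)"
    if S: "lipschitz_graph e L S" "\<rho> > 0" and diam: "\<forall>x\<in>S. \<forall>y\<in>S. norm (x - y) \<le> \<rho>" for S \<rho>
  proof (cases "S = {}")
    case True
    then show ?thesis by (simp add: hausdorff_outer_empty)
  next
    case False
    then obtain x0 where x0: "x0 \<in> S" by blast
    have "hausdorff_outer k S \<le>
        ennreal (unit_ball_vol (real k) * ((1 + L) * DIM('a) * (2 * K * \<rho>) / 2) ^ k)"
      unfolding k_def
    proof (rule hausdorff_outer_le_if_inverse_lipschitz[OF i(1)])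
      show "bounded S"
        using diam x0 by (intro boundedI[of _ "norm x0 + \<rho>"]) (smt (verit) norm_triangle_sub)
      show "Q x \<bullet> i = 0" for x using i by (simp add: Q_def inner_diff_left)
      fix x y assume xy: "x \<in> S" "y \<in> S"
      define z where "z = x - y"
      let ?p = "\<lambda>z. z - (z \<bullet> e) *\<^sub>R e"
      \<comment> \<open>\<open>Q\<close> changes \<open>z\<close> only along \<open>e\<close>, so
        \<open>norm (Q z)\<close> controls the part of \<open>z\<close> orthogonal to
        \<open>e\<close>; the graph condition then controls the part along \<open>e\<close>, at the
        price of a factor \<open>L\<close>.\<close>
      have "?p (Q z) = ?p z"
        using e by (simp add: Q_def inner_diff_left scaleR_diff_left dot_square_norm)
      then have pz: "norm (?p z) \<le> norm (Q z)" using norm_orthogonal_part_le[OF e, of "Q z"] by simp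
      have "norm z \<le> norm (?p z) + norm ((z \<bullet> e) *\<^sub>R e)"
        using norm_triangle_ineq[of "?p z" "(z \<bullet> e) *\<^sub>R e"] by simp
      also have "\<dots> \<le> norm (?p z) + L * norm (?p z)"
        using S(1) xy e unfolding lipschitz_graph_def z_def by simp
      also have "\<dots> \<le> norm (Q z) + L * norm (Q z)"
        using pz L by (intro add_mono mult_left_mono)
      finally show "norm (x - y) \<le> (1 + L) * norm (Q x - Q y)"
        by (simp add: z_def Q_diff algebra_simps)
    next
      fix x and j :: 'a assume x: "x \<in> S" and j: "j \<in> Basis"
      have "norm (Q x - Q x0) \<le> K * norm (x - x0)" unfolding Q_diff by (rule normQ)
      also have "\<dots> \<le> K * \<rho>" using diam x x0 K by (intro mult_left_mono) auto
      finally have "\<bar>(Q x - Q x0) \<bullet> j\<bar> \<le> K * \<rho>" using Basis_le_norm[OF j] order_trans by blast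
      then show "Q x0 \<bullet> j - K * \<rho> \<le> Q x \<bullet> j \<and> Q x \<bullet> j \<le> Q x0 \<bullet> j - K * \<rho> + 2 * K * \<rho>"
        by (simp add: inner_diff_left abs_le_iff)
    qed (use K S(2) L in auto)
    also have "unit_ball_vol (real k) * ((1 + L) * DIM('a) * (2 * K * \<rho>) / 2) ^ k = C * \<rho> ^ k"
      by (simp add: C_def power_mult_distrib[symmetric] mult_ac)
    finally show ?thesis .
  qed
  moreover have "C \<ge> 0" using K L by (simp add: C_def)
  ultimately show ?thesis unfolding k_def by blast
qed

section \<open>Charts of the boundary and finiteness of the surface measure\<close>

text \<open>The definition of a chart locates only \<Omega>. A frontier point is not in the open set
  \<Omega>, so it lies on or below the graph; lying strictly below is an open condition incompatible
  with \<Omega>, which no point of the closure can satisfy.\<close>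

lemma lipschitz_boundary_chart:
  fixes \<Omega> :: "'a::euclidean_space set"
  assumes "open \<Omega>" "lipschitz_boundary \<Omega>" "p \<in> frontier \<Omega>"
  shows "\<exists>r>0. \<exists>e. \<exists>L\<ge>0. \<exists>\<gamma>. norm e = 1 \<and> L-lipschitz_on {y. y \<bullet> e = 0} \<gamma> \<and>
    (\<forall>x\<in>ball p r. x \<in> \<Omega> \<longleftrightarrow> \<gamma> (x - (x \<bullet> e) *\<^sub>R e) < x \<bullet> e) \<and>
    (\<forall>x\<in>ball p r. x \<in> frontier \<Omega> \<longrightarrow> \<gamma> (x - (x \<bullet> e) *\<^sub>R e) = x \<bullet> e)"
proof -
  obtain r e L \<gamma> where r: "r > 0" and e: "norm e = 1" and lip: "L-lipschitz_on {y. y \<bullet> e = 0} \<gamma>"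
    and eq: "\<Omega> \<inter> ball p r = {x \<in> ball p r. \<gamma> (x - (x \<bullet> e) *\<^sub>R e) < x \<bullet> e}"
    using assms(2,3) unfolding lipschitz_boundary_def by blast
  have L: "L \<ge> 0" using lip by (simp add: lipschitz_on_def)
  have mem: "x \<in> \<Omega> \<longleftrightarrow> \<gamma> (x - (x \<bullet> e) *\<^sub>R e) < x \<bullet> e" if "x \<in> ball p r" for x
    using eq that by blast
  have perp: "x - (x \<bullet> e) *\<^sub>R e \<in> {y. y \<bullet> e = 0}" for x
    using e by (simp add: inner_diff_left dot_square_norm)
  define \<Phi> where "\<Phi> x = x \<bullet> e - \<gamma> (x - (x \<bullet> e) *\<^sub>R e)" for x
  have "continuous_on UNIV (\<lambda>x. \<gamma> (x - (x \<bullet> e) *\<^sub>R e))"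
    using perp by (intro continuous_on_compose2[OF lipschitz_on_continuous_on[OF lip]] continuous_intros) auto
  then have c: "continuous_on UNIV \<Phi>" unfolding \<Phi>_def by (intro continuous_intros)
  have "\<gamma> (x - (x \<bullet> e) *\<^sub>R e) = x \<bullet> e" if x: "x \<in> ball p r" "x \<in> frontier \<Omega>" for x
  proof (rule ccontr)
    assume "\<not> ?thesis"
    moreover have "x \<notin> \<Omega>" using x(2) assms(1) by (simp add: frontier_def interior_open)
    ultimately have neg: "\<Phi> x < 0" using mem[OF x(1)] by (simp add: \<Phi>_def)
    have "open ({y. \<Phi> y < 0} \<inter> ball p r)"
      using c by (intro open_Int open_Collect_less continuous_on_const) auto
    moreover have "x \<in> closure \<Omega>" using x(2) by (simp add: frontier_def)
    ultimately obtain y where "y \<in> \<Omega>" "y \<in> {y. \<Phi> y < 0} \<inter> ball p r"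
      using neg x(1) closure_iff_nhds_not_empty[of x \<Omega>]
      by (metis (mono_tags, lifting) IntI disjoint_iff mem_Collect_eq subset_refl)
    then show False using mem[of y] by (auto simp: \<Phi>_def)
  qed
  then show ?thesis using r e L lip mem by blast
qed

lemma lipschitz_graph_chart:
  fixes e :: "'a::euclidean_space"
  assumes "norm e = 1" "L-lipschitz_on {y. y \<bullet> e = 0} \<gamma>"
    and "\<And>x. x \<in> S \<Longrightarrow> \<gamma> (x - (x \<bullet> e) *\<^sub>R e) = x \<bullet> e"
  shows "lipschitz_graph e L S"
  unfolding lipschitz_graph_def
proof (intro ballI)
  fix x y assume xy: "x \<in> S" "y \<in> S"
  let ?p = "\<lambda>x. x - (x \<bullet> e) *\<^sub>R e"
  have "?p z \<in> {y. y \<bullet> e = 0}" for z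
    using assms(1) by (simp add: inner_diff_left dot_square_norm)
  from lipschitz_onD[OF assms(2) this this] have "\<bar>\<gamma> (?p x) - \<gamma> (?p y)\<bar> \<le> L * norm (?p x - ?p y)"
    by (simp add: dist_norm)
  moreover have "?p x - ?p y = ?p (x - y)" by (simp add: inner_diff_left scaleR_diff_left)
  ultimately show "\<bar>(x - y) \<bullet> e\<bar> \<le> L * norm (?p (x - y))"
    using assms(3) xy by (simp add: inner_diff_left)
qed

lemma lipschitz_graph_subset: "lipschitz_graph e L S \<Longrightarrow> T \<subseteq> S \<Longrightarrow> lipschitz_graph e L T"
  unfolding lipschitz_graph_def by blast

text \<open>Finitely many chart balls cover the compact frontier, and in each of them the frontier
  is a bounded Lipschitz graph. Finiteness puts continuous functions into L2 of the surface and
  permits Fubini for pieces of a contact.\<close>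

lemma hausdorff_outer_frontier_finite:
  fixes \<Omega> :: "'a::euclidean_space set"
  assumes "bounded_lipschitz_domain \<Omega>"
  shows "hausdorff_outer (DIM('a) - 1) (frontier \<Omega>) < top"
proof -
  have \<Omega>: "open \<Omega>" "bounded \<Omega>" "lipschitz_boundary \<Omega>"
    using assms by (auto simp: bounded_lipschitz_domain_def)
  have "\<exists>r>0. hausdorff_outer (DIM('a) - 1) (frontier \<Omega> \<inter> ball p r) < top" if p: "p \<in> frontier \<Omega>" for p
  proof -
    obtain r e L \<gamma> where r: "r > 0" "L \<ge> 0" "norm e = 1" "L-lipschitz_on {y. y \<bullet> e = 0} \<gamma>"
      "\<forall>x\<in>ball p r. x \<in> frontier \<Omega> \<longrightarrow> \<gamma> (x - (x \<bullet> e) *\<^sub>R e) = x \<bullet> e"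
      using lipschitz_boundary_chart[OF \<Omega>(1,3) p] by metis
    have graph: "lipschitz_graph e L (frontier \<Omega> \<inter> ball p r)"
      by (rule lipschitz_graph_chart[OF r(3,4)]) (use r(5) in auto)
    obtain C where C: "\<forall>S \<rho>. lipschitz_graph e L S \<and> \<rho> > 0 \<and> (\<forall>x\<in>S. \<forall>y\<in>S. norm (x - y) \<le> \<rho>) \<longrightarrow>
        hausdorff_outer (DIM('a) - 1) S \<le> ennreal (C * \<rho> ^ (DIM('a) - 1))"
      using hausdorff_outer_lipschitz_graph[OF r(3,2)] by blast
    have "norm (x - y) \<le> 2 * r" if "x \<in> ball p r" "y \<in> ball p r" for x y
      using that dist_triangle2[of x y p] by (simp add: dist_norm dist_commute norm_minus_commute)
    then have "\<forall>x\<in>frontier \<Omega> \<inter> ball p r. \<forall>y\<in>frontier \<Omega> \<inter> ball p r. norm (x - y) \<le> 2 * r"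
      by blast
    then have "hausdorff_outer (DIM('a) - 1) (frontier \<Omega> \<inter> ball p r) \<le> ennreal (C * (2 * r) ^ (DIM('a) - 1))"
      using C[rule_format, of "frontier \<Omega> \<inter> ball p r" "2 * r"] graph r(1) by simp
    then show ?thesis using r(1) by (intro exI[of _ r]) (auto simp: le_less_trans)
  qed
  then obtain r where r: "\<And>p. p \<in> frontier \<Omega> \<Longrightarrow> r p > 0"
    "\<And>p. p \<in> frontier \<Omega> \<Longrightarrow> hausdorff_outer (DIM('a) - 1) (frontier \<Omega> \<inter> ball p (r p)) < top"
    by metis
  have "compact (frontier \<Omega>)" using \<Omega>(2) by (rule compact_frontier_bounded)
  then obtain P where P: "finite P" "P \<subseteq> frontier \<Omega>" "frontier \<Omega> \<subseteq> (\<Union>p\<in>P. ball p (r p))"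
  proof (rule compactE_image)
    show "frontier \<Omega> \<subseteq> (\<Union>p\<in>frontier \<Omega>. ball p (r p))" using r(1) by force
  qed auto
  have "hausdorff_outer (DIM('a) - 1) (\<Union>p\<in>P. frontier \<Omega> \<inter> ball p (r p)) < top"
    using P(1,2)
  proof (induction P rule: finite_induct)
    case (insert p P)
    then have "hausdorff_outer (DIM('a) - 1) (frontier \<Omega> \<inter> ball p (r p))
        + hausdorff_outer (DIM('a) - 1) (\<Union>p\<in>P. frontier \<Omega> \<inter> ball p (r p)) < top"
      using r(2) by simp
    from le_less_trans[OF hausdorff_outer_Un this] show ?case by (simp only: UN_insert)
  qed (simp add: hausdorff_outer_empty)
  moreover have "frontier \<Omega> \<subseteq> (\<Union>p\<in>P. frontier \<Omega> \<inter> ball p (r p))" using P(3) by blast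
  ultimately show ?thesis using hausdorff_outer_mono le_less_trans by blast
qed

lemma emeasure_surface_measure:
  fixes \<Omega> :: "'a::euclidean_space set"
  assumes "A \<in> sets borel" "A \<subseteq> frontier \<Omega>"
  shows "emeasure (surface_measure \<Omega>) A = hausdorff_outer (DIM('a) - 1) A"
  unfolding surface_measure_def using assms
  by (subst emeasure_restrict_space) (auto simp: emeasure_hausdorff_measure)

lemma space_surface_measure: "space (surface_measure \<Omega>) = frontier \<Omega>"
  by (simp add: surface_measure_def space_restrict_space)

lemma finite_measure_surface_measure:
  fixes \<Omega> :: "'a::euclidean_space set"
  assumes "bounded_lipschitz_domain \<Omega>"
  shows "finite_measure (surface_measure \<Omega>)"
  using hausdorff_outer_frontier_finite[OF assms]
  by (intro finite_measureI) (simp add: space_surface_measure emeasure_surface_measure)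

section \<open>Integration along transversal segments\<close>

text \<open>A bounded \<open>A\<close> is covered by countably many dyadic cubes inside an open
  \<open>U\<close> of slightly larger volume. Their interiors are disjoint, so their volumes add up
  to at most that of \<open>U\<close>, while on the side of \<mu> subadditivity is enough. Unbounded
  sets are exhausted by growing boxes.\<close>

lemma emeasure_le_lborel_if_le_on_cubes:
  fixes \<mu> :: "'a::euclidean_space measure"
  assumes sets[simp]: "sets \<mu> = sets borel" and C: "C \<ge> 0"
    and cube: "\<And>u w l. l > 0 \<Longrightarrow> (\<forall>i\<in>Basis. w \<bullet> i - u \<bullet> i = l) \<Longrightarrow>
      emeasure \<mu> (cbox u w) \<le> ennreal (C * l ^ DIM('a))"
    and A: "A \<in> sets borel"
  shows "emeasure \<mu> A \<le> ennreal C * emeasure lborel A"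
proof -
  have bdd: "emeasure \<mu> A \<le> ennreal C * emeasure lborel A"
    if A: "A \<in> sets borel" and n: "n > 0" and sub: "A \<subseteq> cbox (- (n *\<^sub>R One)) (n *\<^sub>R One)" for A :: "'a set" and n :: real
  proof -
    let ?a = "- (n *\<^sub>R One) :: 'a" and ?b = "n *\<^sub>R One :: 'a"
    have ab: "box ?a ?b \<noteq> {}" using n by (simp add: box_ne_empty)
    have eps: "emeasure \<mu> A \<le> ennreal C * (emeasure lborel A + ennreal \<epsilon>)" if \<epsilon>: "\<epsilon> > 0" for \<epsilon>
    proof -
      obtain U where U: "open U" "A \<subseteq> U" "emeasure lborel (U - A) < ennreal \<epsilon>"
        using outer_regular_lborel[OF A \<epsilon>] by blast
      \<comment> \<open>Every cube produced by the covering lemma lies in \<open>g x\<close> for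
        some \<open>x\<close> of \<open>A\<close> inside the cube; this choice of gauge therefore
        keeps all cubes within \<open>U\<close>.\<close>
      define g where "g x = (if x \<in> U then U else UNIV)" for x
      have "gauge g" using U(1) by (auto simp: g_def gauge_def)
      then show ?thesis
      proof (rule covering_lemma[OF sub ab])
        fix \<D> :: "'a set set"
        assume \<D>: "countable \<D>" "\<And>K. K \<in> \<D> \<Longrightarrow> interior K \<noteq> {} \<and> (\<exists>c d. K = cbox c d)"
          "pairwise (\<lambda>A B. interior A \<inter> interior B = {}) \<D>"
          "\<And>K. K \<in> \<D> \<Longrightarrow> \<exists>x\<in>A \<inter> K. K \<subseteq> g x"
          "\<And>u v. cbox u v \<in> \<D> \<Longrightarrow> \<exists>m. \<forall>i\<in>Basis. v \<bullet> i - u \<bullet> i = (?b \<bullet> i - ?a \<bullet> i) / 2 ^ m"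
          "A \<subseteq> \<Union>\<D>"
        have KU: "K \<subseteq> U" if "K \<in> \<D>" for K
          using \<D>(4)[OF that] U(2) by (auto simp: g_def split: if_splits)
        have cubeK: "emeasure \<mu> K \<le> ennreal C * emeasure lborel (interior K)" if K: "K \<in> \<D>" for K
        proof -
          obtain u w where uw: "K = cbox u w" using \<D>(2)[OF K] by blast
          obtain m where m: "\<forall>i\<in>Basis. w \<bullet> i - u \<bullet> i = (?b \<bullet> i - ?a \<bullet> i) / 2 ^ m"
            using \<D>(5)[of u w] K uw by blast
          define l where "l = 2 * n / 2 ^ m"
          have l: "l > 0" using n by (simp add: l_def)
          have uwl: "\<forall>i\<in>Basis. w \<bullet> i - u \<bullet> i = l" using m by (simp add: l_def)
          then have le: "u \<bullet> i \<le> w \<bullet> i" if "i \<in> Basis" for i using l that by (metis diff_ge_0_iff_ge less_imp_le)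
          have "emeasure lborel (interior K) = ennreal (\<Prod>i\<in>Basis. (w - u) \<bullet> i)"
            unfolding uw interior_cbox using le by (rule emeasure_lborel_box)
          also have "(\<Prod>i\<in>Basis. (w - u) \<bullet> i) = l ^ DIM('a)"
            using uwl by (simp add: inner_diff_left)
          finally have "ennreal C * emeasure lborel (interior K) = ennreal (C * l ^ DIM('a))"
            using C l by (simp add: ennreal_mult)
          then show ?thesis using cube[OF l uwl] uw by simp
        qed
        \<comment> \<open>An enumeration of the cubes without repetition. Indices that code no cube
          get the empty set, which handles a finite \<open>\<D>\<close> as well.\<close>
        define X where "X j = (if j \<in> to_nat_on \<D> ` \<D> then from_nat_into \<D> j else {})" for j
        have X: "X j \<in> \<D> \<or> X j = {}" for j
          using \<D>(1) by (auto simp: X_def)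
        have XU: "(\<Union>j. X j) = \<Union>\<D>"
        proof
          show "(\<Union>j. X j) \<subseteq> \<Union>\<D>" using X by fast
          show "\<Union>\<D> \<subseteq> (\<Union>j. X j)"
          proof
            fix x assume "x \<in> \<Union>\<D>"
            then obtain K where "K \<in> \<D>" "x \<in> K" by blast
            then have "x \<in> X (to_nat_on \<D> K)" using \<D>(1) by (simp add: X_def)
            then show "x \<in> (\<Union>j. X j)" by blast
          qed
        qed
        have Xb: "X j \<in> sets borel" for j
        proof (cases "X j = {}")
          case False
          then obtain c d where "X j = cbox c d" using X[of j] \<D>(2) by blast
          then show ?thesis by simp
        qed simp
        then have UX: "(\<Union>j. X j) \<in> sets borel" by blast
        have disj: "disjoint_family (\<lambda>j. interior (X j))"
          unfolding disjoint_family_on_def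
        proof (intro ballI impI)
          fix i j :: nat assume ij: "i \<noteq> j"
          show "interior (X i) \<inter> interior (X j) = {}"
          proof (cases "i \<in> to_nat_on \<D> ` \<D> \<and> j \<in> to_nat_on \<D> ` \<D>")
            case True
            then obtain K L where "K \<in> \<D>" "L \<in> \<D>" "i = to_nat_on \<D> K" "j = to_nat_on \<D> L" by blast
            then show ?thesis using ij \<D>(1,3) by (auto simp: X_def pairwise_def)
          qed (auto simp: X_def)
        qed
        have "emeasure \<mu> A \<le> emeasure \<mu> (\<Union>j. X j)"
          using \<D>(6) UX unfolding XU by (intro emeasure_mono) simp_all
        also have "\<dots> \<le> (\<Sum>j. emeasure \<mu> (X j))"
          using Xb by (intro emeasure_subadditive_countably) auto
        also have "\<dots> \<le> (\<Sum>j. ennreal C * emeasure lborel (interior (X j)))"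
          using X cubeK by (intro suminf_le) (metis emeasure_empty interior_empty zero_le, auto)
        also have "\<dots> = ennreal C * emeasure lborel (\<Union>j. interior (X j))"
          using disj by (subst suminf_emeasure[symmetric]) (auto simp: ennreal_suminf_cmult)
        also have "\<dots> \<le> ennreal C * emeasure lborel U"
        proof (intro mult_left_mono emeasure_mono)
          show "(\<Union>j. interior (X j)) \<subseteq> U" using X KU interior_subset by fastforce
        qed (use U(1) in auto)
        also have "emeasure lborel U = emeasure lborel A + emeasure lborel (U - A)"
          using A U by (subst plus_emeasure) (auto simp: Un_absorb1)
        also have "ennreal C * \<dots> \<le> ennreal C * (emeasure lborel A + ennreal \<epsilon>)"
          using U(3) by (intro mult_left_mono add_left_mono) auto
        finally show ?thesis .
      qed
    qed
    show ?thesis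
    proof (rule ennreal_le_epsilon)
      fix \<epsilon> :: real assume "0 < \<epsilon>"
      \<comment> \<open>Dividing by \<open>C + 1\<close> instead of \<open>C\<close> keeps the
        choice meaningful when \<open>C = 0\<close>.\<close>
      have "emeasure \<mu> A \<le> ennreal C * (emeasure lborel A + ennreal (\<epsilon> / (C + 1)))"
        using \<open>0 < \<epsilon>\<close> C by (intro eps) simp
      also have "\<dots> = ennreal C * emeasure lborel A + ennreal (C * (\<epsilon> / (C + 1)))"
        using C \<open>0 < \<epsilon>\<close> by (simp add: distrib_left ennreal_mult[symmetric])
      also have "\<dots> \<le> ennreal C * emeasure lborel A + ennreal \<epsilon>"
        using C \<open>0 < \<epsilon>\<close> by (intro add_left_mono ennreal_leI) (simp add: field_simps)
      finally show "emeasure \<mu> A \<le> ennreal C * emeasure lborel A + ennreal \<epsilon>" .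
    qed
  qed
  let ?B = "\<lambda>n. cbox (- (real (Suc n) *\<^sub>R One)) (real (Suc n) *\<^sub>R One) :: 'a set"
  have inc: "incseq ?B"
    by (rule incseq_SucI) (auto simp: subset_box)
  have cover: "(\<Union>n. ?B n) = UNIV"
  proof -
    have "x \<in> (\<Union>n. ?B n)" for x :: 'a
    proof -
      obtain n where n: "norm x < real n" using reals_Archimedean2 by blast
      have "- real (Suc n) \<le> x \<bullet> i \<and> x \<bullet> i \<le> real (Suc n)" if "i \<in> Basis" for i
        using Basis_le_norm[OF that, of x] n by linarith
      then have "x \<in> ?B n" by (simp add: mem_box del: of_nat_Suc)
      then show ?thesis by blast
    qed
    then show ?thesis by blast
  qed
  have "emeasure \<mu> A = emeasure \<mu> (\<Union>n. A \<inter> ?B n)" using cover by (simp add: Int_UN_distrib[symmetric])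
  also have "\<dots> = (SUP n. emeasure \<mu> (A \<inter> ?B n))"
    using A inc by (intro SUP_emeasure_incseq[symmetric]) (auto simp: incseq_def)
  also have "\<dots> \<le> ennreal C * emeasure lborel A"
  proof (rule SUP_least)
    fix n
    have "emeasure \<mu> (A \<inter> ?B n) \<le> ennreal C * emeasure lborel (A \<inter> ?B n)"
      using A by (intro bdd[of _ "real (Suc n)"]) auto
    also have "\<dots> \<le> ennreal C * emeasure lborel A"
      using A by (intro mult_left_mono emeasure_mono) auto
    finally show "emeasure \<mu> (A \<inter> ?B n) \<le> ennreal C * emeasure lborel A" .
  qed
  finally show ?thesis .
qed

lemma nn_integral_le_if_emeasure_le:
  assumes "sets M = sets N" "\<And>A. A \<in> sets N \<Longrightarrow> emeasure M A \<le> c * emeasure N A"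
    and "f \<in> borel_measurable N"
  shows "(\<integral>\<^sup>+x. f x \<partial>M) \<le> c * (\<integral>\<^sup>+x. f x \<partial>N)"
proof -
  have "M \<le> scale_measure c N"
    using assms(1,2) by (subst le_measure) auto
  then have "(\<integral>\<^sup>+x. f x \<partial>M) \<le> (\<integral>\<^sup>+x. f x \<partial>scale_measure c N)"
    using assms(1) by (intro nn_integral_mono_measure) auto
  then show ?thesis using assms(3) by (simp add: nn_integral_scale_measure)
qed

text \<open>A vector close to \<open>\<tau> *\<^sub>R e\<close> is steeper than the graph, so two
  graph points moved along it come close only if the points and the parameters were close. In other
  words, (x, s) to x + s v has a Lipschitz inverse, with constants depending on \<open>L\<close> and
  \<tau> alone.\<close>

lemma lipschitz_graph_transversal:
  fixes e v x y :: "'a::euclidean_space"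
  assumes e: "norm e = 1" and L: "L \<ge> 0" and \<tau>: "\<tau> > 0"
    and v: "norm (v - \<tau> *\<^sub>R e) \<le> \<tau> / (2 * (1 + L))"
    and E: "lipschitz_graph e L E" "x \<in> E" "y \<in> E"
    and q: "norm ((x + s *\<^sub>R v) - (y + t *\<^sub>R v)) \<le> \<delta>"
  shows "\<bar>s - t\<bar> \<le> 2 * (1 + L) / \<tau> * \<delta>" "norm (x - y) \<le> (4 * (1 + L) + 1) * \<delta>"
proof -
  \<comment> \<open>With this tolerance, \<open>v \<bullet> e - L * norm (?p v)\<close> is at least
    \<open>\<tau> - (1 + L) * \<rho> = \<tau> / 2\<close>: half of the transversality survives the
    perturbation of the direction and the slope of the graph.\<close>
  define \<rho> where "\<rho> = \<tau> / (2 * (1 + L))"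
  define z where "z = x - y"
  define \<sigma> where "\<sigma> = s - t"
  define w where "w = z + \<sigma> *\<^sub>R v"
  let ?p = "\<lambda>z. z - (z \<bullet> e) *\<^sub>R e"
  have "m * (\<tau> / (2 * m)) = \<tau> / 2" if "m > 0" for m using that by simp
  from this[of "1 + L"] have \<rho>: "(1 + L) * \<rho> = \<tau> / 2" "\<rho> \<ge> 0"
    using L \<tau> by (simp_all only: \<rho>_def) auto
  have ee: "e \<bullet> e = 1" using e by (simp add: dot_square_norm)
  have w: "norm w \<le> \<delta>" using q by (simp add: w_def z_def \<sigma>_def algebra_simps)
  have pveq: "?p v = ?p (v - \<tau> *\<^sub>R e)" using ee by (simp add: inner_diff_left scaleR_diff_left)
  have pv: "norm (?p v) \<le> \<rho>"
    unfolding pveq \<rho>_def by (rule order_trans[OF norm_orthogonal_part_le[OF e] v])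
  have "\<bar>(v - \<tau> *\<^sub>R e) \<bullet> e\<bar> \<le> \<rho>"
    using Cauchy_Schwarz_ineq2[of "v - \<tau> *\<^sub>R e" e] v e by (simp add: \<rho>_def)
  then have ve: "v \<bullet> e \<ge> \<tau> - \<rho>" using ee by (simp add: inner_diff_left)
  have zw: "z = w - \<sigma> *\<^sub>R v" by (simp add: w_def)
  have "?p z = ?p w - \<sigma> *\<^sub>R ?p v"
    by (simp add: zw inner_diff_left scaleR_diff_left scaleR_diff_right algebra_simps)
  then have "norm (?p z) \<le> norm (?p w) + norm (\<sigma> *\<^sub>R ?p v)"
    by (simp only: norm_triangle_ineq4)
  also have "\<dots> \<le> \<delta> + \<bar>\<sigma>\<bar> * \<rho>"
    using pv norm_orthogonal_part_le[OF e, of w] w by (auto intro!: add_mono mult_left_mono)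
  finally have pz: "norm (?p z) \<le> \<delta> + \<bar>\<sigma>\<bar> * \<rho>" .
  have "\<bar>\<sigma>\<bar> * (\<tau> - \<rho>) \<le> \<bar>\<sigma>\<bar> * (v \<bullet> e)" using ve by (intro mult_left_mono) auto
  also have "\<dots> \<le> \<bar>\<sigma> * (v \<bullet> e)\<bar>" by (simp add: abs_mult mult_left_mono)
  also have "\<sigma> * (v \<bullet> e) = w \<bullet> e - z \<bullet> e" by (simp add: w_def inner_add_left)
  also have "\<bar>w \<bullet> e - z \<bullet> e\<bar> \<le> \<bar>w \<bullet> e\<bar> + \<bar>z \<bullet> e\<bar>" by linarith
  also have "\<bar>w \<bullet> e\<bar> \<le> \<delta>" using Cauchy_Schwarz_ineq2[of w e] w e by simp
  also have "\<bar>z \<bullet> e\<bar> \<le> L * norm (?p z)" using E unfolding lipschitz_graph_def z_def by blast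
  also have "L * norm (?p z) \<le> L * (\<delta> + \<bar>\<sigma>\<bar> * \<rho>)" using pz L by (rule mult_left_mono)
  finally have "\<bar>\<sigma>\<bar> * \<tau> - \<bar>\<sigma>\<bar> * ((1 + L) * \<rho>) \<le> (1 + L) * \<delta>" by (simp add: algebra_simps)
  then have "\<bar>\<sigma>\<bar> * \<tau> - \<bar>\<sigma>\<bar> * \<tau> / 2 \<le> (1 + L) * \<delta>" unfolding \<rho>(1) by simp
  then have s1: "\<bar>\<sigma>\<bar> * \<tau> \<le> 2 * ((1 + L) * \<delta>)" by linarith
  then have "\<bar>\<sigma>\<bar> \<le> 2 * ((1 + L) * \<delta>) / \<tau>" using \<tau> by (simp add: pos_le_divide_eq)
  then show "\<bar>s - t\<bar> \<le> 2 * (1 + L) / \<tau> * \<delta>"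
    by (simp only: \<sigma>_def mult.assoc times_divide_eq_left)
  have "\<rho> \<le> \<tau>" using \<rho> L mult_right_mono[of 1 "1 + L" \<rho>] \<tau> by simp
  then have nv: "norm v \<le> 2 * \<tau>"
    using v e \<tau> norm_triangle_sub[of v "\<tau> *\<^sub>R e"] by (simp add: \<rho>_def)
  have "norm z \<le> norm w + norm (\<sigma> *\<^sub>R v)" unfolding zw by (rule norm_triangle_ineq4)
  also have "norm (\<sigma> *\<^sub>R v) \<le> \<bar>\<sigma>\<bar> * (2 * \<tau>)" using nv by (auto intro: mult_left_mono)
  also have "\<dots> = 2 * (\<bar>\<sigma>\<bar> * \<tau>)" by simp
  finally have "norm z \<le> \<delta> + 4 * ((1 + L) * \<delta>)" using s1 w by linarith
  then show "norm (x - y) \<le> (4 * (1 + L) + 1) * \<delta>" by (simp add: z_def algebra_simps)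
qed

text \<open>The left side integrates \<open>g\<close> against the push-forward of surface measure
  times ds. By transversality, the preimage of a cube of side l lies in a graph piece of diameter
  O(l) times an interval of length O(l), of measure O(l^(d-1)) O(l). Hence the push-forward is below
  \<open>C\<close> times Lebesgue measure, with \<open>C\<close> independent of \<open>E\<close> and
  \<open>v\<close>.\<close>

lemma transversal_integral_le:
  fixes e :: "'a::euclidean_space"
  assumes e: "norm e = 1" and L: "L \<ge> 0" and \<tau>: "\<tau> > 0"
  shows "\<exists>C\<ge>0. \<forall>E v. \<forall>g::'a \<Rightarrow> ennreal. E \<in> sets borel \<and> lipschitz_graph e L E \<and>
      norm (v - \<tau> *\<^sub>R e) \<le> \<tau> / (2 * (1 + L)) \<and> g \<in> borel_measurable borel \<longrightarrow>
      (\<integral>\<^sup>+x. (\<integral>\<^sup>+s\<in>{0..1}. g (x + s *\<^sub>R v) \<partial>lborel) \<partial>restrict_space (hausdorff_measure (DIM('a) - 1)) E)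
        \<le> ennreal C * (\<integral>\<^sup>+x. g x \<partial>lborel)"
proof -
  define k where "k = DIM('a) - 1"
  have k: "DIM('a) = Suc k" using DIM_positive[where 'a = 'a] unfolding k_def by linarith
  obtain C0 where C0: "C0 \<ge> 0" "\<forall>S \<rho>. lipschitz_graph e L S \<and> \<rho> > 0 \<and> (\<forall>x\<in>S. \<forall>y\<in>S. norm (x - y) \<le> \<rho>) \<longrightarrow>
      hausdorff_outer k S \<le> ennreal (C0 * \<rho> ^ k)"
    using hausdorff_outer_lipschitz_graph[OF e L] unfolding k_def by blast
  define c1 where "c1 = 2 * (1 + L) / \<tau>"
  define c2 where "c2 = 4 * (1 + L) + 1"
  have c: "c1 > 0" "c2 > 0" using L \<tau> by (auto simp: c1_def c2_def)
  define C where "C = C0 * (2 * c2 * DIM('a)) ^ k * (2 * c1 * DIM('a))"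
  have C: "C \<ge> 0" using C0(1) c by (simp add: C_def)
  have "(\<integral>\<^sup>+x. (\<integral>\<^sup>+s\<in>{0..1}. g (x + s *\<^sub>R v) \<partial>lborel) \<partial>restrict_space (hausdorff_measure k) E)
        \<le> ennreal C * (\<integral>\<^sup>+x. g x \<partial>lborel)"
    if E[measurable]: "E \<in> sets borel" and graph: "lipschitz_graph e L E"
      and v: "norm (v - \<tau> *\<^sub>R e) \<le> \<tau> / (2 * (1 + L))" and g[measurable]: "g \<in> borel_measurable borel"
    for E v and g :: "'a \<Rightarrow> ennreal"
  proof -
    define M where "M = restrict_space (hausdorff_measure k) E"
    have spM: "space M = E" by (simp add: M_def space_restrict_space)
    have idM: "(\<lambda>x. x) \<in> M \<rightarrow>\<^sub>M borel"
      unfolding M_def by (intro measurable_restrict_space1 measurable_ident_sets) simp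
    define T where "T = restrict_space lborel {0..1::real}"
    have idT: "(\<lambda>s. s) \<in> T \<rightarrow>\<^sub>M borel"
      unfolding T_def by (intro measurable_restrict_space1 measurable_ident_sets) simp
    have "sigma_finite_measure T" unfolding T_def
      by (intro sigma_finite_measure_restrict_space lborel.sigma_finite_measure_axioms) simp
    then interpret T: sigma_finite_measure T .
    have \<Phi>[measurable]: "(\<lambda>z. fst z + snd z *\<^sub>R v) \<in> M \<Otimes>\<^sub>M T \<rightarrow>\<^sub>M borel"
      by (intro borel_measurable_add borel_measurable_scaleR borel_measurable_const
          measurable_compose[OF measurable_fst idM] measurable_compose[OF measurable_snd idT])
    define \<mu> where "\<mu> = distr (M \<Otimes>\<^sub>M T) borel (\<lambda>z. fst z + snd z *\<^sub>R v)"
    have int: "(\<integral>\<^sup>+x. h x \<partial>\<mu>) = (\<integral>\<^sup>+x. (\<integral>\<^sup>+s\<in>{0..1}. h (x + s *\<^sub>R v) \<partial>lborel) \<partial>M)"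
      if [measurable]: "h \<in> borel_measurable borel" for h :: "'a \<Rightarrow> ennreal"
    proof -
      have "(\<integral>\<^sup>+x. h x \<partial>\<mu>) = (\<integral>\<^sup>+z. h (fst z + snd z *\<^sub>R v) \<partial>(M \<Otimes>\<^sub>M T))"
        unfolding \<mu>_def by (rule nn_integral_distr[OF \<Phi>]) simp
      also have "\<dots> = (\<integral>\<^sup>+x. \<integral>\<^sup>+s. h (x + s *\<^sub>R v) \<partial>T \<partial>M)"
        using measurable_compose[OF \<Phi> that]
        by (subst T.nn_integral_fst[symmetric]) simp_all
      also have "\<dots> = (\<integral>\<^sup>+x. (\<integral>\<^sup>+s\<in>{0..1}. h (x + s *\<^sub>R v) \<partial>lborel) \<partial>M)"
        unfolding T_def by (subst nn_integral_restrict_space) auto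
      finally show ?thesis .
    qed
    have "emeasure \<mu> A \<le> ennreal C * emeasure lborel A" if "A \<in> sets borel" for A
    proof (rule emeasure_le_lborel_if_le_on_cubes[OF _ C _ that])
      show "sets \<mu> = sets borel" by (simp add: \<mu>_def)
      fix u w :: 'a and l :: real assume l: "l > 0" and uw: "\<forall>i\<in>Basis. w \<bullet> i - u \<bullet> i = l"
      define \<delta> where "\<delta> = DIM('a) * l"
      have \<delta>: "\<delta> > 0" using l by (simp add: \<delta>_def)
      have diam: "norm (a - b) \<le> \<delta>" if "a \<in> cbox u w" "b \<in> cbox u w" for a b
      proof -
        have "\<bar>(a - b) \<bullet> i\<bar> \<le> l" if "i \<in> Basis" for i
        proof -
          have "u \<bullet> i \<le> a \<bullet> i" "a \<bullet> i \<le> w \<bullet> i" "u \<bullet> i \<le> b \<bullet> i" "b \<bullet> i \<le> w \<bullet> i" "w \<bullet> i - u \<bullet> i = l"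
            using \<open>a \<in> _\<close> \<open>b \<in> _\<close> uw that by (auto simp: mem_box)
          then show ?thesis unfolding inner_diff_left by linarith
        qed
        then have "norm (a - b) \<le> (\<Sum>i\<in>(Basis::'a set). l)"
          by (intro order_trans[OF norm_le_l1] sum_mono) auto
        then show ?thesis by (simp add: \<delta>_def)
      qed
      show "emeasure \<mu> (cbox u w) \<le> ennreal (C * l ^ DIM('a))"
      proof (cases "\<exists>x0\<in>E. \<exists>s0. x0 + s0 *\<^sub>R v \<in> cbox u w")
        case False
        have "emeasure \<mu> (cbox u w) = (\<integral>\<^sup>+x. indicator (cbox u w) x \<partial>\<mu>)"
          by (simp add: \<mu>_def)
        also have "\<dots> = (\<integral>\<^sup>+x. (\<integral>\<^sup>+s\<in>{0..1}. indicator (cbox u w) (x + s *\<^sub>R v) \<partial>lborel) \<partial>M)"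
          by (rule int) simp
        also have "\<dots> = (\<integral>\<^sup>+x. 0 \<partial>M)"
        proof (rule nn_integral_cong)
          fix x assume "x \<in> space M"
          then have "indicator (cbox u w) (x + s *\<^sub>R v) = (0::ennreal)" for s
            using False spM by (auto simp: indicator_def)
          then show "(\<integral>\<^sup>+s\<in>{0..1}. indicator (cbox u w) (x + s *\<^sub>R v) \<partial>lborel) = 0" by simp
        qed
        finally show ?thesis by simp
      next
        case True
        then obtain x0 s0 where x0: "x0 \<in> E" "x0 + s0 *\<^sub>R v \<in> cbox u w" by blast
        \<comment> \<open>One point of the preimage of the cube is fixed; every other one then lies
          in \<open>F\<close> times \<open>J\<close>, by the two bounds of
          \<open>lipschitz_graph_transversal\<close>.\<close>
        define F where "F = E \<inter> cball x0 (c2 * \<delta>)"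
        define J where "J = {s0 - c1 * \<delta>..s0 + c1 * \<delta>}"
        have F[measurable]: "F \<in> sets M" "F \<in> sets borel"
          by (auto simp: F_def M_def sets_restrict_space_iff)
        have HF: "emeasure M F \<le> ennreal (C0 * (2 * c2 * \<delta>) ^ k)"
        proof -
          have "norm (x - y) \<le> 2 * c2 * \<delta>" if "x \<in> F" "y \<in> F" for x y
            using that dist_triangle2[of x y x0] by (simp add: F_def dist_norm norm_minus_commute)
          then have "hausdorff_outer k F \<le> ennreal (C0 * (2 * c2 * \<delta>) ^ k)"
            using C0(2)[rule_format, of F "2 * c2 * \<delta>"] graph c \<delta>
            by (auto simp: F_def intro: lipschitz_graph_subset)
          moreover have "emeasure M F = hausdorff_outer k F"
            unfolding M_def using F by (subst emeasure_restrict_space) (auto simp: F_def emeasure_hausdorff_measure)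
          ultimately show ?thesis by simp
        qed
        have ind: "indicator (cbox u w) (x + s *\<^sub>R v) \<le> (indicator F x * indicator J s :: ennreal)"
          if "x \<in> E" for x s
        proof (cases "x + s *\<^sub>R v \<in> cbox u w")
          case True
          note lipschitz_graph_transversal[OF e L \<tau> v graph that x0(1) diam[OF True x0(2)]]
          then have "x \<in> F" "s \<in> J"
            using that by (auto simp: F_def J_def c1_def c2_def dist_norm norm_minus_commute abs_le_iff)
          then show ?thesis by (simp add: indicator_def)
        qed auto
        have "emeasure \<mu> (cbox u w) = (\<integral>\<^sup>+x. indicator (cbox u w) x \<partial>\<mu>)"
          by (simp add: \<mu>_def)
        also have "\<dots> = (\<integral>\<^sup>+x. (\<integral>\<^sup>+s\<in>{0..1}. indicator (cbox u w) (x + s *\<^sub>R v) \<partial>lborel) \<partial>M)"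
          by (rule int) simp
        also have "\<dots> \<le> (\<integral>\<^sup>+x. (\<integral>\<^sup>+s. indicator F x * indicator J s \<partial>lborel) \<partial>M)"
        proof (intro nn_integral_mono)
          fix x s assume "x \<in> space M"
          have "indicator (cbox u w) (x + s *\<^sub>R v) * indicator {0..1} s \<le> (indicator (cbox u w) (x + s *\<^sub>R v) :: ennreal)"
            by (simp add: indicator_def)
          also have "\<dots> \<le> indicator F x * indicator J s" using ind \<open>x \<in> space M\<close> spM by blast
          finally show "indicator (cbox u w) (x + s *\<^sub>R v) * indicator {0..1} s \<le> (indicator F x * indicator J s :: ennreal)" .
        qed
        also have "\<dots> = (\<integral>\<^sup>+x. indicator F x * emeasure lborel J \<partial>M)"
          by (simp add: nn_integral_cmult J_def)
        also have "\<dots> = emeasure M F * emeasure lborel J"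
          by (simp add: nn_integral_multc)
        also have "emeasure lborel J = ennreal (2 * c1 * \<delta>)"
          using c \<delta> by (simp add: J_def)
        also have "emeasure M F * ennreal (2 * c1 * \<delta>) \<le> ennreal (C0 * (2 * c2 * \<delta>) ^ k) * ennreal (2 * c1 * \<delta>)"
          using HF by (rule mult_right_mono) simp
        also have "\<dots> = ennreal (C0 * (2 * c2 * \<delta>) ^ k * (2 * c1 * \<delta>))"
          using C0(1) c \<delta> by (simp add: ennreal_mult)
        also have "C0 * (2 * c2 * \<delta>) ^ k * (2 * c1 * \<delta>) = C * l ^ DIM('a)"
          by (simp add: C_def \<delta>_def k power_mult_distrib mult_ac)
        finally show ?thesis .
      qed
    qed
    then have "(\<integral>\<^sup>+x. g x \<partial>\<mu>) \<le> ennreal C * (\<integral>\<^sup>+x. g x \<partial>lborel)"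
      by (intro nn_integral_le_if_emeasure_le) (auto simp: \<mu>_def)
    then show ?thesis using int[OF g] by (simp add: M_def)
  qed
  then show ?thesis using C unfolding k_def by blast
qed

section \<open>A Poincare inequality\<close>

text \<open>The increment of \<open>f\<close> is the integral of its derivative along the segment,
  and both factors 2 come from splitting a square of a sum. Values in \<open>ennreal\<close> allow
  later integration over \<open>x\<close> without integrability conditions.\<close>

lemma power2_add_le_line_integral:
  fixes f :: "'a::euclidean_space \<Rightarrow> real"
  assumes d: "\<And>x. GDERIV f x :> g x" and c: "continuous_on UNIV g"
  shows "ennreal ((f (x + v))\<^sup>2) \<le> 2 * ennreal ((f x)\<^sup>2) +
    ennreal (2 * (norm v)\<^sup>2) * (\<integral>\<^sup>+s\<in>{0..1}. ennreal ((norm (g (x + s *\<^sub>R v)))\<^sup>2) \<partial>lborel)"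
proof -
  define h where "h s = g (x + s *\<^sub>R v) \<bullet> v" for s
  define q where "q s = (norm (g (x + s *\<^sub>R v)))\<^sup>2" for s
  define m where "m = f (x + v) - f x"
  have cg: "continuous_on {0..1} (\<lambda>s. g (x + s *\<^sub>R v))"
    by (rule continuous_on_compose2[OF c]) (auto intro!: continuous_intros)
  have "(h has_integral f (x + 1 *\<^sub>R v) - f (x + 0 *\<^sub>R v)) {0..1}"
  proof (rule fundamental_theorem_of_calculus)
    show "((\<lambda>s. f (x + s *\<^sub>R v)) has_vector_derivative h s) (at s within {0..1})" for s
      using DERIV_along_line[OF d, of x v s] unfolding h_def
      by (simp add: has_real_derivative_iff_has_vector_derivative has_vector_derivative_at_within)
  qed simp
  then have h: "(h has_integral m) {0..1}" by (simp add: m_def)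
  have "q integrable_on {0..1}"
    unfolding q_def by (intro integrable_continuous_real continuous_intros cg)
  then obtain I where I: "(q has_integral I) {0..1}" by blast
  have "(\<lambda>s. (h s)\<^sup>2) integrable_on {0..1}"
    unfolding h_def by (intro integrable_continuous_real continuous_intros cg)
  then obtain J where J: "((\<lambda>s. (h s)\<^sup>2) has_integral J) {0..1}" by blast
  \<comment> \<open>The integrand is \<open>(h s - m)\<^sup>2\<close>. Since \<open>m\<close> is the
    mean of \<open>h\<close>, its nonnegative integral is \<open>J - m\<^sup>2\<close>, which is
    Jensen's inequality for the square.\<close>
  have "((\<lambda>s. ((h s)\<^sup>2 - (2 * m) * h s) + m\<^sup>2) has_integral ((J - (2 * m) * m) + m\<^sup>2)) {0..1}"
    using has_integral_const_real[of "m\<^sup>2" 0 1]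
    by (intro has_integral_add has_integral_diff J has_integral_mult_right h) simp
  then have "0 \<le> (J - (2 * m) * m) + m\<^sup>2"
  proof (rule has_integral_nonneg)
    fix s
    have "((h s)\<^sup>2 - (2 * m) * h s) + m\<^sup>2 = (h s - m)\<^sup>2" by (simp add: power2_diff)
    then show "0 \<le> ((h s)\<^sup>2 - (2 * m) * h s) + m\<^sup>2" by simp
  qed
  then have "m\<^sup>2 \<le> J" by (simp add: power2_eq_square)
  also have "J \<le> (norm v)\<^sup>2 * I"
  proof (rule has_integral_le[OF J has_integral_mult_right[OF I]])
    fix s
    have "\<bar>h s\<bar>\<^sup>2 \<le> (norm (g (x + s *\<^sub>R v)) * norm v)\<^sup>2"
      unfolding h_def by (intro power_mono Cauchy_Schwarz_ineq2) simp
    then show "(h s)\<^sup>2 \<le> (norm v)\<^sup>2 * q s" by (simp add: q_def power_mult_distrib mult.commute)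
  qed
  finally have m: "m\<^sup>2 \<le> (norm v)\<^sup>2 * I" .
  have I0: "I \<ge> 0" by (rule has_integral_nonneg[OF I]) (simp add: q_def)
  have "(f (x + v))\<^sup>2 = (m - (- f x))\<^sup>2" by (simp add: m_def)
  also have "\<dots> \<le> 2 * m\<^sup>2 + 2 * (f x)\<^sup>2" using norm_diff_power2_le[of m "- f x"] by simp
  also have "\<dots> \<le> 2 * (f x)\<^sup>2 + (2 * (norm v)\<^sup>2) * I" using m by simp
  finally have "ennreal ((f (x + v))\<^sup>2) \<le> ennreal (2 * (f x)\<^sup>2 + (2 * (norm v)\<^sup>2) * I)"
    by (rule ennreal_leI)
  also have "\<dots> = 2 * ennreal ((f x)\<^sup>2) + ennreal (2 * (norm v)\<^sup>2) * ennreal I"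
    using I0 by (subst ennreal_plus) (simp_all add: ennreal_mult)
  also have "ennreal I = (\<integral>\<^sup>+s\<in>{0..1}. ennreal (q s) \<partial>lborel)"
    by (rule nn_integral_has_integral_lebesgue'[symmetric, OF _ I]) (simp add: q_def)
  finally show ?thesis by (simp add: q_def)
qed

lemma nn_integral_lborel_translation:
  fixes h :: "'a::euclidean_space \<Rightarrow> ennreal"
  assumes [measurable]: "h \<in> borel_measurable borel"
  shows "(\<integral>\<^sup>+x. h (x + c) \<partial>lborel) = (\<integral>\<^sup>+x. h x \<partial>lborel)"
proof -
  have "(\<integral>\<^sup>+x. h x \<partial>distr lborel borel ((+) c)) = (\<integral>\<^sup>+x. h (c + x) \<partial>lborel)"
    by (rule nn_integral_distr) auto
  then show ?thesis by (simp only: lborel_distr_plus add.commute)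
qed

text \<open>The line estimate is used backwards, from \<open>x + v\<close> to \<open>x\<close>, and
  integrated over \<open>A\<close>. After exchanging the integrals, translation invariance makes the
  gradient term for each parameter at most the gradient integral over \<Omega>.\<close>

lemma translated_integral_le:
  fixes f :: "'a::euclidean_space \<Rightarrow> real"
  assumes d: "\<And>x. GDERIV f x :> g x" and c: "continuous_on UNIV g"
    and A: "A \<in> sets borel" and \<Omega>: "\<Omega> \<in> sets borel"
    and sub: "\<And>x s. x \<in> A \<Longrightarrow> 0 \<le> s \<Longrightarrow> s \<le> 1 \<Longrightarrow> x + s *\<^sub>R v \<in> \<Omega>"
  shows "(\<integral>\<^sup>+x\<in>A. ennreal ((f x)\<^sup>2) \<partial>lborel) \<le> 2 * (\<integral>\<^sup>+x\<in>A. ennreal ((f (x + v))\<^sup>2) \<partial>lborel) +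
    ennreal (2 * (norm v)\<^sup>2) * (\<integral>\<^sup>+x\<in>\<Omega>. ennreal ((norm (g x))\<^sup>2) \<partial>lborel)"
proof -
  note [measurable] = A \<Omega>
  have cf: "continuous_on UNIV f"
    using d by (auto simp: gderiv_def continuous_on_eq_continuous_at intro: has_derivative_continuous)
  have [measurable]: "f \<in> borel_measurable borel" "g \<in> borel_measurable borel"
    using cf c by (auto intro: borel_measurable_continuous_onI)
  \<comment> \<open>The cut-off to \<Omega> changes nothing on the segments, which stay in \<Omega>
    by assumption, and makes the translated integral over the whole space independent of the
    parameter.\<close>
  define G where "G x = ennreal ((norm (g x))\<^sup>2) * indicator \<Omega> x" for x
  have [measurable]: "G \<in> borel_measurable borel" unfolding G_def by measurable
  have pw: "ennreal ((f x)\<^sup>2) * indicator A x \<le> 2 * (ennreal ((f (x + v))\<^sup>2) * indicator A x) +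
      ennreal (2 * (norm v)\<^sup>2) * (\<integral>\<^sup>+s\<in>{0..1}. G (x + (1 - s) *\<^sub>R v) \<partial>lborel)" for x
  proof (cases "x \<in> A")
    case True
    have "ennreal ((f x)\<^sup>2) = ennreal ((f ((x + v) + (- v)))\<^sup>2)" by simp
    also have "\<dots> \<le> 2 * ennreal ((f (x + v))\<^sup>2) + ennreal (2 * (norm (- v))\<^sup>2) *
        (\<integral>\<^sup>+s\<in>{0..1}. ennreal ((norm (g ((x + v) + s *\<^sub>R (- v))))\<^sup>2) \<partial>lborel)"
      by (rule power2_add_le_line_integral[OF d c])
    also have "(\<integral>\<^sup>+s\<in>{0..1}. ennreal ((norm (g ((x + v) + s *\<^sub>R (- v))))\<^sup>2) \<partial>lborel)
        = (\<integral>\<^sup>+s\<in>{0..1}. G (x + (1 - s) *\<^sub>R v) \<partial>lborel)"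
    proof (rule nn_integral_cong)
      fix s :: real
      have eq: "(x + v) + s *\<^sub>R (- v) = x + (1 - s) *\<^sub>R v" by (simp add: scaleR_diff_left)
      show "ennreal ((norm (g ((x + v) + s *\<^sub>R (- v))))\<^sup>2) * indicator {0..1} s
          = G (x + (1 - s) *\<^sub>R v) * indicator {0..1} s"
        unfolding eq G_def using sub[OF True, of "1 - s"] by (auto simp: indicator_def)
    qed
    finally show ?thesis using True by simp
  qed simp
  have "(\<integral>\<^sup>+x\<in>A. ennreal ((f x)\<^sup>2) \<partial>lborel) \<le> (\<integral>\<^sup>+x. 2 * (ennreal ((f (x + v))\<^sup>2) * indicator A x) +
      ennreal (2 * (norm v)\<^sup>2) * (\<integral>\<^sup>+s\<in>{0..1}. G (x + (1 - s) *\<^sub>R v) \<partial>lborel) \<partial>lborel)"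
    by (intro nn_integral_mono pw)
  also have "\<dots> = 2 * (\<integral>\<^sup>+x\<in>A. ennreal ((f (x + v))\<^sup>2) \<partial>lborel) +
      ennreal (2 * (norm v)\<^sup>2) * (\<integral>\<^sup>+x. (\<integral>\<^sup>+s\<in>{0..1}. G (x + (1 - s) *\<^sub>R v) \<partial>lborel) \<partial>lborel)"
    by (subst nn_integral_add) (auto simp: nn_integral_cmult)
  also have "(\<integral>\<^sup>+x. (\<integral>\<^sup>+s\<in>{0..1}. G (x + (1 - s) *\<^sub>R v) \<partial>lborel) \<partial>lborel)
      = (\<integral>\<^sup>+s. (\<integral>\<^sup>+x. G (x + (1 - s) *\<^sub>R v) * indicator {0..1} s \<partial>lborel) \<partial>lborel)"
    by (rule lborel_pair.Fubini'[symmetric]) measurable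
  also have "\<dots> = (\<integral>\<^sup>+s. (\<integral>\<^sup>+x. G x \<partial>lborel) * indicator {0..1::real} s \<partial>lborel)"
    by (simp add: nn_integral_multc nn_integral_lborel_translation)
  also have "\<dots> = (\<integral>\<^sup>+x. G x \<partial>lborel)"
    by (simp add: nn_integral_cmult)
  finally show ?thesis by (simp add: G_def)
qed

section \<open>Sets on which the L2 norm is controlled\<close>

definition sq_energy :: "'a::euclidean_space set \<Rightarrow> 'a set \<Rightarrow> ('a \<Rightarrow> real) \<Rightarrow> ('a \<Rightarrow> 'a) \<Rightarrow> ennreal" where
  "sq_energy \<Omega> \<Gamma> f g = (\<integral>\<^sup>+x\<in>\<Omega>. ennreal ((norm (g x))\<^sup>2) \<partial>lborel) +
     (\<integral>\<^sup>+x\<in>\<Gamma>. ennreal ((f x)\<^sup>2) \<partial>hausdorff_measure (DIM('a) - 1))"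

text \<open>One \<open>K\<close> serves all smooth \<open>f\<close>, and \<open>sq_energy\<close>
  always integrates the gradient over all of \<Omega>. Control is thus a property of the set
  \<open>A\<close> alone, stable under finite unions and transport; for \<open>A = \<Omega>\<close>
  it is the Poincare inequality.\<close>

definition energy_controlled :: "'a::euclidean_space set \<Rightarrow> 'a set \<Rightarrow> 'a set \<Rightarrow> bool" where
  "energy_controlled \<Omega> \<Gamma> A \<longleftrightarrow> A \<in> sets borel \<and>
     (\<exists>K\<ge>0. \<forall>f g. smooth f \<and> (\<forall>x. GDERIV f x :> g x) \<longrightarrow>
        (\<integral>\<^sup>+x\<in>A. ennreal ((f x)\<^sup>2) \<partial>lborel) \<le> ennreal K * sq_energy \<Omega> \<Gamma> f g)"

lemma energy_controlled_subset:
  assumes "energy_controlled \<Omega> \<Gamma> B" "A \<subseteq> B" "A \<in> sets borel"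
  shows "energy_controlled \<Omega> \<Gamma> A"
proof -
  have "(\<integral>\<^sup>+x\<in>A. ennreal ((f x)\<^sup>2) \<partial>lborel) \<le> (\<integral>\<^sup>+x\<in>B. ennreal ((f x)\<^sup>2) \<partial>lborel)" for f :: "'a \<Rightarrow> real"
    by (rule nn_integral_mono) (use assms(2) in \<open>auto simp: indicator_def\<close>)
  then show ?thesis using assms(1,3) unfolding energy_controlled_def by (meson order_trans)
qed

lemma energy_controlled_Un:
  assumes "energy_controlled \<Omega> \<Gamma> A" "energy_controlled \<Omega> \<Gamma> B"
  shows "energy_controlled \<Omega> \<Gamma> (A \<union> B)"
proof -
  obtain K L where K: "K \<ge> 0" "\<forall>f g. smooth f \<and> (\<forall>x. GDERIV f x :> g x) \<longrightarrow>
        (\<integral>\<^sup>+x\<in>A. ennreal ((f x)\<^sup>2) \<partial>lborel) \<le> ennreal K * sq_energy \<Omega> \<Gamma> f g"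
    and L: "L \<ge> 0" "\<forall>f g. smooth f \<and> (\<forall>x. GDERIV f x :> g x) \<longrightarrow>
        (\<integral>\<^sup>+x\<in>B. ennreal ((f x)\<^sup>2) \<partial>lborel) \<le> ennreal L * sq_energy \<Omega> \<Gamma> f g"
    using assms unfolding energy_controlled_def by blast
  have AB[measurable]: "A \<in> sets borel" "B \<in> sets borel"
    using assms by (auto simp: energy_controlled_def)
  have "(\<integral>\<^sup>+x\<in>A \<union> B. ennreal ((f x)\<^sup>2) \<partial>lborel) \<le> ennreal (K + L) * sq_energy \<Omega> \<Gamma> f g"
    if f: "smooth f \<and> (\<forall>x. GDERIV f x :> g x)" for f g
  proof -
    have [measurable]: "f \<in> borel_measurable borel"
      using f smooth_continuous by (intro borel_measurable_continuous_onI) blast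
    have "(\<integral>\<^sup>+x\<in>A \<union> B. ennreal ((f x)\<^sup>2) \<partial>lborel)
        \<le> (\<integral>\<^sup>+x. ennreal ((f x)\<^sup>2) * indicator A x + ennreal ((f x)\<^sup>2) * indicator B x \<partial>lborel)"
      by (intro nn_integral_mono) (auto simp: indicator_def)
    also have "\<dots> = (\<integral>\<^sup>+x\<in>A. ennreal ((f x)\<^sup>2) \<partial>lborel) + (\<integral>\<^sup>+x\<in>B. ennreal ((f x)\<^sup>2) \<partial>lborel)"
      by (rule nn_integral_add) auto
    also have "\<dots> \<le> ennreal K * sq_energy \<Omega> \<Gamma> f g + ennreal L * sq_energy \<Omega> \<Gamma> f g"
      using K(2) L(2) f by (intro add_mono) blast+
    also have "\<dots> = ennreal (K + L) * sq_energy \<Omega> \<Gamma> f g"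
      using K(1) L(1) by (simp add: distrib_right)
    finally show ?thesis .
  qed
  then show ?thesis unfolding energy_controlled_def using K(1) L(1) AB
    by (intro conjI exI[of _ "K + L"]) auto
qed

lemma energy_controlled_UN:
  assumes "finite I" "\<And>i. i \<in> I \<Longrightarrow> energy_controlled \<Omega> \<Gamma> (A i)"
  shows "energy_controlled \<Omega> \<Gamma> (\<Union>i\<in>I. A i)"
  using assms
proof (induction I rule: finite_induct)
  case empty
  show ?case unfolding energy_controlled_def by (auto intro!: exI[of _ 0])
qed (simp add: energy_controlled_Un)

text \<open>In \<open>translated_integral_le\<close> the values of \<open>f\<close> on the translate
  cost \<open>2 * K\<close> through the control on \<open>B\<close>, and the gradient term costs
  \<open>2 * (norm v)\<^sup>2\<close>.\<close>

lemma energy_controlled_translation: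
  assumes B: "energy_controlled \<Omega> \<Gamma> B" and A: "A \<in> sets borel" and \<Omega>: "\<Omega> \<in> sets borel"
    and AB: "\<And>x. x \<in> A \<Longrightarrow> x + v \<in> B"
    and sub: "\<And>x s. x \<in> A \<Longrightarrow> 0 \<le> s \<Longrightarrow> s \<le> 1 \<Longrightarrow> x + s *\<^sub>R v \<in> \<Omega>"
  shows "energy_controlled \<Omega> \<Gamma> A"
proof -
  obtain K where K: "K \<ge> 0" "\<forall>f g. smooth f \<and> (\<forall>x. GDERIV f x :> g x) \<longrightarrow>
        (\<integral>\<^sup>+x\<in>B. ennreal ((f x)\<^sup>2) \<partial>lborel) \<le> ennreal K * sq_energy \<Omega> \<Gamma> f g"
    and [measurable]: "B \<in> sets borel"
    using B unfolding energy_controlled_def by blast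
  have "(\<integral>\<^sup>+x\<in>A. ennreal ((f x)\<^sup>2) \<partial>lborel) \<le> ennreal (2 * K + 2 * (norm v)\<^sup>2) * sq_energy \<Omega> \<Gamma> f g"
    if f: "smooth f \<and> (\<forall>x. GDERIV f x :> g x)" for f g
  proof -
    have d: "GDERIV f x :> g x" for x using f by blast
    have [measurable]: "f \<in> borel_measurable borel"
      using f smooth_continuous by (intro borel_measurable_continuous_onI) blast
    have "(\<integral>\<^sup>+x\<in>A. ennreal ((f x)\<^sup>2) \<partial>lborel) \<le> 2 * (\<integral>\<^sup>+x\<in>A. ennreal ((f (x + v))\<^sup>2) \<partial>lborel) +
      ennreal (2 * (norm v)\<^sup>2) * (\<integral>\<^sup>+x\<in>\<Omega>. ennreal ((norm (g x))\<^sup>2) \<partial>lborel)"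
      by (rule translated_integral_le[OF d smooth_gradient_continuous[OF conjunct1[OF f] d] A \<Omega> sub])
    also have "(\<integral>\<^sup>+x\<in>A. ennreal ((f (x + v))\<^sup>2) \<partial>lborel)
        \<le> (\<integral>\<^sup>+x. ennreal ((f (x + v))\<^sup>2) * indicator B (x + v) \<partial>lborel)"
      by (intro nn_integral_mono) (use AB in \<open>auto simp: indicator_def\<close>)
    also have "\<dots> = (\<integral>\<^sup>+x\<in>B. ennreal ((f x)\<^sup>2) \<partial>lborel)"
      by (rule nn_integral_lborel_translation) measurable
    also have "\<dots> \<le> ennreal K * sq_energy \<Omega> \<Gamma> f g" using K(2) f by blast
    also have "(\<integral>\<^sup>+x\<in>\<Omega>. ennreal ((norm (g x))\<^sup>2) \<partial>lborel) \<le> sq_energy \<Omega> \<Gamma> f g"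
      by (simp add: sq_energy_def)
    also have "2 * (ennreal K * sq_energy \<Omega> \<Gamma> f g) + ennreal (2 * (norm v)\<^sup>2) * sq_energy \<Omega> \<Gamma> f g
        = ennreal (2 * K + 2 * (norm v)\<^sup>2) * sq_energy \<Omega> \<Gamma> f g"
      using K(1) by (simp add: distrib_right ennreal_mult mult.assoc)
    finally show ?thesis by (simp add: add_mono mult_left_mono)
  qed
  then show ?thesis unfolding energy_controlled_def using K(1) A
    by (intro conjI exI[of _ "2 * K + 2 * (norm v)\<^sup>2"]) auto
qed

section \<open>Propagation from the contact to the whole domain\<close>

text \<open>Moving by \<open>w\<close> raises the graph by at most \<open>L\<close> times the
  orthogonal part of \<open>w\<close>, less than the gain in height. A start on the graph itself is
  allowed, so that segments may begin at frontier points and enter \<Omega> at once.\<close>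

lemma lipschitz_graph_cone:
  fixes e x w :: "'a::euclidean_space"
  assumes e: "norm e = 1" and lip: "L-lipschitz_on {y. y \<bullet> e = 0} \<gamma>"
    and x: "\<gamma> (x - (x \<bullet> e) *\<^sub>R e) \<le> x \<bullet> e" and w: "L * norm (w - (w \<bullet> e) *\<^sub>R e) < w \<bullet> e"
  shows "\<gamma> ((x + w) - ((x + w) \<bullet> e) *\<^sub>R e) < (x + w) \<bullet> e"
proof -
  let ?p = "\<lambda>x. x - (x \<bullet> e) *\<^sub>R e"
  have "?p z \<in> {y. y \<bullet> e = 0}" for z
    using e by (simp add: inner_diff_left dot_square_norm)
  from lipschitz_onD[OF lip this this]
  have lip': "\<bar>\<gamma> (?p (x + w)) - \<gamma> (?p x)\<bar> \<le> L * norm (?p (x + w) - ?p x)"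
    by (simp only: dist_norm real_norm_def)
  have eq: "?p (x + w) - ?p x = ?p w" by (simp add: inner_add_left scaleR_add_left)
  show ?thesis using lip' x w inner_add_left[of x w e] unfolding eq by linarith
qed

text \<open>Near a chart point \<open>p\<close>, every \<open>x\<close> in a small piece of \<open>\<Gamma>\<close> is joined with every point of a
  fixed ball inside \<open>\<Omega>\<close> by a segment transversal to the boundary.\<close>

lemma energy_controlled_ball_near_boundary:
  fixes \<Omega> \<Gamma> :: "'a::euclidean_space set"
  assumes \<Omega>: "bounded_lipschitz_domain \<Omega>" and p: "p \<in> frontier \<Omega>"
    and \<Gamma>: "\<Gamma> \<in> sets borel" "\<Gamma> \<subseteq> frontier \<Omega>"
  shows "\<exists>r>0. 0 < hausdorff_outer (DIM('a) - 1) (\<Gamma> \<inter> ball p r) \<longrightarrow>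
    (\<exists>q s. s > 0 \<and> ball q s \<subseteq> \<Omega> \<and> energy_controlled \<Omega> \<Gamma> (ball q s))"
proof -
  have op: "open \<Omega>" and lb: "lipschitz_boundary \<Omega>" using \<Omega> by (auto simp: bounded_lipschitz_domain_def)
  note [measurable] = \<Gamma>(1) borel_open[OF op]
  obtain r e L \<gamma> where r: "r > 0" and e: "norm e = 1" and L: "L \<ge> 0"
    and lip: "L-lipschitz_on {y. y \<bullet> e = 0} \<gamma>"
    and inside: "\<forall>x\<in>ball p r. x \<in> \<Omega> \<longleftrightarrow> \<gamma> (x - (x \<bullet> e) *\<^sub>R e) < x \<bullet> e"
    and graph: "\<forall>x\<in>ball p r. x \<in> frontier \<Omega> \<longrightarrow> \<gamma> (x - (x \<bullet> e) *\<^sub>R e) = x \<bullet> e"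
    using lipschitz_boundary_chart[OF op lb p] by metis
  define k where "k = DIM('a) - 1"
  \<comment> \<open>Points of \<open>ball p r'\<close> moved by at most \<open>2 * \<tau>\<close>
    stay within \<open>3 * \<tau> < r\<close> of \<open>p\<close>, hence inside the chart. The
    tolerance \<rho> is that of \<open>transversal_integral_le\<close>, and \<open>r'\<close> is
    half of it because a vector from \<open>ball p r'\<close> to the ball of radius
    \<open>r'\<close> around \<open>p + \<tau> *\<^sub>R e\<close> differs from
    \<open>\<tau> *\<^sub>R e\<close> by less than \<open>2 * r'\<close>.\<close>
  define \<tau> where "\<tau> = r / 4"
  define \<rho> where "\<rho> = \<tau> / (2 * (1 + L))"
  define r' where "r' = \<rho> / 2"
  have \<tau>: "\<tau> > 0" using r by (simp add: \<tau>_def)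
  have \<rho>: "\<rho> > 0" "(1 + L) * \<rho> < \<tau>" "\<rho> < \<tau>"
  proof -
    have "m * (\<tau> / (2 * m)) = \<tau> / 2" if "m > 0" for m using that by simp
    from this[of "1 + L"] have 1: "(1 + L) * \<rho> = \<tau> / 2" using L by (simp only: \<rho>_def)
    then show "(1 + L) * \<rho> < \<tau>" using \<tau> by simp
    show "\<rho> > 0" using L \<tau> by (simp add: \<rho>_def)
    then have "1 * \<rho> \<le> (1 + L) * \<rho>" using L by (intro mult_right_mono) auto
    then show "\<rho> < \<tau>" using 1 \<tau> by simp
  qed
  have r': "r' > 0" "2 * r' = \<rho>" "r' < \<tau>" using \<rho> by (auto simp: r'_def)
  have r\<tau>: "r = 4 * \<tau>" by (simp add: \<tau>_def)
  have ee: "e \<bullet> e = 1" using e by (simp add: dot_square_norm)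
  have nv: "norm v \<le> 2 * \<tau>" if "norm (v - \<tau> *\<^sub>R e) \<le> \<rho>" for v
    using that e \<tau> \<rho>(3) norm_triangle_sub[of v "\<tau> *\<^sub>R e"] by simp
  have seg: "x + s *\<^sub>R v \<in> \<Omega>"
    if x: "x \<in> frontier \<Omega>" "x \<in> ball p r'" and s: "0 < s" "s \<le> 1" and v: "norm (v - \<tau> *\<^sub>R e) \<le> \<rho>" for x s v
  proof -
    have xr: "x \<in> ball p r" using x(2) r' r\<tau> \<tau> by simp
    have "norm (s *\<^sub>R v) \<le> 2 * \<tau>" using nv[OF v] s mult_left_le_one_le[of "norm v" s] by simp
    moreover have "dist p (x + s *\<^sub>R v) \<le> dist p x + norm (s *\<^sub>R v)"
      using dist_triangle[of p "x + s *\<^sub>R v" x] by (simp add: dist_norm)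
    ultimately have xv: "x + s *\<^sub>R v \<in> ball p r" using x(2) r'(3) r\<tau> \<tau> by simp
    let ?p = "\<lambda>z. z - (z \<bullet> e) *\<^sub>R e"
    have pveq: "?p v = ?p (v - \<tau> *\<^sub>R e)" using ee by (simp add: inner_diff_left scaleR_diff_left)
    have pv: "norm (?p v) \<le> \<rho>"
      unfolding pveq by (rule order_trans[OF norm_orthogonal_part_le[OF e] v])
    have "\<bar>(v - \<tau> *\<^sub>R e) \<bullet> e\<bar> \<le> \<rho>"
      using Cauchy_Schwarz_ineq2[of "v - \<tau> *\<^sub>R e" e] v e by simp
    then have ve: "v \<bullet> e \<ge> \<tau> - \<rho>" using ee by (simp add: inner_diff_left)
    have "L * norm (?p v) \<le> L * \<rho>" using pv L by (rule mult_left_mono)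
    then have "L * norm (?p v) < v \<bullet> e" using ve \<rho>(2) by (simp add: algebra_simps)
    then have "s * (L * norm (?p v)) < s * (v \<bullet> e)" using s(1) by (rule mult_strict_left_mono)
    moreover have "?p (s *\<^sub>R v) = s *\<^sub>R ?p v" by (simp add: scaleR_diff_right)
    then have "norm (?p (s *\<^sub>R v)) = s * norm (?p v)" using s(1) by simp
    ultimately have w: "L * norm (?p (s *\<^sub>R v)) < (s *\<^sub>R v) \<bullet> e" by (simp add: mult.left_commute)
    have "\<gamma> (?p x) \<le> x \<bullet> e" using graph xr x(1) by simp
    from lipschitz_graph_cone[OF e lip this w] show ?thesis using inside xv by blast
  qed
  have "\<exists>q s. s > 0 \<and> ball q s \<subseteq> \<Omega> \<and> energy_controlled \<Omega> \<Gamma> (ball q s)"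
    if pos: "0 < hausdorff_outer k (\<Gamma> \<inter> ball p r')"
  proof -
    define E where "E = \<Gamma> \<inter> ball p r'"
    define B where "B = ball (p + \<tau> *\<^sub>R e) r'"
    define V where "V = cball (\<tau> *\<^sub>R e) \<rho>"
    have E[measurable]: "E \<in> sets borel" unfolding E_def by measurable
    have [measurable]: "V \<in> sets borel" "B \<in> sets borel" by (auto simp: V_def B_def)
    have Esub: "E \<subseteq> frontier \<Omega>" "E \<subseteq> ball p r'" "E \<subseteq> ball p r" using \<Gamma>(2) r' r\<tau> \<tau> by (auto simp: E_def)
    have V: "norm (v - \<tau> *\<^sub>R e) \<le> \<rho>" if "v \<in> V" for v
      using that by (simp add: V_def dist_norm norm_minus_commute)
    have BV: "v \<in> V" if "x \<in> E" "v + x \<in> B" for x v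
    proof -
      have "norm (v + x - (p + \<tau> *\<^sub>R e)) < r'" "norm (p - x) < r'"
        using that Esub by (auto simp: B_def dist_norm norm_minus_commute)
      moreover have "v - \<tau> *\<^sub>R e = (v + x - (p + \<tau> *\<^sub>R e)) + (p - x)" by simp
      ultimately have "norm (v - \<tau> *\<^sub>R e) < r' + r'"
        by (smt (verit) norm_triangle_ineq)
      then show ?thesis using r' by (simp add: V_def dist_norm norm_minus_commute)
    qed
    have B\<Omega>: "B \<subseteq> \<Omega>"
    proof
      fix y assume "y \<in> B"
      then have "norm ((y - p) - \<tau> *\<^sub>R e) \<le> \<rho>"
        using r' by (simp add: B_def dist_norm norm_minus_commute algebra_simps)
      from seg[OF p _ _ _ this, of 1] r' show "y \<in> \<Omega>" by simp
    qed
    have graphE: "lipschitz_graph e L E"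
      by (rule lipschitz_graph_chart[OF e lip]) (use graph Esub in blast)
    obtain C where C: "C \<ge> 0" "\<forall>E v. \<forall>g::'a \<Rightarrow> ennreal. E \<in> sets borel \<and> lipschitz_graph e L E \<and>
        norm (v - \<tau> *\<^sub>R e) \<le> \<tau> / (2 * (1 + L)) \<and> g \<in> borel_measurable borel \<longrightarrow>
        (\<integral>\<^sup>+x. (\<integral>\<^sup>+s\<in>{0..1}. g (x + s *\<^sub>R v) \<partial>lborel) \<partial>restrict_space (hausdorff_measure k) E)
        \<le> ennreal C * (\<integral>\<^sup>+x. g x \<partial>lborel)"
      using transversal_integral_le[OF e L \<tau>] unfolding k_def by blast
    define M where "M = restrict_space (hausdorff_measure k) E"
    have spM: "space M = E" by (simp add: M_def space_restrict_space)
    have HE: "emeasure M (space M) = hausdorff_outer k E"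
      unfolding spM unfolding M_def by (subst emeasure_restrict_space) (auto simp: emeasure_hausdorff_measure)
    have "hausdorff_outer k E < top"
      using hausdorff_outer_frontier_finite[OF \<Omega>] hausdorff_outer_mono[OF Esub(1)]
      unfolding k_def by (rule le_less_trans[rotated])
    then obtain \<eta> where \<eta>: "hausdorff_outer k E = ennreal \<eta>" "\<eta> \<ge> 0"
      by (cases "hausdorff_outer k E") auto
    have \<eta>0: "\<eta> > 0" using pos \<eta> by (simp add: E_def[symmetric])
    interpret M: finite_measure M by (rule finite_measureI) (simp add: HE \<eta>)
    interpret P: pair_sigma_finite M lborel ..
    have toM: "h \<in> borel_measurable M" if "h \<in> borel_measurable borel" for h :: "'a \<Rightarrow> ennreal"
      unfolding M_def using that by (intro measurable_restrict_space1) simp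
    have idM: "(\<lambda>x. x) \<in> M \<rightarrow>\<^sub>M borel"
      unfolding M_def by (intro measurable_restrict_space1 measurable_ident_sets) simp
    define \<omega> where "\<omega> = measure lborel V"
    have \<omega>: "emeasure lborel V = ennreal \<omega>" "\<omega> \<ge> 0"
    proof -
      have "emeasure lborel V < \<infinity>" unfolding V_def by (rule emeasure_bounded_finite) simp
      then show "emeasure lborel V = ennreal \<omega>"
        unfolding \<omega>_def by (intro emeasure_eq_ennreal_measure) simp
    qed (simp add: \<omega>_def)
    \<comment> \<open>The 2 pays for the values on \<Gamma>; the rest is
      \<open>2 * (norm v)\<^sup>2 * C\<close> with \<open>norm v \<le> 2 * \<tau>\<close>, where
      \<open>C\<close> bounds the transversal integral of the gradient.\<close>
    define K where "K = 2 + 8 * \<tau>\<^sup>2 * C"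
    have K: "K \<ge> 0" using C(1) by (simp add: K_def)
    have bound: "(\<integral>\<^sup>+x\<in>B. ennreal ((f x)\<^sup>2) \<partial>lborel) \<le> ennreal (\<omega> * K / \<eta>) * sq_energy \<Omega> \<Gamma> f g"
      if f: "smooth f \<and> (\<forall>x. GDERIV f x :> g x)" for f g
    proof -
      have d: "GDERIV f x :> g x" for x using f by blast
      have cg: "continuous_on UNIV g" by (rule smooth_gradient_continuous[OF conjunct1[OF f] d])
      have fm[measurable]: "f \<in> borel_measurable borel"
        using f smooth_continuous by (intro borel_measurable_continuous_onI) blast
      have [measurable]: "g \<in> borel_measurable borel" using cg by (rule borel_measurable_continuous_onI)
      define G where "G x = ennreal ((norm (g x))\<^sup>2) * indicator \<Omega> x" for x
      have Gm[measurable]: "G \<in> borel_measurable borel" unfolding G_def by measurable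
      have Fm: "(\<lambda>z. ennreal ((f (fst z + snd z))\<^sup>2) * indicator V (snd z)) \<in> borel_measurable (M \<Otimes>\<^sub>M lborel)"
      proof -
        have pm: "(\<lambda>z. (fst z, snd z)) \<in> M \<Otimes>\<^sub>M lborel \<rightarrow>\<^sub>M borel \<Otimes>\<^sub>M borel"
          by (intro measurable_Pair measurable_compose[OF measurable_fst idM]) simp
        have hm: "(\<lambda>z. ennreal ((f (fst z + snd z))\<^sup>2) * indicator V (snd z)) \<in> borel_measurable (borel \<Otimes>\<^sub>M borel)"
          by measurable
        from measurable_compose[OF pm hm] show ?thesis by simp
      qed
      have slice: "(\<integral>\<^sup>+x. ennreal ((f (x + v))\<^sup>2) \<partial>M) \<le> ennreal K * sq_energy \<Omega> \<Gamma> f g" if v: "v \<in> V" for v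
      proof -
        have "(\<integral>\<^sup>+x. ennreal ((f (x + v))\<^sup>2) \<partial>M) \<le> (\<integral>\<^sup>+x. 2 * ennreal ((f x)\<^sup>2) + ennreal (2 * (norm v)\<^sup>2) *
            (\<integral>\<^sup>+s\<in>{0..1}. G (x + s *\<^sub>R v) \<partial>lborel) \<partial>M)"
        proof (rule nn_integral_mono)
          fix x assume "x \<in> space M"
          then have x: "x \<in> frontier \<Omega>" "x \<in> ball p r'" using spM Esub by auto
          \<comment> \<open>At \<open>s = 0\<close> the segment sits at \<open>x\<close> on the
            frontier, outside \<Omega>; a single parameter is a null set, so the cut-off in
            \<open>G\<close> is still invisible.\<close>
          have eq: "(\<integral>\<^sup>+s\<in>{0..1}. ennreal ((norm (g (x + s *\<^sub>R v)))\<^sup>2) \<partial>lborel) = (\<integral>\<^sup>+s\<in>{0..1}. G (x + s *\<^sub>R v) \<partial>lborel)"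
          proof (rule nn_integral_cong_AE)
            show "AE s in lborel. ennreal ((norm (g (x + s *\<^sub>R v)))\<^sup>2) * indicator {0..1} s = G (x + s *\<^sub>R v) * indicator {0..1} s"
              using AE_lborel_singleton[of "0::real"]
            proof eventually_elim
              case (elim s)
              show ?case
              proof (cases "s \<in> {0..1}")
                case True
                then have "x + s *\<^sub>R v \<in> \<Omega>" using elim by (intro seg[OF x _ _ V[OF v]]) auto
                then show ?thesis by (simp add: G_def)
              qed simp
            qed
          qed
          show "ennreal ((f (x + v))\<^sup>2) \<le> 2 * ennreal ((f x)\<^sup>2) + ennreal (2 * (norm v)\<^sup>2) *
            (\<integral>\<^sup>+s\<in>{0..1}. G (x + s *\<^sub>R v) \<partial>lborel)"
            using power2_add_le_line_integral[OF d cg, of x v] unfolding eq .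
        qed
        also have "\<dots> = 2 * (\<integral>\<^sup>+x. ennreal ((f x)\<^sup>2) \<partial>M) + ennreal (2 * (norm v)\<^sup>2) *
            (\<integral>\<^sup>+x. (\<integral>\<^sup>+s\<in>{0..1}. G (x + s *\<^sub>R v) \<partial>lborel) \<partial>M)"
        proof -
          have m1: "(\<lambda>x. ennreal ((f x)\<^sup>2)) \<in> borel_measurable M" by (rule toM) measurable
          have m2: "(\<lambda>x. \<integral>\<^sup>+s\<in>{0..1}. G (x + s *\<^sub>R v) \<partial>lborel) \<in> borel_measurable M"
            by (rule toM) measurable
          show ?thesis using m1 m2 by (simp add: nn_integral_add nn_integral_cmult)
        qed
        also have "(\<integral>\<^sup>+x. ennreal ((f x)\<^sup>2) \<partial>M) \<le> (\<integral>\<^sup>+x\<in>\<Gamma>. ennreal ((f x)\<^sup>2) \<partial>hausdorff_measure k)"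
        proof -
          have "(\<integral>\<^sup>+x. ennreal ((f x)\<^sup>2) \<partial>M) = (\<integral>\<^sup>+x\<in>E. ennreal ((f x)\<^sup>2) \<partial>hausdorff_measure k)"
            unfolding M_def by (subst nn_integral_restrict_space) auto
          also have "\<dots> \<le> (\<integral>\<^sup>+x\<in>\<Gamma>. ennreal ((f x)\<^sup>2) \<partial>hausdorff_measure k)"
            by (intro nn_integral_mono) (auto simp: E_def indicator_def)
          finally show ?thesis .
        qed
        also have "\<dots> \<le> sq_energy \<Omega> \<Gamma> f g" by (simp add: sq_energy_def k_def)
        also have "(\<integral>\<^sup>+x. (\<integral>\<^sup>+s\<in>{0..1}. G (x + s *\<^sub>R v) \<partial>lborel) \<partial>M) \<le> ennreal C * (\<integral>\<^sup>+x. G x \<partial>lborel)"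
          unfolding M_def using C(2) E graphE V[OF v] Gm unfolding \<rho>_def by blast
        also have "(\<integral>\<^sup>+x. G x \<partial>lborel) \<le> sq_energy \<Omega> \<Gamma> f g" by (simp add: sq_energy_def G_def)
        also have "ennreal (2 * (norm v)\<^sup>2) \<le> ennreal (8 * \<tau>\<^sup>2)"
        proof -
          have "(norm v)\<^sup>2 \<le> (2 * \<tau>)\<^sup>2" using nv[OF V[OF v]] by (intro power_mono) auto
          then show ?thesis by (intro ennreal_leI) (simp add: power_mult_distrib)
        qed
        also have "2 * sq_energy \<Omega> \<Gamma> f g + ennreal (8 * \<tau>\<^sup>2) * (ennreal C * sq_energy \<Omega> \<Gamma> f g)
            = ennreal K * sq_energy \<Omega> \<Gamma> f g"
          using C(1) by (simp add: K_def distrib_right ennreal_mult mult.assoc)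
        finally show ?thesis by (simp add: add_mono mult_mono mult_left_mono mult_right_mono)
      qed
      \<comment> \<open>The integral over \<open>B\<close> is averaged over the starting points in
        \<open>E\<close>, of total measure \<eta>. Substituting y = x + v turns \<open>B\<close>
        into a subset of the fixed ball \<open>V\<close> of vectors, and Fubini then brings
        \<open>v\<close> outside, where \<open>slice\<close> applies.\<close>
      have "(\<integral>\<^sup>+x\<in>B. ennreal ((f x)\<^sup>2) \<partial>lborel) * ennreal \<eta> = (\<integral>\<^sup>+x. (\<integral>\<^sup>+y\<in>B. ennreal ((f y)\<^sup>2) \<partial>lborel) \<partial>M)"
        by (simp add: HE \<eta>)
      also have "\<dots> \<le> (\<integral>\<^sup>+x. (\<integral>\<^sup>+v. ennreal ((f (x + v))\<^sup>2) * indicator V v \<partial>lborel) \<partial>M)"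
      proof (rule nn_integral_mono)
        fix x assume x: "x \<in> space M"
        have "(\<integral>\<^sup>+y\<in>B. ennreal ((f y)\<^sup>2) \<partial>lborel) = (\<integral>\<^sup>+v. ennreal ((f (v + x))\<^sup>2) * indicator B (v + x) \<partial>lborel)"
          by (rule nn_integral_lborel_translation[symmetric]) measurable
        also have "\<dots> \<le> (\<integral>\<^sup>+v. ennreal ((f (x + v))\<^sup>2) * indicator V v \<partial>lborel)"
        proof (rule nn_integral_mono)
          fix v
          have "indicator B (v + x) \<le> (indicator V v :: ennreal)"
            using BV[of x v] x spM by (auto simp: indicator_def)
          then show "ennreal ((f (v + x))\<^sup>2) * indicator B (v + x) \<le> ennreal ((f (x + v))\<^sup>2) * indicator V v"
            by (subst add.commute) (auto intro: mult_left_mono simp: add.commute)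
        qed
        finally show "(\<integral>\<^sup>+y\<in>B. ennreal ((f y)\<^sup>2) \<partial>lborel) \<le> (\<integral>\<^sup>+v. ennreal ((f (x + v))\<^sup>2) * indicator V v \<partial>lborel)" .
      qed
      also have "\<dots> = (\<integral>\<^sup>+v. (\<integral>\<^sup>+x. ennreal ((f (x + v))\<^sup>2) * indicator V v \<partial>M) \<partial>lborel)"
        using P.Fubini[OF Fm] by simp
      also have "\<dots> \<le> (\<integral>\<^sup>+v. (ennreal K * sq_energy \<Omega> \<Gamma> f g) * indicator V v \<partial>lborel)"
      proof (rule nn_integral_mono)
        fix v
        show "(\<integral>\<^sup>+x. ennreal ((f (x + v))\<^sup>2) * indicator V v \<partial>M) \<le> (ennreal K * sq_energy \<Omega> \<Gamma> f g) * indicator V v"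
          using slice[of v] by (cases "v \<in> V") auto
      qed
      also have "\<dots> = ennreal K * sq_energy \<Omega> \<Gamma> f g * ennreal \<omega>"
        by (simp add: nn_integral_cmult_indicator \<omega>(1))
      finally have *: "(\<integral>\<^sup>+x\<in>B. ennreal ((f x)\<^sup>2) \<partial>lborel) * ennreal \<eta> \<le> ennreal K * sq_energy \<Omega> \<Gamma> f g * ennreal \<omega>" .
      have "(\<integral>\<^sup>+x\<in>B. ennreal ((f x)\<^sup>2) \<partial>lborel) = (\<integral>\<^sup>+x\<in>B. ennreal ((f x)\<^sup>2) \<partial>lborel) * (ennreal \<eta> * ennreal (1 / \<eta>))"
        using \<eta>0 by (simp add: ennreal_mult[symmetric])
      also have "\<dots> \<le> (ennreal K * sq_energy \<Omega> \<Gamma> f g * ennreal \<omega>) * ennreal (1 / \<eta>)"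
        unfolding mult.assoc[symmetric] using * by (intro mult_right_mono) (auto simp: mult.assoc)
      also have "\<dots> = (ennreal \<omega> * ennreal K * ennreal (1 / \<eta>)) * sq_energy \<Omega> \<Gamma> f g"
        by (simp add: mult_ac)
      also have "ennreal \<omega> * ennreal K * ennreal (1 / \<eta>) = ennreal (\<omega> * K / \<eta>)"
        using \<omega>(2) K \<eta>0 by (simp add: ennreal_mult[symmetric])
      finally show ?thesis .
    qed
    have "0 \<le> \<omega> * K / \<eta>" using \<omega>(2) K \<eta>0 by simp
    with bound have "energy_controlled \<Omega> \<Gamma> B" unfolding energy_controlled_def
      by (intro conjI exI[of _ "\<omega> * K / \<eta>"]) auto
    then show ?thesis using B\<Omega> r'(1) unfolding B_def by blast
  qed
  then show ?thesis using r'(1) unfolding k_def by blast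
qed

text \<open>Within a ball contained in \<Omega>, a small ball around one point can be translated
  onto one around any other. Having some controlled ball is therefore locally constant, and
  connectedness spreads it over \<Omega>.\<close>

lemma energy_controlled_ball_connected:
  fixes \<Omega> :: "'a::euclidean_space set"
  assumes \<Omega>: "open \<Omega>" "connected \<Omega>"
    and q: "s > 0" "ball q s \<subseteq> \<Omega>" "energy_controlled \<Omega> \<Gamma> (ball q s)" and p: "p \<in> \<Omega>"
  shows "\<exists>s>0. ball p s \<subseteq> \<Omega> \<and> energy_controlled \<Omega> \<Gamma> (ball p s)"
proof (rule connected_induction_simple[OF \<Omega>(2) _ p])
  show "q \<in> \<Omega>" using q by auto
  show "\<exists>s>0. ball q s \<subseteq> \<Omega> \<and> energy_controlled \<Omega> \<Gamma> (ball q s)" using q by blast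
  fix a assume "a \<in> \<Omega>"
  then obtain R where R: "R > 0" "ball a R \<subseteq> \<Omega>" using \<Omega>(1) openE by blast
  \<comment> \<open>Half of the radius is reserved for the segment between the centres, which stays
    in \<open>ball a r\<close> by convexity, and half for the deviation of a moving point from that
    segment.\<close>
  define r where "r = R / 2"
  have r: "r > 0" "R = 2 * r" using R(1) by (auto simp: r_def)
  have main: "\<exists>s>0. ball y s \<subseteq> \<Omega> \<and> energy_controlled \<Omega> \<Gamma> (ball y s)"
    if xy: "x \<in> ball a r" "y \<in> ball a r" and x: "\<exists>s>0. ball x s \<subseteq> \<Omega> \<and> energy_controlled \<Omega> \<Gamma> (ball x s)" for x y
  proof -
    obtain s where s: "s > 0" "energy_controlled \<Omega> \<Gamma> (ball x s)" using x by blast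
    define t where "t = min s r"
    have t: "t > 0" "t \<le> s" "t \<le> r" using s(1) r by (auto simp: t_def)
    have seg: "z + c *\<^sub>R (x - y) \<in> \<Omega>" if z: "z \<in> ball y t" and c: "0 \<le> c" "c \<le> 1" for z c
    proof -
      have "(1 - c) *\<^sub>R y + c *\<^sub>R x \<in> ball a r"
        by (rule convexD[OF convex_ball]) (use xy c in auto)
      then have "norm (a - ((1 - c) *\<^sub>R y + c *\<^sub>R x)) < r" by (simp add: dist_norm)
      moreover have "norm (y - z) < r" using z t by (simp add: dist_norm)
      moreover have eq: "a - (z + c *\<^sub>R (x - y)) = (a - ((1 - c) *\<^sub>R y + c *\<^sub>R x)) + (y - z)"
        by (simp add: algebra_simps)
      ultimately have "norm (a - (z + c *\<^sub>R (x - y))) < R"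
        unfolding eq r(2)
        using norm_triangle_ineq[of "a - ((1 - c) *\<^sub>R y + c *\<^sub>R x)" "y - z"] by linarith
      then show ?thesis using R(2) by (auto simp: dist_norm)
    qed
    have "energy_controlled \<Omega> \<Gamma> (ball y t)"
    proof (rule energy_controlled_translation[OF s(2) _ borel_open[OF \<Omega>(1)]])
      show "z + (x - y) \<in> ball x s" if "z \<in> ball y t" for z
        using that t(2) by (simp add: dist_norm algebra_simps)
    qed (use seg in auto)
    moreover have "ball y t \<subseteq> \<Omega>" using seg[of _ 0] by auto
    ultimately show ?thesis using t(1) by blast
  qed
  have op: "openin (top_of_set \<Omega>) (ball a r)"
    using R(2) r by (intro open_subset) auto
  have mem: "a \<in> ball a r" using r(1) by simp
  show "\<exists>T. openin (top_of_set \<Omega>) T \<and> a \<in> T \<and>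
      (\<forall>x\<in>T. \<forall>y\<in>T. (\<exists>s>0. ball x s \<subseteq> \<Omega> \<and> energy_controlled \<Omega> \<Gamma> (ball x s)) \<longrightarrow>
        (\<exists>s>0. ball y s \<subseteq> \<Omega> \<and> energy_controlled \<Omega> \<Gamma> (ball y s)))"
  proof (intro exI[of _ "ball a r"] conjI ballI impI op mem)
    fix x y assume "x \<in> ball a r" "y \<in> ball a r" "\<exists>s>0. ball x s \<subseteq> \<Omega> \<and> energy_controlled \<Omega> \<Gamma> (ball x s)"
    then show "\<exists>s>0. ball y s \<subseteq> \<Omega> \<and> energy_controlled \<Omega> \<Gamma> (ball y s)" by (rule main)
  qed
qed

text \<open>Above the graph, moving in direction \<open>e\<close> never leaves \<Omega> within the
  chart. So a single translation by \<open>\<tau> *\<^sub>R e\<close> carries the part of \<Omega>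
  near \<open>p\<close> into a controlled interior ball; starting within \<open>r / 2\<close> of
  \<open>p\<close> and moving by at most \<open>r / 2\<close> keeps the path inside the
  chart.\<close>

lemma energy_controlled_boundary_neighbourhood:
  fixes \<Omega> :: "'a::euclidean_space set"
  assumes op: "open \<Omega>" and lb: "lipschitz_boundary \<Omega>" and p: "p \<in> frontier \<Omega>"
    and inner: "\<And>x. x \<in> \<Omega> \<Longrightarrow> \<exists>s>0. ball x s \<subseteq> \<Omega> \<and> energy_controlled \<Omega> \<Gamma> (ball x s)"
  shows "\<exists>r>0. energy_controlled \<Omega> \<Gamma> (ball p r \<inter> \<Omega>)"
proof -
  obtain r e L \<gamma> where r: "r > 0" and e: "norm e = 1" and L: "L \<ge> 0"
    and lip: "L-lipschitz_on {y. y \<bullet> e = 0} \<gamma>"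
    and inside: "\<forall>x\<in>ball p r. x \<in> \<Omega> \<longleftrightarrow> \<gamma> (x - (x \<bullet> e) *\<^sub>R e) < x \<bullet> e"
    and graph: "\<forall>x\<in>ball p r. x \<in> frontier \<Omega> \<longrightarrow> \<gamma> (x - (x \<bullet> e) *\<^sub>R e) = x \<bullet> e"
    using lipschitz_boundary_chart[OF op lb p] by metis
  have ee: "e \<bullet> e = 1" using e by (simp add: dot_square_norm)
  have up: "x + c *\<^sub>R e \<in> \<Omega>"
    if "\<gamma> (x - (x \<bullet> e) *\<^sub>R e) \<le> x \<bullet> e" "c > 0" "x + c *\<^sub>R e \<in> ball p r" for x c
  proof -
    have "L * norm (c *\<^sub>R e - ((c *\<^sub>R e) \<bullet> e) *\<^sub>R e) < (c *\<^sub>R e) \<bullet> e" using ee that(2) by simp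
    from lipschitz_graph_cone[OF e lip that(1) this] show ?thesis using inside that(3) by blast
  qed
  have near: "x + c *\<^sub>R e \<in> ball p r" if "x \<in> ball p (r / 2)" "0 \<le> c" "c \<le> r / 2" for x c
  proof -
    have "dist p (x + c *\<^sub>R e) \<le> dist p x + c"
      using dist_triangle[of p "x + c *\<^sub>R e" x] e that by (simp add: dist_norm)
    then show ?thesis using that by simp
  qed
  define \<tau> where "\<tau> = r / 2"
  have \<tau>: "\<tau> > 0" "\<tau> \<le> r / 2" using r by (auto simp: \<tau>_def)
  have "p + \<tau> *\<^sub>R e \<in> \<Omega>"
    using up[of p \<tau>] near[of p \<tau>] graph p r \<tau> by simp
  then obtain s where s: "s > 0" "energy_controlled \<Omega> \<Gamma> (ball (p + \<tau> *\<^sub>R e) s)" using inner by blast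
  define t where "t = min s (r / 2)"
  have t: "t > 0" "t \<le> s" "t \<le> r / 2" using s(1) r by (auto simp: t_def)
  have "energy_controlled \<Omega> \<Gamma> (ball p t \<inter> \<Omega>)"
  proof (rule energy_controlled_translation[OF s(2) _ borel_open[OF op]])
    show "ball p t \<inter> \<Omega> \<in> sets borel" using op by (intro borel_open open_Int) auto
    show "x + \<tau> *\<^sub>R e \<in> ball (p + \<tau> *\<^sub>R e) s" if "x \<in> ball p t \<inter> \<Omega>" for x
      using that t(2) by (simp add: dist_norm)
    fix x c assume x: "x \<in> ball p t \<inter> \<Omega>" and c: "0 \<le> c" "c \<le> (1::real)"
    show "x + c *\<^sub>R (\<tau> *\<^sub>R e) \<in> \<Omega>"
    proof (cases "c = 0")
      case False
      have c\<tau>: "0 < c * \<tau>" "c * \<tau> \<le> r / 2"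
        using c \<tau> False mult_left_le_one_le[of \<tau> c] by (simp_all add: zero_less_mult_iff, linarith)
      have "x \<in> ball p (r / 2)" "x \<in> ball p r" using x t r by auto
      then show ?thesis using up[of x "c * \<tau>"] near[of x "c * \<tau>"] c\<tau> inside x by simp
    qed (use x in simp)
  qed
  then show ?thesis using t(1) by blast
qed

lemma energy_controlled_domain:
  fixes \<Omega> \<Gamma> :: "'a::euclidean_space set"
  assumes \<Omega>: "bounded_lipschitz_domain \<Omega>" and \<Gamma>: "\<Gamma> \<in> sets borel" "\<Gamma> \<subseteq> frontier \<Omega>"
    and pos: "0 < hausdorff_outer (DIM('a) - 1) \<Gamma>"
  shows "energy_controlled \<Omega> \<Gamma> \<Omega>"
proof -
  have dom: "open \<Omega>" "connected \<Omega>" "bounded \<Omega>" "lipschitz_boundary \<Omega>"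
    using \<Omega> by (auto simp: bounded_lipschitz_domain_def)
  define good where "good \<longleftrightarrow> (\<exists>q s. s > 0 \<and> ball q s \<subseteq> \<Omega> \<and> energy_controlled \<Omega> \<Gamma> (ball q s))"
  have "\<forall>p\<in>frontier \<Omega>. \<exists>r>0. 0 < hausdorff_outer (DIM('a) - 1) (\<Gamma> \<inter> ball p r) \<longrightarrow> good"
    unfolding good_def using energy_controlled_ball_near_boundary[OF \<Omega> _ \<Gamma>] by blast
  then obtain r where r: "\<forall>p\<in>frontier \<Omega>. r p > 0 \<and> (0 < hausdorff_outer (DIM('a) - 1) (\<Gamma> \<inter> ball p (r p)) \<longrightarrow> good)"
    by metis
  have "compact (frontier \<Omega>)" using dom(3) by (rule compact_frontier_bounded)
  then obtain P where P: "finite P" "P \<subseteq> frontier \<Omega>" "frontier \<Omega> \<subseteq> (\<Union>p\<in>P. ball p (r p))"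
  proof (rule compactE_image)
    show "frontier \<Omega> \<subseteq> (\<Union>p\<in>frontier \<Omega>. ball p (r p))" using r by force
  qed auto
  \<comment> \<open>Which chart meets the contact in positive measure is not known in advance. If
    none of the finitely many did, subadditivity would make \<Gamma> a null set.\<close>
  have good
  proof (rule ccontr)
    assume "\<not> good"
    then have zero: "hausdorff_outer (DIM('a) - 1) (\<Gamma> \<inter> ball p (r p)) = 0" if "p \<in> P" for p
      using r P(2) that by (metis not_gr_zero subsetD)
    have "hausdorff_outer (DIM('a) - 1) (\<Union>p\<in>P. \<Gamma> \<inter> ball p (r p)) = 0"
      using P(1) zero
    proof (induction P rule: finite_induct)
      case (insert p P)
      then show ?case
        using hausdorff_outer_Un[of "DIM('a) - 1" "\<Gamma> \<inter> ball p (r p)" "\<Union>p\<in>P. \<Gamma> \<inter> ball p (r p)"] by simp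
    qed (simp add: hausdorff_outer_empty)
    moreover have "\<Gamma> \<subseteq> (\<Union>p\<in>P. \<Gamma> \<inter> ball p (r p))" using P(3) \<Gamma>(2) by blast
    ultimately show False using pos hausdorff_outer_mono[of \<Gamma>] by (metis le_zero_eq less_irrefl)
  qed
  then obtain q s where q: "s > 0" "ball q s \<subseteq> \<Omega>" "energy_controlled \<Omega> \<Gamma> (ball q s)"
    unfolding good_def by blast
  note inner = energy_controlled_ball_connected[OF dom(1,2) q]
  have "\<exists>r>0. energy_controlled \<Omega> \<Gamma> (ball p r \<inter> \<Omega>)" if p: "p \<in> closure \<Omega>" for p
  proof (cases "p \<in> \<Omega>")
    case True
    then obtain r where r: "r > 0" "ball p r \<subseteq> \<Omega>" "energy_controlled \<Omega> \<Gamma> (ball p r)" using inner by blast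
    then have "ball p r \<inter> \<Omega> = ball p r" by blast
    then show ?thesis using r by metis
  next
    case False
    then have "p \<in> frontier \<Omega>" using p dom(1) by (simp add: frontier_def interior_open)
    then show ?thesis by (rule energy_controlled_boundary_neighbourhood[OF dom(1,4) _ inner])
  qed
  then obtain r where r: "\<forall>p\<in>closure \<Omega>. r p > 0 \<and> energy_controlled \<Omega> \<Gamma> (ball p (r p) \<inter> \<Omega>)" by metis
  have "compact (closure \<Omega>)" using dom(3) by simp
  then obtain P where P: "finite P" "P \<subseteq> closure \<Omega>" "closure \<Omega> \<subseteq> (\<Union>p\<in>P. ball p (r p))"
  proof (rule compactE_image)
    show "closure \<Omega> \<subseteq> (\<Union>p\<in>closure \<Omega>. ball p (r p))" using r by force
  qed auto
  have "energy_controlled \<Omega> \<Gamma> (\<Union>p\<in>P. ball p (r p) \<inter> \<Omega>)"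
    using r P(2) by (intro energy_controlled_UN P(1)) blast
  moreover have "\<Omega> \<subseteq> (\<Union>p\<in>P. ball p (r p) \<inter> \<Omega>)" using P(3) closure_subset[of \<Omega>] by blast
  ultimately show ?thesis by (rule energy_controlled_subset) (use dom(1) in simp)
qed

section \<open>Functions with vanishing trace\<close>

lemma measurable_surface_measure_if_continuous:
  fixes f :: "'a::euclidean_space \<Rightarrow> real"
  assumes "continuous_on UNIV f"
  shows "f \<in> borel_measurable (surface_measure \<Omega>)"
  unfolding surface_measure_def
  using borel_measurable_continuous_onI[OF assms] by (intro measurable_restrict_space1) simp

lemma L2_surface_measure_continuous:
  fixes f :: "'a::euclidean_space \<Rightarrow> real"
  assumes "bounded_lipschitz_domain \<Omega>" "continuous_on UNIV f"
  shows "f \<in> L2 (surface_measure \<Omega>)"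
  by (rule L2_continuous[OF finite_measure_surface_measure[OF assms(1)]
        measurable_surface_measure_if_continuous[OF assms(2)] assms(2), of "frontier \<Omega>"])
     (use assms(1) in \<open>auto simp: space_surface_measure bounded_lipschitz_domain_def compact_frontier_bounded\<close>)

lemma nn_integral_norm_power2:
  assumes "f \<in> L2 M"
  shows "(\<integral>\<^sup>+x. ennreal ((norm (f x))\<^sup>2) \<partial>M) = ennreal ((L2_norm M f)\<^sup>2)"
  unfolding L2_norm_power2 by (rule nn_integral_eq_integral[OF L2_D(2)[OF assms]]) simp

lemma H1_norm_power2:
  "(H1_norm \<Omega> u)\<^sup>2 = (L2_norm (lebesgue_on \<Omega>) u)\<^sup>2 + (L2_norm (lebesgue_on \<Omega>) (weak_gradient \<Omega> u))\<^sup>2"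
  by (simp add: H1_norm_def)

lemma H1_norm_nonneg [simp]: "0 \<le> H1_norm \<Omega> u"
  by (simp add: H1_norm_def)

lemma lipschitz_domain_lmeasurable: "bounded_lipschitz_domain \<Omega> \<Longrightarrow> \<Omega> \<in> lmeasurable"
  by (simp add: bounded_lipschitz_domain_def lmeasurable_open)

text \<open>The representative chosen for the difference agrees with the difference of the chosen
  representatives only almost everywhere, which the norm does not see.\<close>

lemma L2_norm_weak_gradient_diff:
  assumes "open \<Omega>" "\<Omega> \<in> lmeasurable" "u \<in> H1 \<Omega>" "v \<in> H1 \<Omega>"
  shows "L2_norm (lebesgue_on \<Omega>) (weak_gradient \<Omega> (\<lambda>x. u x - v x))
    = L2_norm (lebesgue_on \<Omega>) (\<lambda>x. weak_gradient \<Omega> u x - weak_gradient \<Omega> v x)"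
proof (rule L2_norm_cong_AE[OF _ _ H1_diff(2)[OF assms]])
  show "weak_gradient \<Omega> (\<lambda>x. u x - v x) \<in> borel_measurable (lebesgue_on \<Omega>)"
    by (rule L2_D(1)[OF H1_weak_gradient(2)[OF H1_diff(1)[OF assms]]])
  show "(\<lambda>x. weak_gradient \<Omega> u x - weak_gradient \<Omega> v x) \<in> borel_measurable (lebesgue_on \<Omega>)"
    by (rule L2_D(1)[OF L2_diff[OF H1_weak_gradient(2)[OF assms(3)] H1_weak_gradient(2)[OF assms(4)]]])
qed

lemma H1_norm_diff_le:
  assumes "open \<Omega>" "\<Omega> \<in> lmeasurable" "u \<in> H1 \<Omega>" "v \<in> H1 \<Omega>"
  shows "H1_norm \<Omega> (\<lambda>x. u x - v x) \<le> 2 * (H1_norm \<Omega> u + H1_norm \<Omega> v)"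
proof (rule power2_le_imp_le)
  note u = H1_weak_gradient[OF assms(3)] and v = H1_weak_gradient[OF assms(4)]
  have "(H1_norm \<Omega> (\<lambda>x. u x - v x))\<^sup>2 \<le> 2 * (H1_norm \<Omega> u)\<^sup>2 + 2 * (H1_norm \<Omega> v)\<^sup>2"
    using L2_norm_diff_power2_le[OF u(1) v(1)] L2_norm_diff_power2_le[OF u(2) v(2)]
    unfolding H1_norm_power2 L2_norm_weak_gradient_diff[OF assms] by simp
  also have "\<dots> \<le> (2 * (H1_norm \<Omega> u + H1_norm \<Omega> v))\<^sup>2"
    by (simp add: power2_sum power_mult_distrib)
  finally show "(H1_norm \<Omega> (\<lambda>x. u x - v x))\<^sup>2 \<le> (2 * (H1_norm \<Omega> u + H1_norm \<Omega> v))\<^sup>2" .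
qed simp

lemma L2_norm_diff_le:
  assumes "f \<in> L2 M" "g \<in> L2 M"
  shows "L2_norm M (\<lambda>x. f x - g x) \<le> 2 * (L2_norm M f + L2_norm M g)"
proof (rule power2_le_imp_le)
  have "(L2_norm M (\<lambda>x. f x - g x))\<^sup>2 \<le> 2 * (L2_norm M f)\<^sup>2 + 2 * (L2_norm M g)\<^sup>2"
    by (rule L2_norm_diff_power2_le[OF assms])
  also have "\<dots> \<le> (2 * (L2_norm M f + L2_norm M g))\<^sup>2"
    by (simp add: power2_sum power_mult_distrib)
  finally show "(L2_norm M (\<lambda>x. f x - g x))\<^sup>2 \<le> (2 * (L2_norm M f + L2_norm M g))\<^sup>2" .
qed simp

lemma smooth_in_H1:
  fixes \<phi> :: "'a::euclidean_space \<Rightarrow> real"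
  assumes "open \<Omega>" "bounded \<Omega>" "smooth \<phi>"
  shows "\<phi> \<in> H1 \<Omega>"
proof -
  obtain g where "\<forall>x. GDERIV \<phi> x :> g x" using smooth_gradient[OF assms(3)] by blast
  then show ?thesis by (intro H1_smooth(1)[OF assms]) blast
qed

lemma has_trace_diff:
  fixes \<Omega> :: "'a::euclidean_space set"
  assumes \<Omega>: "bounded_lipschitz_domain \<Omega>" and u: "has_trace \<Omega> u h" and v: "has_trace \<Omega> v k"
  shows "has_trace \<Omega> (\<lambda>x. u x - v x) (\<lambda>x. h x - k x)"
proof -
  have op: "open \<Omega>" "bounded \<Omega>" using \<Omega> by (auto simp: bounded_lipschitz_domain_def)
  note lm = lipschitz_domain_lmeasurable[OF \<Omega>]
  have uv: "u \<in> H1 \<Omega>" "v \<in> H1 \<Omega>" and hk: "h \<in> L2 (surface_measure \<Omega>)" "k \<in> L2 (surface_measure \<Omega>)"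
    using u v by (auto simp: has_trace_def)
  obtain \<phi> where \<phi>: "\<forall>n. smooth (\<phi> n)" "(\<lambda>n. H1_norm \<Omega> (\<lambda>x. \<phi> n x - u x)) \<longlonglongrightarrow> 0"
      "(\<lambda>n. L2_norm (surface_measure \<Omega>) (\<lambda>x. \<phi> n x - h x)) \<longlonglongrightarrow> 0"
    using u unfolding has_trace_def by blast
  obtain \<psi> where \<psi>: "\<forall>n. smooth (\<psi> n)" "(\<lambda>n. H1_norm \<Omega> (\<lambda>x. \<psi> n x - v x)) \<longlonglongrightarrow> 0"
      "(\<lambda>n. L2_norm (surface_measure \<Omega>) (\<lambda>x. \<psi> n x - k x)) \<longlonglongrightarrow> 0"
    using v unfolding has_trace_def by blast
  have swap: "(\<lambda>x. (\<phi> n x - \<psi> n x) - (a x - b x)) = (\<lambda>x. (\<phi> n x - a x) - (\<psi> n x - b x))" for n a b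
    by auto
  have "(\<lambda>n. H1_norm \<Omega> (\<lambda>x. (\<phi> n x - \<psi> n x) - (u x - v x))) \<longlonglongrightarrow> 0"
  proof (rule tendsto_sandwich[OF _ _ tendsto_const])
    show "(\<lambda>n. 2 * (H1_norm \<Omega> (\<lambda>x. \<phi> n x - u x) + H1_norm \<Omega> (\<lambda>x. \<psi> n x - v x))) \<longlonglongrightarrow> 0"
      using tendsto_mult_right_zero[OF tendsto_add_zero[OF \<phi>(2) \<psi>(2)], of 2] .
    show "\<forall>\<^sub>F n in sequentially. H1_norm \<Omega> (\<lambda>x. (\<phi> n x - \<psi> n x) - (u x - v x))
        \<le> 2 * (H1_norm \<Omega> (\<lambda>x. \<phi> n x - u x) + H1_norm \<Omega> (\<lambda>x. \<psi> n x - v x))"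
      unfolding swap
      by (intro always_eventually allI H1_norm_diff_le op(1) lm H1_diff(1) smooth_in_H1 op
          \<phi>(1)[rule_format] \<psi>(1)[rule_format] uv)
  qed simp
  moreover have "(\<lambda>n. L2_norm (surface_measure \<Omega>) (\<lambda>x. (\<phi> n x - \<psi> n x) - (h x - k x))) \<longlonglongrightarrow> 0"
  proof (rule tendsto_sandwich[OF _ _ tendsto_const])
    show "(\<lambda>n. 2 * (L2_norm (surface_measure \<Omega>) (\<lambda>x. \<phi> n x - h x)
        + L2_norm (surface_measure \<Omega>) (\<lambda>x. \<psi> n x - k x))) \<longlonglongrightarrow> 0"
      using tendsto_mult_right_zero[OF tendsto_add_zero[OF \<phi>(3) \<psi>(3)], of 2] .
    show "\<forall>\<^sub>F n in sequentially. L2_norm (surface_measure \<Omega>) (\<lambda>x. (\<phi> n x - \<psi> n x) - (h x - k x))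
        \<le> 2 * (L2_norm (surface_measure \<Omega>) (\<lambda>x. \<phi> n x - h x) + L2_norm (surface_measure \<Omega>) (\<lambda>x. \<psi> n x - k x))"
      unfolding swap
      by (intro always_eventually allI L2_norm_diff_le L2_diff hk L2_surface_measure_continuous[OF \<Omega>]
          smooth_continuous \<phi>(1)[rule_format] \<psi>(1)[rule_format])
  qed simp
  moreover have "\<forall>n. smooth (\<lambda>x. \<phi> n x - \<psi> n x)" using \<phi>(1) \<psi>(1) smooth_diff by blast
  ultimately show ?thesis unfolding has_trace_def
    using H1_diff(1)[OF op(1) lm uv] L2_diff[OF hk]
    by (intro conjI exI[of _ "\<lambda>n x. \<phi> n x - \<psi> n x"])
qed

text \<open>Both energy estimates obtain their test functions here: from a solution one subtracts an
  extension of the datum, or a second solution with the same datum.\<close>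

lemma H1_D_diff:
  fixes \<Omega> :: "'a::euclidean_space set"
  assumes \<Omega>: "bounded_lipschitz_domain \<Omega>" and u: "has_trace_on \<Omega> D u w" and v: "has_trace_on \<Omega> D v w"
  shows "(\<lambda>x. u x - v x) \<in> H1_D \<Omega> D"
proof -
  obtain h k where hk: "has_trace \<Omega> u h" "AE x in surface_measure \<Omega>. x \<in> D \<longrightarrow> h x = w x"
    "has_trace \<Omega> v k" "AE x in surface_measure \<Omega>. x \<in> D \<longrightarrow> k x = w x"
    using u v unfolding has_trace_on_def by blast
  note tr = has_trace_diff[OF \<Omega> hk(1,3)]
  have "AE x in surface_measure \<Omega>. x \<in> D \<longrightarrow> h x - k x = 0"
    using hk(2,4) by eventually_elim auto
  moreover have "(\<lambda>x. u x - v x) \<in> H1 \<Omega>" using tr by (simp add: has_trace_def)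
  ultimately show ?thesis using tr unfolding H1_D_def has_trace_on_def
    by (intro CollectI conjI exI[of _ "\<lambda>x. h x - k x"])
qed

section \<open>Poincare inequality for functions with vanishing trace\<close>

text \<open>On \<Gamma> the function \<open>f - h\<close> equals \<open>f\<close> almost everywhere,
  so its surface norm dominates the boundary part of \<open>sq_energy\<close>. It is also exactly
  the quantity that tends to zero along a sequence defining the trace \<open>h\<close>.\<close>

lemma poincare_smooth:
  fixes \<Omega> \<Gamma> :: "'a::euclidean_space set"
  assumes \<Omega>: "bounded_lipschitz_domain \<Omega>" and \<Gamma>: "\<Gamma> \<in> sets borel" "\<Gamma> \<subseteq> frontier \<Omega>"
    and pos: "0 < emeasure (surface_measure \<Omega>) \<Gamma>"
  shows "\<exists>K\<ge>0. \<forall>f g h. smooth f \<and> (\<forall>x. GDERIV f x :> g x) \<and> h \<in> L2 (surface_measure \<Omega>) \<and>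
      (AE x in surface_measure \<Omega>. x \<in> \<Gamma> \<longrightarrow> h x = 0) \<longrightarrow>
      (L2_norm (lebesgue_on \<Omega>) f)\<^sup>2 \<le>
        K * ((L2_norm (lebesgue_on \<Omega>) g)\<^sup>2 + (L2_norm (surface_measure \<Omega>) (\<lambda>x. f x - h x))\<^sup>2)"
proof -
  have op: "open \<Omega>" "bounded \<Omega>" using \<Omega> by (auto simp: bounded_lipschitz_domain_def)
  note lm = lipschitz_domain_lmeasurable[OF \<Omega>]
  have "0 < hausdorff_outer (DIM('a) - 1) \<Gamma>"
    using pos emeasure_surface_measure[OF \<Gamma>] by simp
  then obtain K where K: "K \<ge> 0" "\<forall>f g. smooth f \<and> (\<forall>x. GDERIV f x :> g x) \<longrightarrow>
      (\<integral>\<^sup>+x\<in>\<Omega>. ennreal ((f x)\<^sup>2) \<partial>lborel) \<le> ennreal K * sq_energy \<Omega> \<Gamma> f g"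
    using energy_controlled_domain[OF \<Omega> \<Gamma>] unfolding energy_controlled_def by blast
  have conv: "(\<integral>\<^sup>+x\<in>\<Omega>. ennreal ((norm (f x))\<^sup>2) \<partial>lborel) = ennreal ((L2_norm (lebesgue_on \<Omega>) f)\<^sup>2)"
    if c: "continuous_on UNIV f" for f :: "'a \<Rightarrow> 'b::euclidean_space"
  proof -
    have [measurable]: "f \<in> borel_measurable borel" using c by (rule borel_measurable_continuous_onI)
    have [measurable]: "\<Omega> \<in> sets borel" using op(1) by simp
    have "ennreal ((L2_norm (lebesgue_on \<Omega>) f)\<^sup>2) = (\<integral>\<^sup>+x. ennreal ((norm (f x))\<^sup>2) \<partial>lebesgue_on \<Omega>)"
      by (rule nn_integral_norm_power2[symmetric, OF L2_lebesgue_on_continuous[OF op(2) lm c]])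
    also have "\<dots> = (\<integral>\<^sup>+x\<in>\<Omega>. ennreal ((norm (f x))\<^sup>2) \<partial>lebesgue)"
      using lm by (subst nn_integral_restrict_space) auto
    also have "\<dots> = (\<integral>\<^sup>+x\<in>\<Omega>. ennreal ((norm (f x))\<^sup>2) \<partial>lborel)"
      by (rule nn_integral_completion)
    finally show ?thesis by simp
  qed
  have "(L2_norm (lebesgue_on \<Omega>) f)\<^sup>2 \<le>
        K * ((L2_norm (lebesgue_on \<Omega>) g)\<^sup>2 + (L2_norm (surface_measure \<Omega>) (\<lambda>x. f x - h x))\<^sup>2)"
    if f: "smooth f" and d: "\<forall>x. GDERIV f x :> g x" and h: "h \<in> L2 (surface_measure \<Omega>)"
      "AE x in surface_measure \<Omega>. x \<in> \<Gamma> \<longrightarrow> h x = 0" for f g h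
  proof -
    have cf: "continuous_on UNIV f" by (rule smooth_continuous[OF f])
    have cg: "continuous_on UNIV g" by (rule smooth_gradient_continuous[OF f d[rule_format]])
    have "(\<integral>\<^sup>+x\<in>\<Gamma>. ennreal ((f x)\<^sup>2) \<partial>hausdorff_measure (DIM('a) - 1))
        = (\<integral>\<^sup>+x\<in>\<Gamma>. ennreal ((f x)\<^sup>2) \<partial>surface_measure \<Omega>)"
      unfolding surface_measure_def
      by (subst nn_integral_restrict_space) (use \<Gamma>(2) in \<open>auto intro!: nn_integral_cong simp: indicator_def\<close>)
    also have "\<dots> \<le> (\<integral>\<^sup>+x. ennreal ((norm (f x - h x))\<^sup>2) \<partial>surface_measure \<Omega>)"
      by (rule nn_integral_mono_AE) (use h(2) in \<open>auto simp: indicator_def elim!: eventually_mono\<close>)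
    also have "\<dots> = ennreal ((L2_norm (surface_measure \<Omega>) (\<lambda>x. f x - h x))\<^sup>2)"
      by (rule nn_integral_norm_power2[OF L2_diff[OF L2_surface_measure_continuous[OF \<Omega> cf] h(1)]])
    finally have b: "(\<integral>\<^sup>+x\<in>\<Gamma>. ennreal ((f x)\<^sup>2) \<partial>hausdorff_measure (DIM('a) - 1))
        \<le> ennreal ((L2_norm (surface_measure \<Omega>) (\<lambda>x. f x - h x))\<^sup>2)" .
    have "ennreal ((L2_norm (lebesgue_on \<Omega>) f)\<^sup>2) = (\<integral>\<^sup>+x\<in>\<Omega>. ennreal ((f x)\<^sup>2) \<partial>lborel)"
      using conv[OF cf] by simp
    also have "\<dots> \<le> ennreal K * sq_energy \<Omega> \<Gamma> f g" using K(2) f d by blast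
    also have "\<dots> \<le> ennreal K * (ennreal ((L2_norm (lebesgue_on \<Omega>) g)\<^sup>2)
        + ennreal ((L2_norm (surface_measure \<Omega>) (\<lambda>x. f x - h x))\<^sup>2))"
      unfolding sq_energy_def conv[OF cg] using b by (intro mult_left_mono add_left_mono) simp_all
    also have "\<dots> = ennreal (K * ((L2_norm (lebesgue_on \<Omega>) g)\<^sup>2
        + (L2_norm (surface_measure \<Omega>) (\<lambda>x. f x - h x))\<^sup>2))"
      using K(1) by (simp add: ennreal_mult)
    finally show ?thesis using K(1) by (subst (asm) ennreal_le_iff) auto
  qed
  then show ?thesis using K(1) by blast
qed

text \<open>The smooth inequality is applied to the sequence that witnesses the trace, and the H1
  distance and the boundary term vanish in the limit. Passing from \<open>u\<close> to the
  approximation and from its gradient back to that of \<open>u\<close> costs a factor 2 each, whence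
  \<open>4 * K\<close>.\<close>

lemma poincare_H1_D:
  fixes \<Omega> D \<Gamma> :: "'a::euclidean_space set"
  assumes \<Omega>: "bounded_lipschitz_domain \<Omega>" and \<Gamma>: "\<Gamma> \<in> sets borel" "\<Gamma> \<subseteq> frontier \<Omega>" "\<Gamma> \<subseteq> D"
    and pos: "0 < emeasure (surface_measure \<Omega>) \<Gamma>"
  shows "\<exists>K\<ge>0. \<forall>u\<in>H1_D \<Omega> D.
    (L2_norm (lebesgue_on \<Omega>) u)\<^sup>2 \<le> K * (L2_norm (lebesgue_on \<Omega>) (weak_gradient \<Omega> u))\<^sup>2"
proof -
  have op: "open \<Omega>" "bounded \<Omega>" using \<Omega> by (auto simp: bounded_lipschitz_domain_def)
  note lm = lipschitz_domain_lmeasurable[OF \<Omega>]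
  obtain K where K: "K \<ge> 0" "\<forall>f g h. smooth f \<and> (\<forall>x. GDERIV f x :> g x) \<and> h \<in> L2 (surface_measure \<Omega>) \<and>
      (AE x in surface_measure \<Omega>. x \<in> \<Gamma> \<longrightarrow> h x = 0) \<longrightarrow>
      (L2_norm (lebesgue_on \<Omega>) f)\<^sup>2 \<le>
        K * ((L2_norm (lebesgue_on \<Omega>) g)\<^sup>2 + (L2_norm (surface_measure \<Omega>) (\<lambda>x. f x - h x))\<^sup>2)"
    using poincare_smooth[OF \<Omega> \<Gamma>(1,2) pos] by blast
  let ?N = "L2_norm (lebesgue_on \<Omega>)"
  have "(?N u)\<^sup>2 \<le> 4 * K * (?N (weak_gradient \<Omega> u))\<^sup>2" if u: "u \<in> H1_D \<Omega> D" for u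
  proof -
    obtain h where h: "has_trace \<Omega> u h" "AE x in surface_measure \<Omega>. x \<in> D \<longrightarrow> h x = 0"
      using u unfolding H1_D_def has_trace_on_def by blast
    have h0: "AE x in surface_measure \<Omega>. x \<in> \<Gamma> \<longrightarrow> h x = 0"
      using h(2) by eventually_elim (use \<Gamma>(3) in blast)
    have uH: "u \<in> H1 \<Omega>" and hL: "h \<in> L2 (surface_measure \<Omega>)" using h(1) by (auto simp: has_trace_def)
    obtain \<phi> where \<phi>: "\<forall>n. smooth (\<phi> n)" "(\<lambda>n. H1_norm \<Omega> (\<lambda>x. \<phi> n x - u x)) \<longlonglongrightarrow> 0"
      "(\<lambda>n. L2_norm (surface_measure \<Omega>) (\<lambda>x. \<phi> n x - h x)) \<longlonglongrightarrow> 0"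
      using h(1) unfolding has_trace_def by blast
    define a where "a n = H1_norm \<Omega> (\<lambda>x. \<phi> n x - u x)" for n
    define b where "b n = L2_norm (surface_measure \<Omega>) (\<lambda>x. \<phi> n x - h x)" for n
    have le: "(?N u)\<^sup>2 \<le> 2 * (K * ((2 * (?N (weak_gradient \<Omega> u))\<^sup>2 + 2 * (a n)\<^sup>2) + (b n)\<^sup>2)) + 2 * (a n)\<^sup>2" for n
    proof -
      note sm = \<phi>(1)[rule_format, of n]
      note \<phi>H = smooth_in_H1[OF op sm]
      note wu = H1_weak_gradient[OF uH] and w\<phi> = H1_weak_gradient[OF \<phi>H]
      note diff = H1_diff[OF op(1) lm \<phi>H uH]
      note wd = H1_weak_gradient[OF diff(1)]
      obtain g where g: "\<forall>x. GDERIV (\<phi> n) x :> g x" using smooth_gradient[OF sm] by blast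
      have cg: "continuous_on UNIV g" by (rule smooth_gradient_continuous[OF sm g[rule_format]])
      \<comment> \<open>A sum in the guise of a difference, so that
        \<open>L2_norm_diff_power2_le\<close> applies.\<close>
      have ga: "?N g = ?N (\<lambda>x. weak_gradient \<Omega> (\<lambda>x. \<phi> n x - u x) x - (- weak_gradient \<Omega> u x))"
      proof (rule L2_norm_cong_AE)
        show "g \<in> borel_measurable (lebesgue_on \<Omega>)" by (rule measurable_lebesgue_on_if_continuous[OF cg])
        show "(\<lambda>x. weak_gradient \<Omega> (\<lambda>x. \<phi> n x - u x) x - (- weak_gradient \<Omega> u x)) \<in> borel_measurable (lebesgue_on \<Omega>)"
          using L2_D(1)[OF wd(2)] L2_D(1)[OF wu(2)] by measurable
        show "AE x in lebesgue_on \<Omega>. g x = weak_gradient \<Omega> (\<lambda>x. \<phi> n x - u x) x - (- weak_gradient \<Omega> u x)"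
          using diff(2) H1_smooth(2)[OF op sm g[rule_format]] by eventually_elim simp
      qed
      have neg: "(\<lambda>x. - weak_gradient \<Omega> u x) \<in> L2 (lebesgue_on \<Omega>)" "?N (\<lambda>x. - weak_gradient \<Omega> u x) = ?N (weak_gradient \<Omega> u)"
        using wu(2) by (auto simp: L2_def L2_norm_def)
      have an: "(?N (\<lambda>x. \<phi> n x - u x))\<^sup>2 \<le> (a n)\<^sup>2" "(?N (weak_gradient \<Omega> (\<lambda>x. \<phi> n x - u x)))\<^sup>2 \<le> (a n)\<^sup>2"
        unfolding a_def H1_norm_power2 by auto
      have g2: "(?N g)\<^sup>2 \<le> 2 * (?N (weak_gradient \<Omega> u))\<^sup>2 + 2 * (a n)\<^sup>2"
        using L2_norm_diff_power2_le[OF wd(2) neg(1)] an(2) unfolding ga neg(2) by linarith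
      have "smooth (\<phi> n) \<and> (\<forall>x. GDERIV (\<phi> n) x :> g x) \<and> h \<in> L2 (surface_measure \<Omega>) \<and>
          (AE x in surface_measure \<Omega>. x \<in> \<Gamma> \<longrightarrow> h x = 0)"
        by (intro conjI sm g hL h0)
      from K(2)[rule_format, OF this] have "(?N (\<phi> n))\<^sup>2 \<le> K * ((?N g)\<^sup>2 + (b n)\<^sup>2)"
        unfolding b_def .
      also have "\<dots> \<le> K * ((2 * (?N (weak_gradient \<Omega> u))\<^sup>2 + 2 * (a n)\<^sup>2) + (b n)\<^sup>2)"
        using g2 K(1) by (intro mult_left_mono add_right_mono)
      finally have "(?N (\<phi> n))\<^sup>2 \<le> K * ((2 * (?N (weak_gradient \<Omega> u))\<^sup>2 + 2 * (a n)\<^sup>2) + (b n)\<^sup>2)" .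
      moreover have "(?N u)\<^sup>2 \<le> 2 * (?N (\<phi> n))\<^sup>2 + 2 * (?N (\<lambda>x. \<phi> n x - u x))\<^sup>2"
        using L2_norm_diff_power2_le[OF w\<phi>(1) wd(1)] by simp
      ultimately show ?thesis using an(1) by linarith
    qed
    have ab: "a \<longlonglongrightarrow> 0" "b \<longlonglongrightarrow> 0" using \<phi>(2,3) by (simp_all add: a_def[abs_def] b_def[abs_def])
    have "(\<lambda>n. 2 * (K * ((2 * (?N (weak_gradient \<Omega> u))\<^sup>2 + 2 * (a n)\<^sup>2) + (b n)\<^sup>2)) + 2 * (a n)\<^sup>2)
        \<longlonglongrightarrow> 2 * (K * ((2 * (?N (weak_gradient \<Omega> u))\<^sup>2 + 2 * 0\<^sup>2) + 0\<^sup>2)) + 2 * 0\<^sup>2"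
      by (intro tendsto_intros ab)
    from LIMSEQ_le_const[OF this] le
    have "(?N u)\<^sup>2 \<le> 2 * (K * ((2 * (?N (weak_gradient \<Omega> u))\<^sup>2 + 2 * 0\<^sup>2) + 0\<^sup>2)) + 2 * 0\<^sup>2" by blast
    then show ?thesis by simp
  qed
  then show ?thesis using K(1) by (intro exI[of _ "4 * K"]) auto
qed

section \<open>Energy estimates\<close>

text \<open>\<open>real_of_ereal\<close> sends both infinities to 0, so both must be examined.
  Membership in \<open>Linf\<close> excludes the positive one; a negative essential supremum forces
  a null space, where the bound is vacuous and the norm is 0.\<close>

lemma Linf_norm_bound:
  assumes "V \<in> Linf M"
  shows "AE x in M. \<bar>V x\<bar> \<le> Linf_norm M V" "0 \<le> Linf_norm M V"
proof -
  have [measurable]: "V \<in> borel_measurable M" using assms by (simp add: Linf_def)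
  obtain K where "AE x in M. \<bar>V x\<bar> \<le> K" using assms by (auto simp: Linf_def)
  then have "AE x in M. ereal \<bar>V x\<bar> \<le> ereal K" by simp
  then have "esssup M (\<lambda>x. ereal \<bar>V x\<bar>) \<le> ereal K" by (intro esssup_I) auto
  then have top: "esssup M (\<lambda>x. ereal \<bar>V x\<bar>) \<noteq> \<infinity>" by auto
  have ae: "AE x in M. ereal \<bar>V x\<bar> \<le> esssup M (\<lambda>x. ereal \<bar>V x\<bar>)" by (rule esssup_AE)
  have neg: "esssup M (\<lambda>x. ereal \<bar>V x\<bar>) = - \<infinity>" "AE x in M. False" if "esssup M (\<lambda>x. ereal \<bar>V x\<bar>) < 0"
  proof -
    show F: "AE x in M. False" using ae
    proof eventually_elim
      case (elim x)
      then have "ereal \<bar>V x\<bar> < 0" using that by (rule le_less_trans)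
      then show False by simp
    qed
    then have "emeasure M (space M) = 0" by (simp add: eventually_False ae_filter_eq_bot_iff)
    then show "esssup M (\<lambda>x. ereal \<bar>V x\<bar>) = - \<infinity>" by (rule esssup_zero_space) measurable
  qed
  show "0 \<le> Linf_norm M V"
    using neg(1) unfolding Linf_norm_def
    by (cases "esssup M (\<lambda>x. ereal \<bar>V x\<bar>)") (force simp: not_less)+
  show "AE x in M. \<bar>V x\<bar> \<le> Linf_norm M V"
  proof (cases "esssup M (\<lambda>x. ereal \<bar>V x\<bar>) < 0")
    case True
    from neg(2)[OF this] show ?thesis by eventually_elim simp
  next
    case False
    then obtain r where "esssup M (\<lambda>x. ereal \<bar>V x\<bar>) = ereal r"
      using top by (cases "esssup M (\<lambda>x. ereal \<bar>V x\<bar>)") auto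
    then show ?thesis using ae by (simp add: Linf_norm_def)
  qed
qed

lemma Linf_diff:
  assumes "V \<in> Linf M" "W \<in> Linf M"
  shows "(\<lambda>x. V x - W x) \<in> Linf M"
proof -
  obtain K L where "AE x in M. \<bar>V x\<bar> \<le> K" "AE x in M. \<bar>W x\<bar> \<le> L"
    using assms by (auto simp: Linf_def)
  then have "AE x in M. \<bar>V x - W x\<bar> \<le> K + L" by eventually_elim linarith
  then show ?thesis using assms by (auto simp: Linf_def)
qed

text \<open>The larger exponential is factored out and the rest is 1 + t \<le> exp t, which replaces
  the mean value theorem.\<close>

lemma abs_exp_diff_le:
  fixes x y m :: real
  assumes "x \<le> m" "y \<le> m"
  shows "\<bar>exp x - exp y\<bar> \<le> exp m * \<bar>x - y\<bar>"
proof -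
  have *: "exp a - exp b \<le> exp m * (a - b)" if "b \<le> a" "a \<le> m" for a b :: real
  proof -
    have "1 - exp (b - a) \<le> a - b" using exp_ge_add_one_self[of "b - a"] by linarith
    then have "exp a * (1 - exp (b - a)) \<le> exp a * (a - b)" by (rule mult_left_mono) simp
    also have "\<dots> \<le> exp m * (a - b)" using that by (intro mult_right_mono) auto
    finally show ?thesis by (simp add: right_diff_distrib exp_diff)
  qed
  show ?thesis
  proof (cases "y \<le> x")
    case True
    then show ?thesis using *[of y x] assms by simp
  next
    case False
    then show ?thesis using *[of x y] assms by simp
  qed
qed

text \<open>Dirichlet's principle with weight \<open>W\<close>: expanding
  \<open>W x * (norm (a x - b x))\<^sup>2 \<ge> 0\<close> leaves a mixed term with
  \<open>a x \<bullet> p x\<close>, whose integral vanishes. Here \<open>a\<close> is the gradient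
  of a solution and \<open>b\<close> that of any extension of the datum.\<close>

lemma weighted_energy_minimal:
  fixes a b p :: "'a \<Rightarrow> 'b::euclidean_space"
  assumes W: "W \<in> borel_measurable M" "AE x in M. c \<le> W x \<and> W x \<le> C" "c > 0"
    and L2: "a \<in> L2 M" "b \<in> L2 M" "p \<in> L2 M" "AE x in M. p x = a x - b x"
    and orth: "(LINT x|M. W x * (a x \<bullet> p x)) = 0"
  shows "c * (L2_norm M a)\<^sup>2 \<le> C * (L2_norm M b)\<^sup>2"
proof -
  have Wb: "AE x in M. \<bar>W x\<bar> \<le> C" using W(2) by eventually_elim (use W(3) in auto)
  note int = integrable_weighted_inner[OF W(1) Wb]
  have "c * (L2_norm M a)\<^sup>2 = (LINT x|M. c * (norm (a x))\<^sup>2)"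
    by (simp add: L2_norm_power2)
  also have "\<dots> \<le> (LINT x|M. 2 * (W x * (a x \<bullet> p x)) + C * (norm (b x))\<^sup>2)"
  proof (rule integral_mono_AE)
    show "integrable M (\<lambda>x. c * (norm (a x))\<^sup>2)" using L2_D(2)[OF L2(1)] by simp
    show "integrable M (\<lambda>x. 2 * (W x * (a x \<bullet> p x)) + C * (norm (b x))\<^sup>2)"
      using L2_D(2)[OF L2(2)] int[OF L2(1,3)] by simp
    show "AE x in M. c * (norm (a x))\<^sup>2 \<le> 2 * (W x * (a x \<bullet> p x)) + C * (norm (b x))\<^sup>2"
      using W(2) L2(4)
    proof eventually_elim
      case (elim x)
      have "0 \<le> W x * (norm (a x - b x))\<^sup>2" using elim W(3) by simp
      moreover have "(norm (a x - b x))\<^sup>2 = 2 * (a x \<bullet> p x) + (norm (b x))\<^sup>2 - (norm (a x))\<^sup>2"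
        unfolding elim(2) power2_norm_eq_inner by (simp add: inner_diff_left inner_diff_right inner_commute)
      ultimately have "W x * (norm (a x))\<^sup>2 \<le> 2 * (W x * (a x \<bullet> p x)) + W x * (norm (b x))\<^sup>2"
        by (simp add: algebra_simps)
      moreover have "c * (norm (a x))\<^sup>2 \<le> W x * (norm (a x))\<^sup>2" "W x * (norm (b x))\<^sup>2 \<le> C * (norm (b x))\<^sup>2"
        using elim(1) by (auto intro: mult_right_mono)
      ultimately show ?case by linarith
    qed
  qed
  also have "\<dots> = C * (L2_norm M b)\<^sup>2"
    using L2_D(2)[OF L2(2)] int[OF L2(1,3)] orth by (simp add: L2_norm_power2)
  finally show ?thesis .
qed

text \<open>Subtracting the two equations tested with the same function leaves only the term with
  \<open>W\<^sub>1 x - W\<^sub>2 x\<close>, which is linear in \<open>p\<close> and can be absorbed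
  by the quadratic term thanks to the lower bound \<open>c\<close>.\<close>

lemma weighted_energy_diff:
  fixes a\<^sub>1 a\<^sub>2 p :: "'a \<Rightarrow> 'b::euclidean_space"
  assumes W: "W\<^sub>1 \<in> borel_measurable M" "W\<^sub>2 \<in> borel_measurable M"
    "AE x in M. c \<le> W\<^sub>1 x \<and> W\<^sub>1 x \<le> C" "AE x in M. \<bar>W\<^sub>2 x\<bar> \<le> C" "AE x in M. \<bar>W\<^sub>1 x - W\<^sub>2 x\<bar> \<le> d" "c > 0"
    and L2: "a\<^sub>1 \<in> L2 M" "a\<^sub>2 \<in> L2 M" "p \<in> L2 M" "AE x in M. p x = a\<^sub>1 x - a\<^sub>2 x"
    and orth: "(LINT x|M. W\<^sub>1 x * (a\<^sub>1 x \<bullet> p x)) = 0" "(LINT x|M. W\<^sub>2 x * (a\<^sub>2 x \<bullet> p x)) = 0"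
  shows "c * (L2_norm M p)\<^sup>2 \<le> d\<^sup>2 / c * (L2_norm M a\<^sub>2)\<^sup>2"
proof -
  have Wb: "AE x in M. \<bar>W\<^sub>1 x\<bar> \<le> C" using W(3) by eventually_elim (use W(6) in auto)
  note int1 = integrable_weighted_inner[OF W(1) Wb L2(1,3)]
    and int2 = integrable_weighted_inner[OF W(2,4) L2(2,3)]
  have "c * (L2_norm M p)\<^sup>2 = (LINT x|M. c * (norm (p x))\<^sup>2)"
    by (simp add: L2_norm_power2)
  also have "\<dots> \<le> (LINT x|M. 2 * (W\<^sub>1 x * (a\<^sub>1 x \<bullet> p x)) - 2 * (W\<^sub>2 x * (a\<^sub>2 x \<bullet> p x)) + d\<^sup>2 / c * (norm (a\<^sub>2 x))\<^sup>2)"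
  proof (rule integral_mono_AE)
    show "integrable M (\<lambda>x. c * (norm (p x))\<^sup>2)" using L2_D(2)[OF L2(3)] by simp
    show "integrable M (\<lambda>x. 2 * (W\<^sub>1 x * (a\<^sub>1 x \<bullet> p x)) - 2 * (W\<^sub>2 x * (a\<^sub>2 x \<bullet> p x)) + d\<^sup>2 / c * (norm (a\<^sub>2 x))\<^sup>2)"
      by (intro Bochner_Integration.integrable_add Bochner_Integration.integrable_diff
          integrable_mult_right int1 int2 L2_D(2)[OF L2(2)])
    show "AE x in M. c * (norm (p x))\<^sup>2 \<le>
        2 * (W\<^sub>1 x * (a\<^sub>1 x \<bullet> p x)) - 2 * (W\<^sub>2 x * (a\<^sub>2 x \<bullet> p x)) + d\<^sup>2 / c * (norm (a\<^sub>2 x))\<^sup>2"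
      using W(3,5) L2(4)
    proof eventually_elim
      case (elim x)
      let ?s = "norm (a\<^sub>2 x)" and ?t = "norm (p x)"
      have "W\<^sub>1 x * ?t\<^sup>2 = W\<^sub>1 x * (a\<^sub>1 x \<bullet> p x) - W\<^sub>2 x * (a\<^sub>2 x \<bullet> p x) - (W\<^sub>1 x - W\<^sub>2 x) * (a\<^sub>2 x \<bullet> p x)"
        unfolding elim(3) power2_norm_eq_inner by (simp add: inner_diff_left algebra_simps)
      moreover have "- ((W\<^sub>1 x - W\<^sub>2 x) * (a\<^sub>2 x \<bullet> p x)) \<le> d * (?s * ?t)"
      proof -
        have "\<bar>W\<^sub>1 x - W\<^sub>2 x\<bar> * \<bar>a\<^sub>2 x \<bullet> p x\<bar> \<le> d * (?s * ?t)"
          using elim(2) Cauchy_Schwarz_ineq2[of "a\<^sub>2 x" "p x"] by (intro mult_mono) auto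
        then show ?thesis by (metis abs_ge_minus_self abs_mult order_trans)
      qed
      \<comment> \<open>Young's inequality with weight \<open>c\<close>. The identity above is used
        twice, so its left side is at least \<open>2 * c * ?t\<^sup>2\<close>; one copy absorbs the
        term produced here and one remains.\<close>
      moreover have "2 * (d * (?s * ?t)) \<le> c * ?t\<^sup>2 + d\<^sup>2 / c * ?s\<^sup>2"
      proof -
        have "0 \<le> (c * ?t - d * ?s)\<^sup>2 / c" using W(6) by simp
        also have "\<dots> = c * ?t\<^sup>2 + d\<^sup>2 / c * ?s\<^sup>2 - 2 * (d * (?s * ?t))"
          using W(6) by (simp add: power2_diff power_mult_distrib diff_divide_distrib add_divide_distrib)
            (simp add: power2_eq_square)
        finally show ?thesis by simp
      qed
      moreover have "c * ?t\<^sup>2 \<le> W\<^sub>1 x * ?t\<^sup>2" using elim(1) by (auto intro: mult_right_mono)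
      ultimately show ?case by linarith
    qed
  qed
  also have "\<dots> = d\<^sup>2 / c * (L2_norm M a\<^sub>2)\<^sup>2"
    using int1 int2 L2_D(2)[OF L2(2)] orth by (simp add: L2_norm_power2)
  finally show ?thesis .
qed

text \<open>The constant factor \<open>\<mu> * \<delta>\<^sup>2\<close> is nonzero and cancels; this
  is why the final constant can be chosen before \<delta> and \<mu>.\<close>

lemma continuity_orthogonality:
  fixes \<Omega> :: "'a::euclidean_space set"
  assumes "continuity_weak_solution \<Omega> D \<delta> \<mu> V U u" "\<delta> > 0" "\<mu> > 0" "\<phi> \<in> H1_D \<Omega> D"
  shows "(LINT x|lebesgue_on \<Omega>. exp (V x) * (weak_gradient \<Omega> u x \<bullet> weak_gradient \<Omega> \<phi> x)) = 0"
proof -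
  have "(LINT x|lebesgue_on \<Omega>. \<mu> * \<delta>\<^sup>2 * exp (V x) * (weak_gradient \<Omega> u x \<bullet> weak_gradient \<Omega> \<phi> x)) = 0"
    using assms(1,4) unfolding continuity_weak_solution_def by blast
  then have "(\<mu> * \<delta>\<^sup>2) * (LINT x|lebesgue_on \<Omega>. exp (V x) * (weak_gradient \<Omega> u x \<bullet> weak_gradient \<Omega> \<phi> x)) = 0"
    unfolding integral_mult_right_zero[symmetric] by (simp only: mult.assoc)
  then show ?thesis using assms(2,3) by simp
qed

lemma exp_Linf_bounds:
  assumes "V \<in> Linf M" "Linf_norm M V \<le> m"
  shows "(\<lambda>x. exp (V x)) \<in> borel_measurable M" "AE x in M. exp (- m) \<le> exp (V x) \<and> exp (V x) \<le> exp m"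
proof -
  have [measurable]: "V \<in> borel_measurable M" using assms(1) by (simp add: Linf_def)
  show "(\<lambda>x. exp (V x)) \<in> borel_measurable M" by measurable
  show "AE x in M. exp (- m) \<le> exp (V x) \<and> exp (V x) \<le> exp m"
    using Linf_norm_bound(1)[OF assms(1)] by eventually_elim (use assms(2) in auto)
qed

text \<open>The factor is the ratio of the upper bound exp(m) to the lower bound exp(-m) of the
  weight exp(V), m being the norm of \<open>V\<close>; \<open>weighted_energy_minimal\<close> is
  applied with \<open>u - w\<close> as test function.\<close>

lemma continuity_gradient_bound:
  fixes \<Omega> :: "'a::euclidean_space set"
  assumes \<Omega>: "bounded_lipschitz_domain \<Omega>" and V: "V \<in> Linf (lebesgue_on \<Omega>)"
    and u: "continuity_weak_solution \<Omega> D \<delta> \<mu> V U u" "\<delta> > 0" "\<mu> > 0"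
    and w: "has_trace_on \<Omega> D w U" "w \<in> H1 \<Omega>"
  shows "(L2_norm (lebesgue_on \<Omega>) (weak_gradient \<Omega> u))\<^sup>2 \<le>
    exp (2 * Linf_norm (lebesgue_on \<Omega>) V) * (L2_norm (lebesgue_on \<Omega>) (weak_gradient \<Omega> w))\<^sup>2"
proof -
  let ?M = "lebesgue_on \<Omega>"
  define m where "m = Linf_norm ?M V"
  have op: "open \<Omega>" using \<Omega> by (simp add: bounded_lipschitz_domain_def)
  note lm = lipschitz_domain_lmeasurable[OF \<Omega>]
  have uH: "u \<in> H1 \<Omega>" "has_trace_on \<Omega> D u U" using u(1) by (auto simp: continuity_weak_solution_def)
  have test: "(\<lambda>x. u x - w x) \<in> H1_D \<Omega> D" by (rule H1_D_diff[OF \<Omega> uH(2) w(1)])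
  note diff = H1_diff[OF op lm uH(1) w(2)]
  note W = exp_Linf_bounds[OF V order_refl, folded m_def]
  have "exp (- m) * (L2_norm ?M (weak_gradient \<Omega> u))\<^sup>2 \<le> exp m * (L2_norm ?M (weak_gradient \<Omega> w))\<^sup>2"
    by (rule weighted_energy_minimal[OF W _ H1_weak_gradient(2)[OF uH(1)] H1_weak_gradient(2)[OF w(2)]
          H1_weak_gradient(2)[OF diff(1)] diff(2) continuity_orthogonality[OF u test]]) simp
  then have "exp m * (exp (- m) * (L2_norm ?M (weak_gradient \<Omega> u))\<^sup>2) \<le> exp m * (exp m * (L2_norm ?M (weak_gradient \<Omega> w))\<^sup>2)"
    by (rule mult_left_mono) simp
  then show ?thesis by (simp add: mult.assoc[symmetric] exp_add[symmetric] m_def[symmetric])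
qed

theorem theorem5:
  fixes \<Omega> D N \<Gamma>P \<Gamma>N :: "'a::euclidean_space set"
    and U :: "'a \<Rightarrow> real"
  assumes "device_geometry \<Omega> D N \<Gamma>P \<Gamma>N"
    and "U \<in> H32 \<Omega> D"
  shows "\<exists>C\<^sub>D>0. \<forall>lam \<delta> \<mu> :: real. lam > 0 \<and> \<delta> > 0 \<and> \<mu> > 0 \<longrightarrow>
      (\<forall>C Vbi V u.
         doping_profile \<Omega> C \<and> builtin_potential \<Omega> D Vbi \<and>
         poisson_weak_solution \<Omega> D lam \<delta> C Vbi V \<and>
         continuity_weak_solution \<Omega> D \<delta> \<mu> V U u \<longrightarrow>
         H1_norm \<Omega> u \<le> C\<^sub>D * exp (2 * Linf_norm (lebesgue_on \<Omega>) V)) \<and>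
      (\<forall>C1 C2 Vbi1 Vbi2 V1 V2 u1 u2.
         doping_profile \<Omega> C1 \<and> builtin_potential \<Omega> D Vbi1 \<and>
         poisson_weak_solution \<Omega> D lam \<delta> C1 Vbi1 V1 \<and>
         continuity_weak_solution \<Omega> D \<delta> \<mu> V1 U u1 \<and>
         doping_profile \<Omega> C2 \<and> builtin_potential \<Omega> D Vbi2 \<and>
         poisson_weak_solution \<Omega> D lam \<delta> C2 Vbi2 V2 \<and>
         continuity_weak_solution \<Omega> D \<delta> \<mu> V2 U u2 \<longrightarrow>
         H1_norm \<Omega> (\<lambda>x. u1 x - u2 x) \<le>
           C\<^sub>D * exp (4 * max (Linf_norm (lebesgue_on \<Omega>) V1) (Linf_norm (lebesgue_on \<Omega>) V2)) *
           Linf_norm (lebesgue_on \<Omega>) (\<lambda>x. V1 x - V2 x))"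
proof -
  have \<Omega>: "bounded_lipschitz_domain \<Omega>" and op: "open \<Omega>"
    using assms(1) by (auto simp: device_geometry_def bounded_lipschitz_domain_def)
  note lm = lipschitz_domain_lmeasurable[OF \<Omega>]
  have "\<Gamma>P \<in> sets borel" "\<Gamma>P \<subseteq> frontier \<Omega>" "\<Gamma>P \<subseteq> D" "0 < emeasure (surface_measure \<Omega>) \<Gamma>P"
    using assms(1) by (auto simp: device_geometry_def)
  from poincare_H1_D[OF \<Omega> this] obtain K where K: "K \<ge> 0" "\<forall>u\<in>H1_D \<Omega> D.
      (L2_norm (lebesgue_on \<Omega>) u)\<^sup>2 \<le> K * (L2_norm (lebesgue_on \<Omega>) (weak_gradient \<Omega> u))\<^sup>2"
    by blast
  obtain w where w: "has_trace_on \<Omega> D w U" "w \<in> H1 \<Omega>"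
    using assms(2) by (auto simp: H32_def H2_def)
  let ?N = "L2_norm (lebesgue_on \<Omega>)" and ?L = "Linf_norm (lebesgue_on \<Omega>)"
  define A where "A = (?N w)\<^sup>2"
  define B where "B = (?N (weak_gradient \<Omega> w))\<^sup>2"
  have AB: "A \<ge> 0" "B \<ge> 0" by (auto simp: A_def B_def)
  \<comment> \<open>Up to the factor \<open>E\<close> below, \<open>2 * A + 8 * K * B\<close> bounds
    the squared norm of \<open>u\<close> and one more \<open>B\<close> that of its gradient. The
    summand 1 keeps the constant positive when \<open>A\<close> and \<open>B\<close> vanish.\<close>
  define S where "S = 2 * A + (8 * K + 1) * B + 1"
  have S: "S > 0" "(K + 1) * B \<le> S"
  proof -
    have "0 \<le> K * B" using K(1) AB by simp
    then show "S > 0" "(K + 1) * B \<le> S" using AB by (auto simp: S_def algebra_simps)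
  qed
  have part1: "H1_norm \<Omega> u \<le> sqrt S * exp (2 * ?L V)"
    if \<delta>\<mu>: "\<delta> > 0" "\<mu> > 0" and V: "V \<in> Linf (lebesgue_on \<Omega>)" and u: "continuity_weak_solution \<Omega> D \<delta> \<mu> V U u"
    for \<delta> \<mu> V u
  proof (rule power2_le_imp_le)
    have m: "?L V \<ge> 0" by (rule Linf_norm_bound(2)[OF V])
    define E where "E = exp (2 * ?L V)"
    have E: "E \<ge> 1" using m by (simp add: E_def)
    have uH: "u \<in> H1 \<Omega>" "has_trace_on \<Omega> D u U" using u by (auto simp: continuity_weak_solution_def)
    have test: "(\<lambda>x. u x - w x) \<in> H1_D \<Omega> D" by (rule H1_D_diff[OF \<Omega> uH(2) w(1)])
    note H = H1_diff[OF op lm uH(1) w(2)]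
    have grad: "(?N (weak_gradient \<Omega> u))\<^sup>2 \<le> E * B"
      unfolding B_def E_def by (rule continuity_gradient_bound[OF \<Omega> V u \<delta>\<mu> w])
    have "1 * B \<le> E * B" using E AB by (intro mult_right_mono)
    moreover have "(?N (weak_gradient \<Omega> (\<lambda>x. u x - w x)))\<^sup>2 \<le> 2 * (?N (weak_gradient \<Omega> u))\<^sup>2 + 2 * B"
      unfolding L2_norm_weak_gradient_diff[OF op lm uH(1) w(2)] B_def
      by (rule L2_norm_diff_power2_le[OF H1_weak_gradient(2)[OF uH(1)] H1_weak_gradient(2)[OF w(2)]])
    ultimately have "(?N (weak_gradient \<Omega> (\<lambda>x. u x - w x)))\<^sup>2 \<le> 4 * (E * B)" using grad by linarith
    then have "K * (?N (weak_gradient \<Omega> (\<lambda>x. u x - w x)))\<^sup>2 \<le> K * (4 * (E * B))"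
      using K(1) by (rule mult_left_mono)
    with K(2) test have d: "(?N (\<lambda>x. u x - w x))\<^sup>2 \<le> K * (4 * (E * B))" using order_trans by blast
    have "(?N u)\<^sup>2 = (?N (\<lambda>x. (u x - w x) - (- w x)))\<^sup>2" by simp
    also have "\<dots> \<le> 2 * (?N (\<lambda>x. u x - w x))\<^sup>2 + 2 * (?N (\<lambda>x. - w x))\<^sup>2"
      using H1_weak_gradient(1)[OF w(2)]
      by (intro L2_norm_diff_power2_le H1_weak_gradient(1)[OF H(1)]) (simp add: L2_def)
    also have "?N (\<lambda>x. - w x) = ?N w" by (simp add: L2_norm_def)
    finally have u2: "(?N u)\<^sup>2 \<le> 2 * (K * (4 * (E * B))) + 2 * A" using d by (simp add: A_def)
    have "1 * A \<le> E * A" by (rule mult_right_mono[OF E AB(1)])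
    then have "(H1_norm \<Omega> u)\<^sup>2 \<le> 2 * (K * (4 * (E * B))) + 2 * (E * A) + E * B + E"
      unfolding H1_norm_power2 using u2 grad E by linarith
    also have "\<dots> = S * E" by (simp add: S_def algebra_simps)
    \<comment> \<open>The bound \<open>S * E\<close> is already reached; the further factor
      \<open>E \<ge> 1\<close> only completes the square of the factor in the statement.\<close>
    also have "\<dots> \<le> S * (E * E)" using E S by (intro mult_left_mono) auto
    also have "\<dots> = (sqrt S * E)\<^sup>2" using S by (simp add: power_mult_distrib power2_eq_square)
    finally show "(H1_norm \<Omega> u)\<^sup>2 \<le> (sqrt S * exp (2 * ?L V))\<^sup>2" by (simp add: E_def)
  qed (use S in simp)
  have part2: "H1_norm \<Omega> (\<lambda>x. u1 x - u2 x) \<le> sqrt S * exp (4 * max (?L V1) (?L V2)) * ?L (\<lambda>x. V1 x - V2 x)"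
    if \<delta>\<mu>: "\<delta> > 0" "\<mu> > 0" and V: "V1 \<in> Linf (lebesgue_on \<Omega>)" "V2 \<in> Linf (lebesgue_on \<Omega>)"
      and u: "continuity_weak_solution \<Omega> D \<delta> \<mu> V1 U u1" "continuity_weak_solution \<Omega> D \<delta> \<mu> V2 U u2"
    for \<delta> \<mu> V1 V2 u1 u2
  proof (rule power2_le_imp_le)
    define m where "m = max (?L V1) (?L V2)"
    define d where "d = ?L (\<lambda>x. V1 x - V2 x)"
    have m: "?L V1 \<le> m" "?L V2 \<le> m" "0 \<le> m"
      using Linf_norm_bound(2)[OF V(1)] by (auto simp: m_def)
    note dV = Linf_norm_bound[OF Linf_diff[OF V], folded d_def]
    have u1H: "u1 \<in> H1 \<Omega>" "has_trace_on \<Omega> D u1 U" using u(1) by (auto simp: continuity_weak_solution_def)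
    have u2H: "u2 \<in> H1 \<Omega>" "has_trace_on \<Omega> D u2 U" using u(2) by (auto simp: continuity_weak_solution_def)
    have test: "(\<lambda>x. u1 x - u2 x) \<in> H1_D \<Omega> D" by (rule H1_D_diff[OF \<Omega> u1H(2) u2H(2)])
    note H = H1_diff[OF op lm u1H(1) u2H(1)]
    note W1 = exp_Linf_bounds[OF V(1) m(1)] and W2 = exp_Linf_bounds[OF V(2) m(2)]
    have W2b: "AE x in lebesgue_on \<Omega>. \<bar>exp (V2 x)\<bar> \<le> exp m" using W2(2) by eventually_elim simp
    have W12: "AE x in lebesgue_on \<Omega>. \<bar>exp (V1 x) - exp (V2 x)\<bar> \<le> exp m * d"
      using W1(2) W2(2) dV(1)
    proof eventually_elim
      case (elim x)
      have "\<bar>exp (V1 x) - exp (V2 x)\<bar> \<le> exp m * \<bar>V1 x - V2 x\<bar>"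
        using elim by (intro abs_exp_diff_le) auto
      also have "\<dots> \<le> exp m * d" using elim(3) by (intro mult_left_mono) auto
      finally show ?case .
    qed
    let ?p = "weak_gradient \<Omega> (\<lambda>x. u1 x - u2 x)"
    have "exp (- m) * (?N ?p)\<^sup>2 \<le> (exp m * d)\<^sup>2 / exp (- m) * (?N (weak_gradient \<Omega> u2))\<^sup>2"
      by (rule weighted_energy_diff[OF W1(1) W2(1) W1(2) W2b W12 _ H1_weak_gradient(2)[OF u1H(1)]
            H1_weak_gradient(2)[OF u2H(1)] H1_weak_gradient(2)[OF H(1)] H(2)
            continuity_orthogonality[OF u(1) \<delta>\<mu> test] continuity_orthogonality[OF u(2) \<delta>\<mu> test]]) simp
    also have "\<dots> \<le> (exp m * d)\<^sup>2 / exp (- m) * (exp (2 * m) * B)"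
    proof (rule mult_left_mono)
      have "(?N (weak_gradient \<Omega> u2))\<^sup>2 \<le> exp (2 * ?L V2) * B"
        unfolding B_def by (rule continuity_gradient_bound[OF \<Omega> V(2) u(2) \<delta>\<mu> w])
      also have "\<dots> \<le> exp (2 * m) * B" using m(2) AB by (intro mult_right_mono) auto
      finally show "(?N (weak_gradient \<Omega> u2))\<^sup>2 \<le> exp (2 * m) * B" .
    qed simp
    finally have le: "exp m * (exp (- m) * (?N ?p)\<^sup>2) \<le> exp m * ((exp m * d)\<^sup>2 / exp (- m) * (exp (2 * m) * B))"
      by (rule mult_left_mono) simp
    \<comment> \<open>The exponent counts: 1 from clearing \<open>exp (- m)\<close> on the left, 2
      from the squared difference of the weights, 1 from dividing by the lower bound, and 2 from the
      gradient of \<open>u2\<close>.\<close>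
    have p: "(?N ?p)\<^sup>2 \<le> exp (6 * m) * d\<^sup>2 * B"
    proof -
      have e1: "exp m * (exp (- m) * (?N ?p)\<^sup>2) = (?N ?p)\<^sup>2" by (simp add: exp_minus)
      have e2: "exp m * ((exp m * d)\<^sup>2 / exp (- m) * (exp (2 * m) * B))
          = (exp m * exp m * exp m * exp m * exp (2 * m)) * d\<^sup>2 * B"
        by (simp add: exp_minus power2_eq_square divide_inverse mult_ac)
      have e3: "exp m * exp m * exp m * exp m * exp (2 * m) = exp (6 * m)"
        by (simp add: exp_add[symmetric])
      show ?thesis using le unfolding e1 e2 e3 .
    qed
    have "(H1_norm \<Omega> (\<lambda>x. u1 x - u2 x))\<^sup>2 \<le> K * (?N ?p)\<^sup>2 + (?N ?p)\<^sup>2"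
      unfolding H1_norm_power2 using K(2) test by simp
    also have "\<dots> = (K + 1) * (?N ?p)\<^sup>2" by (simp add: algebra_simps)
    also have "\<dots> \<le> (K + 1) * (exp (6 * m) * d\<^sup>2 * B)" using p K(1) by (intro mult_left_mono) auto
    also have "\<dots> = ((K + 1) * B) * (exp (6 * m) * d\<^sup>2)" by simp
    also have "\<dots> \<le> S * (exp (8 * m) * d\<^sup>2)"
      using S m(3) by (intro mult_mono mult_right_mono) auto
    also have "exp (8 * m) = (exp (4 * m))\<^sup>2" by (simp add: exp_double[symmetric] power2_eq_square exp_add[symmetric])
    also have "S * ((exp (4 * m))\<^sup>2 * d\<^sup>2) = (sqrt S * exp (4 * m) * d)\<^sup>2"
      using S by (simp add: power_mult_distrib)
    finally show "(H1_norm \<Omega> (\<lambda>x. u1 x - u2 x))\<^sup>2 \<le>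
        (sqrt S * exp (4 * max (?L V1) (?L V2)) * ?L (\<lambda>x. V1 x - V2 x))\<^sup>2"
      by (simp add: m_def d_def)
    show "0 \<le> sqrt S * exp (4 * max (?L V1) (?L V2)) * ?L (\<lambda>x. V1 x - V2 x)"
      using S dV(2) by (simp add: d_def)
  qed
  have Linf: "V \<in> Linf (lebesgue_on \<Omega>)" if "poisson_weak_solution \<Omega> D lam \<delta> C Vbi V" for lam \<delta> C Vbi V
    using that by (simp add: poisson_weak_solution_def)
  show ?thesis
    using S(1) part1 part2 Linf by (intro exI[of _ "sqrt S"] conjI allI impI; (elim conjE)?) auto
qed

end
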